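(* Let $\Omega\subset\mathbb{R}^d$ ($d\ge 1$) be a bounded domain and let $\mu$ be a positive finite Borel measure on $\mathbb{R}^d$ with $\operatorname{supp}(\mu)\subset\overline{\Omega}$ and $\mu(\Omega)>0$. Assume $\underline{\dim}_\infty(\mu)>d-2$. Let the Dirichlet eigenvalues $\{\lambda_n\}_{n\ge1}$ of $-\Delta_\mu$ on $\Omega$ be arranged in increasing order (counted with multiplicity), and let $u_n$ be a $\lambda_n$-eigenfunction. Suppose $u_n\in C(\overline{\Omega})$ (i.e. $u_n$ is given by a function continuous on $\overline\Omega$, vanishing on $\partial\Omega$, which is used to define its nodal set). Then: (a) $u_1(\boldsymbol{x})\neq 0$ for all $\boldsymbol{x}\in\Omega$ (for a continuous $\lambda_1$-eigenfunction $u_1$); (b) for $n\ge 2$, if $\lambda_n$ has multiplicity $r\ge 1$, then the nodal set $\mathcal{Z}_\mu(u_n)=\{\boldsymbol{x}\in\Omega: u_n(\boldsymbol{x})=0\}$ divides $\Omega$ into at least $2$ and at most $n+r-1$ subdomains, i.e. $\Omega\setminus\mathcal{Z}_\mu(u_n)$ has at least $2$ and at most $n+r-1$ connected components.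
   Context: The lower $L^\infty$-dimension of $\mu$ is $\underline{\dim}_\infty(\mu)=\liminf_{\delta\to0^+}\frac{\ln(\sup_{\boldsymbol{x}\in\operatorname{supp}\mu}\mu(B_\delta(\boldsymbol{x})))}{\ln\delta}$. If $\underline{\dim}_\infty(\mu)>d-2$, the Poincaré inequality (MPI) holds: there is $C>0$ with $\int_\Omega|u|^2\,d\mu\le C\int_\Omega|\nabla u|^2\,d\boldsymbol{x}$ for all $u\in C_c^\infty(\Omega)$. Under (MPI), each $u\in H_0^1(\Omega)$ has a unique $L^2(\Omega,\mu)$-representative $\mathcal I(u)$: the $L^2(\Omega,\mu)$-limit of any sequence in $C_c^\infty(\Omega)$ converging to $u$ in $H_0^1(\Omega)$. Let $\mathcal N=\{u\in H_0^1(\Omega):\|\mathcal I(u)\|_{L^2(\Omega,\mu)}=0\}$ and $\mathcal N^\perp$ its orthogonal complement in $H_0^1(\Omega)$. The form $\mathcal E(u,v)=\int_\Omega\nabla u\cdot\nabla v\,d\boldsymbol{x}$ with domain $\mathcal N^\perp$ is closed on $L^2(\Omega,\mu)$, and the Krein–Feller (Dirichlet) operator $\Delta_\mu$ is defined so that $-\Delta_\mu$ is the nonnegative self-adjoint operator associated with $\mathcal E$. Equivalently, $u\in\operatorname{Dom}(\Delta_\mu)$ and $-\Delta_\mu u=f$ iff $u\in\mathcal N^\perp$, $f\in L^2(\Omega,\mu)$ and $\int_\Omega\nabla u\cdot\nabla\varphi\,d\boldsymbol{x}=\int_\Omega f\varphi\,d\mu$ for all $\varphi\in C_c^\infty(\Omega)$.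 A $\lambda$-eigenfunction is a nonzero $u\in\operatorname{Dom}(\Delta_\mu)$ with $-\Delta_\mu u=\lambda u$. Under $\underline{\dim}_\infty(\mu)>d-2$, $L^2(\Omega,\mu)$ has an orthonormal basis of such eigenfunctions with eigenvalues $0<\lambda_1\le\lambda_2\le\cdots\to\infty$. *)

theory Defs
  imports "HOL-Analysis.Analysis"
begin

coinductive smooth_fn :: "('a::euclidean_space \<Rightarrow> real) \<Rightarrow> bool" where
  "(\<And>x. (f has_derivative (\<lambda>h. D h x)) (at x)) \<Longrightarrow> (\<And>h. smooth_fn (D h)) \<Longrightarrow> smooth_fn f"

definition test_fn :: "'a::euclidean_space set \<Rightarrow> ('a \<Rightarrow> real) \<Rightarrow> bool" where
  "test_fn \<Omega> \<phi> \<longleftrightarrow> smooth_fn \<phi> \<and> compact (closure {x. \<phi> x \<noteq> 0})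
      \<and> closure {x. \<phi> x \<noteq> 0} \<subseteq> \<Omega>"

definition grad :: "('a::euclidean_space \<Rightarrow> real) \<Rightarrow> 'a \<Rightarrow> 'a" where
  "grad \<phi> x = (\<Sum>b\<in>Basis. frechet_derivative \<phi> (at x) b *\<^sub>R b)"

definition msupp :: "'a::metric_space measure \<Rightarrow> 'a set" where
  "msupp \<mu> = {x. \<forall>e>0. emeasure \<mu> (ball x e) > 0}"

definition lower_Linf_dim :: "'a::metric_space measure \<Rightarrow> ereal" where
  "lower_Linf_dim \<mu> = Liminf (at_right 0)
     (\<lambda>\<delta>::real. ereal (ln (SUP x\<in>msupp \<mu>. measure \<mu> (ball x \<delta>)) / ln \<delta>))"

text \<open>\<open>H01_rep \<Omega> \<mu> u g f\<close>: \<open>u\<close> (with weak gradient \<open>g\<close>) is an element of H_0^1(Omega),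
  approximated in H^1(Omega) by a sequence of test functions which converges to \<open>f\<close>
  in L^2(Omega, mu); i.e. f is (a representative of) I(u).\<close>
definition H01_rep :: "'a::euclidean_space set \<Rightarrow> 'a measure \<Rightarrow> ('a \<Rightarrow> real) \<Rightarrow> ('a \<Rightarrow> 'a)
    \<Rightarrow> ('a \<Rightarrow> real) \<Rightarrow> bool" where
  "H01_rep \<Omega> \<mu> u g f \<longleftrightarrow>
     u \<in> borel_measurable lebesgue \<and> g \<in> borel_measurable lebesgue \<and> f \<in> borel_measurable \<mu> \<and>
     (\<exists>\<phi>::nat \<Rightarrow> 'a \<Rightarrow> real. (\<forall>k. test_fn \<Omega> (\<phi> k)) \<and>
        ((\<lambda>k. \<integral>\<^sup>+x\<in>\<Omega>. ennreal ((\<phi> k x - u x)\<^sup>2) \<partial>lebesgue) \<longlonglongrightarrow> 0) \<and>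
        ((\<lambda>k. \<integral>\<^sup>+x\<in>\<Omega>. ennreal ((norm (grad (\<phi> k) x - g x))\<^sup>2) \<partial>lebesgue) \<longlonglongrightarrow> 0) \<and>
        ((\<lambda>k. \<integral>\<^sup>+x\<in>\<Omega>. ennreal ((\<phi> k x - f x)\<^sup>2) \<partial>\<mu>) \<longlonglongrightarrow> 0))"

text \<open>Membership in the orthogonal complement (w.r.t. the Dirichlet inner product of
  H_0^1(Omega)) of the null space \<open>N = {v. I(v) = 0}\<close>.\<close>
definition in_N_perp :: "'a::euclidean_space set \<Rightarrow> 'a measure \<Rightarrow> ('a \<Rightarrow> 'a) \<Rightarrow> bool" where
  "in_N_perp \<Omega> \<mu> g \<longleftrightarrow>
     (\<forall>v gv. H01_rep \<Omega> \<mu> v gv (\<lambda>_. 0) \<longrightarrow> (LINT x:\<Omega>|lebesgue. g x \<bullet> gv x) = 0)"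

text \<open>\<open>is_eigenfunction \<Omega> \<mu> t u g f\<close>: the H_0^1 element \<open>u\<close> (weak gradient \<open>g\<close>,
  L^2(mu)-representative \<open>f = I(u)\<close>) lies in Dom(Delta_mu), satisfies
  \<open>-Delta_mu u = t u\<close> and is nonzero.\<close>
definition is_eigenfunction :: "'a::euclidean_space set \<Rightarrow> 'a measure \<Rightarrow> real \<Rightarrow> ('a \<Rightarrow> real)
    \<Rightarrow> ('a \<Rightarrow> 'a) \<Rightarrow> ('a \<Rightarrow> real) \<Rightarrow> bool" where
  "is_eigenfunction \<Omega> \<mu> t u g f \<longleftrightarrow>
     H01_rep \<Omega> \<mu> u g f \<and> in_N_perp \<Omega> \<mu> g \<and>
     (\<integral>\<^sup>+x\<in>\<Omega>. ennreal ((f x)\<^sup>2) \<partial>\<mu>) < \<infinity> \<and>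
     (\<integral>\<^sup>+x\<in>\<Omega>. ennreal ((f x)\<^sup>2) \<partial>\<mu>) \<noteq> 0 \<and>
     (\<forall>\<phi>. test_fn \<Omega> \<phi> \<longrightarrow>
        (LINT x:\<Omega>|lebesgue. g x \<bullet> grad \<phi> x) = t * (LINT x:\<Omega>|\<mu>. f x * \<phi> x))"

definition is_eigenvalue :: "'a::euclidean_space set \<Rightarrow> 'a measure \<Rightarrow> real \<Rightarrow> bool" where
  "is_eigenvalue \<Omega> \<mu> t \<longleftrightarrow> (\<exists>u g f. is_eigenfunction \<Omega> \<mu> t u g f)"

definition orthonormal_eigen :: "'a::euclidean_space set \<Rightarrow> 'a measure \<Rightarrow> real \<Rightarrow> nat \<Rightarrow> bool" where
  "orthonormal_eigen \<Omega> \<mu> t r \<longleftrightarrow>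
     (\<exists>F :: nat \<Rightarrow> 'a \<Rightarrow> real.
        (\<forall>i<r. \<exists>u g. is_eigenfunction \<Omega> \<mu> t u g (F i)) \<and>
        (\<forall>i<r. \<forall>j<r. (LINT x:\<Omega>|\<mu>. F i x * F j x) = (if i = j then 1 else 0)))"

definition has_multiplicity :: "'a::euclidean_space set \<Rightarrow> 'a measure \<Rightarrow> real \<Rightarrow> nat \<Rightarrow> bool" where
  "has_multiplicity \<Omega> \<mu> t r \<longleftrightarrow>
     orthonormal_eigen \<Omega> \<mu> t r \<and> \<not> orthonormal_eigen \<Omega> \<mu> t (Suc r)"

text \<open>\<open>lam 1 \<le> lam 2 \<le> ...\<close> lists the Dirichlet eigenvalues in increasing order,
  each repeated according to its multiplicity (index 0 is unused).\<close>
definition eigen_arrangement :: "'a::euclidean_space set \<Rightarrow> 'a measure \<Rightarrow> (nat \<Rightarrow> real) \<Rightarrow> bool" where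
  "eigen_arrangement \<Omega> \<mu> lam \<longleftrightarrow>
     (\<forall>m n. 1 \<le> m \<longrightarrow> m \<le> n \<longrightarrow> lam m \<le> lam n) \<and>
     (\<forall>t. is_eigenvalue \<Omega> \<mu> t \<longleftrightarrow> (\<exists>n\<ge>1. lam n = t)) \<and>
     (\<forall>t. is_eigenvalue \<Omega> \<mu> t \<longrightarrow>
         finite {n. 1 \<le> n \<and> lam n = t} \<and> has_multiplicity \<Omega> \<mu> t (card {n. 1 \<le> n \<and> lam n = t}))"

text \<open>A continuous \<open>\<lambda>\<close>-eigenfunction: a function continuous on the closure of Omega,
  vanishing on the boundary, which represents the eigenfunction both as an element of
  H_0^1(Omega) and as an element of L^2(Omega,mu).\<close>
definition cont_eigenfunction :: "'a::euclidean_space set \<Rightarrow> 'a measure \<Rightarrow> real \<Rightarrow> ('a \<Rightarrow> real) \<Rightarrow> bool" where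
  "cont_eigenfunction \<Omega> \<mu> t u \<longleftrightarrow>
     continuous_on (closure \<Omega>) u \<and> (\<forall>x\<in>frontier \<Omega>. u x = 0) \<and>
     (\<exists>g. is_eigenfunction \<Omega> \<mu> t u g u)"

definition nodal_set :: "'a::euclidean_space set \<Rightarrow> ('a \<Rightarrow> real) \<Rightarrow> 'a set" where
  "nodal_set \<Omega> u = {x\<in>\<Omega>. u x = 0}"

end

theory Submission
  imports Defs "HOL-Complex_Analysis.Great_Picard"
begin

text \<open>The growth bound \<open>\<mu>(B(x,r)) \<le> C r\<^sup>s\<close> with \<open>s > d - 2\<close> makes the difference between a test function and
  its averages at scale \<open>R\<close> small in \<open>L\<^sup>2(\<mu>)\<close>, of order \<open>R\<close> to the power \<open>(s + 2 - d)/2\<close> times the energy norm.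
  As averages are bounded and equicontinuous, this gives the Poincare inequality and the compactness of
  \<open>H\<^sub>0\<^sup>1\<close> in \<open>L\<^sup>2(\<mu>)\<close>, so Rayleigh quotients attain their minimum on the orthogonal complement of finitely
  many eigenfunctions. The pieces of \<open>u\<^sub>n\<close> on its nodal components all have Rayleigh quotient \<open>\<lambda>\<^sub>n\<close>: were
  there more of them than eigenvalues \<open>\<le> \<lambda>\<^sub>n\<close>, some combination would be orthogonal to all the
  eigenfunctions concerned and the minimiser would be one eigenfunction too many. The positive part of a
  first eigenfunction is again one, hence superharmonic; the strong maximum principle gives (a). A
  higher eigenfunction of one sign would be positive, hence orthogonal to no nonnegative first eigenfunction,
  and two first eigenfunctions with disjoint supports contradict the maximum principle.\<close>

section \<open>Square-integrable functions\<close>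

text \<open>The measure may be singular with respect to Lebesgue measure, so an
  \<open>H01_rep\<close> element cannot be treated as one function: function, gradient and
  \<open>\<mu>\<close>-representative travel together as a triple, tied only by a common sequence of
  test functions. Every operation on triples is carried out on test functions first, which is why
  positive parts and restrictions to nodal domains go through smooth truncations and cutoffs.

  Only the eigenfunction under study is known to be continuous. Rayleigh minimisers and the other
  eigenfunctions of the same eigenvalue are mere classes, so the strong maximum principle is proved
  twice: pointwise, by comparing means at a zero, and almost everywhere, by an estimate in the mean.

  No unique continuation is invoked: all nodal pieces are kept and compared with every eigenvalue
  \<open>\<le> lam n\<close>. Such eigenvalues belong to the \<open>n - 1\<close> indices below
  \<open>n\<close> or to the \<open>r\<close> indices with value \<open>lam n\<close>, whence the
  bound \<open>n + r - 1\<close>.\<close>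

definition L2 :: "'a measure \<Rightarrow> ('a \<Rightarrow> 'b::euclidean_space) \<Rightarrow> bool" where
  "L2 M f \<longleftrightarrow> f \<in> borel_measurable M \<and> integrable M (\<lambda>x. (norm (f x))\<^sup>2)"

definition ip :: "'a measure \<Rightarrow> ('a \<Rightarrow> 'b::euclidean_space) \<Rightarrow> ('a \<Rightarrow> 'b) \<Rightarrow> real" where
  "ip M f h = (LINT x|M. f x \<bullet> h x)"

text \<open>Functions are not identified almost everywhere, so this is only a seminorm. Values in a
  Euclidean space let one theory serve functions and their gradients.\<close>

definition L2n :: "'a measure \<Rightarrow> ('a \<Rightarrow> 'b::euclidean_space) \<Rightarrow> real" where
  "L2n M f = sqrt (ip M f f)"

lemma L2_measurable [measurable_dest]: "L2 M f \<Longrightarrow> f \<in> borel_measurable M"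
  by (simp add: L2_def)

lemma L2I_bound:
  assumes "f \<in> borel_measurable M" "integrable M G" "AE x in M. (norm (f x))\<^sup>2 \<le> G x"
  shows "L2 M f"
  unfolding L2_def
proof
  show "integrable M (\<lambda>x. (norm (f x))\<^sup>2)"
    by (rule Bochner_Integration.integrable_bound[OF assms(2)]) (use assms in \<open>auto intro: order_trans\<close>)
qed (use assms in auto)

lemma L2_integrable_ip [intro]:
  assumes "L2 M f" "L2 M h"
  shows "integrable M (\<lambda>x. f x \<bullet> h x)"
proof (rule Bochner_Integration.integrable_bound)
  show "integrable M (\<lambda>x. (norm (f x))\<^sup>2 + (norm (h x))\<^sup>2)"
    using assms by (auto simp: L2_def)
  show "(\<lambda>x. f x \<bullet> h x) \<in> borel_measurable M"
    using assms by (auto simp: L2_def)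
  have "norm (f x \<bullet> h x) \<le> (norm (f x))\<^sup>2 + (norm (h x))\<^sup>2" for x
  proof -
    have "\<bar>f x \<bullet> h x\<bar> \<le> norm (f x) * norm (h x)"
      by (rule Cauchy_Schwarz_ineq2)
    moreover have "2 * (norm (f x) * norm (h x)) \<le> (norm (f x))\<^sup>2 + (norm (h x))\<^sup>2"
      using sum_squares_bound[of "norm (f x)" "norm (h x)"] by simp
    moreover have "0 \<le> norm (f x) * norm (h x)"
      by simp
    ultimately show ?thesis by simp
  qed
  then show "AE x in M. norm (f x \<bullet> h x) \<le> norm ((norm (f x))\<^sup>2 + (norm (h x))\<^sup>2)"
    by (intro always_eventually allI) (metis abs_of_nonneg norm_ge_zero real_norm_def order_trans)
qed

lemma L2_zero [simp, intro]: "L2 M (\<lambda>x. 0)"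
  by (simp add: L2_def)

lemma L2_scale [intro]:
  assumes "L2 M f"
  shows "L2 M (\<lambda>x. c *\<^sub>R f x)"
  using assms by (auto simp: L2_def power_mult_distrib)

lemma L2_cmult [intro]: "L2 M f \<Longrightarrow> L2 M (\<lambda>x. c * f x :: real)"
  using L2_scale[of M f c] by simp

lemma L2_uminus [intro]: "L2 M f \<Longrightarrow> L2 M (\<lambda>x. - f x)"
  using L2_scale[of M f "-1"] by simp

lemma L2_add [intro]:
  assumes "L2 M f" "L2 M h"
  shows "L2 M (\<lambda>x. f x + h x)"
  unfolding L2_def
proof
  show "(\<lambda>x. f x + h x) \<in> borel_measurable M" using assms by (auto simp: L2_def)
  have "integrable M (\<lambda>x. f x \<bullet> f x + 2 * (f x \<bullet> h x) + h x \<bullet> h x)"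
    using assms by (intro Bochner_Integration.integrable_add integrable_mult_right L2_integrable_ip)
  then show "integrable M (\<lambda>x. (norm (f x + h x))\<^sup>2)"
    by (simp add: power2_norm_eq_inner inner_add_left inner_add_right inner_commute algebra_simps)
qed

lemma L2_diff [intro]:
  assumes "L2 M f" "L2 M h"
  shows "L2 M (\<lambda>x. f x - h x)"
  using L2_add[OF assms(1) L2_uminus[OF assms(2)]] by simp

lemma L2_sum [intro]:
  assumes "\<And>i. i \<in> I \<Longrightarrow> L2 M (f i)"
  shows "L2 M (\<lambda>x. \<Sum>i\<in>I. f i x)"
  using assms by (induction I rule: infinite_finite_induct) auto

section \<open>Bilinearity, Cauchy-Schwarz and the triangle inequality\<close>

lemma ip_commute: "ip M f h = ip M h f"
  by (simp add: ip_def inner_commute)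

lemma ip_add_left:
  assumes "L2 M f" "L2 M h" "L2 M k"
  shows "ip M (\<lambda>x. f x + h x) k = ip M f k + ip M h k"
  unfolding ip_def inner_add_left using assms by (intro Bochner_Integration.integral_add) auto

lemma ip_scale_left: "ip M (\<lambda>x. c *\<^sub>R f x) k = c * ip M f k"
  by (simp add: ip_def)

lemma ip_cmult_left: "ip M (\<lambda>x. c * f x :: real) k = c * ip M f k"
  using ip_scale_left[of M c f k] by simp

lemma ip_diff_left:
  assumes "L2 M f" "L2 M h" "L2 M k"
  shows "ip M (\<lambda>x. f x - h x) k = ip M f k - ip M h k"
  unfolding ip_def inner_diff_left using assms by (intro Bochner_Integration.integral_diff) auto

lemma ip_add_right:
  assumes "L2 M f" "L2 M h" "L2 M k"
  shows "ip M k (\<lambda>x. f x + h x) = ip M k f + ip M k h"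
  using ip_add_left[OF assms] by (simp add: ip_commute)

lemma ip_diff_right:
  assumes "L2 M f" "L2 M h" "L2 M k"
  shows "ip M k (\<lambda>x. f x - h x) = ip M k f - ip M k h"
  using ip_diff_left[OF assms] by (simp add: ip_commute)

lemma ip_scale_right: "ip M k (\<lambda>x. c *\<^sub>R f x) = c * ip M k f"
  by (simp add: ip_def)

lemma ip_cmult_right: "ip M k (\<lambda>x. c * f x :: real) = c * ip M k f"
  using ip_scale_right[of M k c f] by simp

lemma ip_sum_left:
  assumes "\<And>i. i \<in> I \<Longrightarrow> L2 M (f i)" "L2 M k"
  shows "ip M (\<lambda>x. \<Sum>i\<in>I. f i x) k = (\<Sum>i\<in>I. ip M (f i) k)"
  using assms
proof (induction I rule: infinite_finite_induct)
  case (insert i I)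
  then show ?case by (simp add: ip_add_left L2_sum)
qed (auto simp: ip_def)

lemma ip_self_nonneg [simp]: "0 \<le> ip M f f"
  by (simp add: ip_def)

lemma L2n_nonneg [simp]: "0 \<le> L2n M f"
  by (simp add: L2n_def)

lemma L2n_sq: "(L2n M f)\<^sup>2 = ip M f f"
  by (simp add: L2n_def)

lemma L2n_scale: "L2n M (\<lambda>x. c *\<^sub>R f x) = \<bar>c\<bar> * L2n M f"
  by (simp add: L2n_def ip_scale_left ip_scale_right real_sqrt_mult flip: mult.assoc)

lemma L2n_zero [simp]: "L2n M (\<lambda>x. 0) = 0"
  by (simp add: L2n_def ip_def)

lemma L2n_minus_commute: "L2n M (\<lambda>x. f x - h x) = L2n M (\<lambda>x. h x - f x)"
  unfolding L2n_def ip_def by (simp add: inner_diff_left inner_diff_right algebra_simps)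

text \<open>The degenerate case \<open>C = 0\<close> is included because the lemma is also applied
  to a form that may vanish. With \<open>A = 0\<close> it says that the first variation at a minimum
  is zero.\<close>

lemma quadratic_nonneg_discrim:
  fixes A B C :: real
  assumes "\<And>t. 0 \<le> A + 2 * t * B + t\<^sup>2 * C" "0 \<le> C"
  shows "B\<^sup>2 \<le> A * C"
proof (cases "C = 0")
  case True
  have "B = 0"
  proof (rule ccontr)
    assume "B \<noteq> 0"
    \<comment> \<open>At the chosen \<open>t\<close> the affine function takes the value -1.\<close>
    then show False
      using assms(1)[of "- (A + 1) / (2 * B)"] True by (simp add: field_simps)
  qed
  with True show ?thesis by simp
next
  case False
  then have "C > 0" using assms by simp
  have "0 \<le> A + 2 * (- B / C) * B + (- B / C)\<^sup>2 * C" by (rule assms(1))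
  also have "\<dots> = (A * C - B\<^sup>2) / C"
    using False by (simp add: field_simps power2_eq_square)
  finally show ?thesis using \<open>C > 0\<close> by (simp add: zero_le_divide_iff)
qed

lemma ip_expand:
  assumes "L2 M f" "L2 M h"
  shows "ip M (\<lambda>x. f x + t *\<^sub>R h x) (\<lambda>x. f x + t *\<^sub>R h x)
    = ip M f f + 2 * t * ip M f h + t\<^sup>2 * ip M h h"
  using assms
  by (simp add: ip_add_left ip_add_right L2_add L2_scale ip_scale_left ip_scale_right
      ip_commute[of M h f] power2_eq_square algebra_simps)

lemma ip_Cauchy_Schwarz:
  assumes "L2 M f" "L2 M h"
  shows "\<bar>ip M f h\<bar> \<le> L2n M f * L2n M h"
proof -
  have "0 \<le> ip M f f + 2 * t * ip M f h + t\<^sup>2 * ip M h h" for t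
    using ip_expand[OF assms, of t] by (metis ip_self_nonneg)
  then have "(ip M f h)\<^sup>2 \<le> ip M f f * ip M h h"
    by (intro quadratic_nonneg_discrim) auto
  then have "sqrt ((ip M f h)\<^sup>2) \<le> sqrt (ip M f f * ip M h h)"
    by (rule real_sqrt_le_mono)
  then show ?thesis by (simp add: L2n_def real_sqrt_mult)
qed

lemma L2n_triangle:
  assumes "L2 M f" "L2 M h"
  shows "L2n M (\<lambda>x. f x + h x) \<le> L2n M f + L2n M h"
proof (rule power2_le_imp_le)
  have "(L2n M (\<lambda>x. f x + h x))\<^sup>2 = ip M f f + 2 * ip M f h + ip M h h"
    using ip_expand[OF assms, of 1] by (simp add: L2n_sq)
  also have "\<dots> \<le> (L2n M f + L2n M h)\<^sup>2"
    using ip_Cauchy_Schwarz[OF assms] by (simp add: power2_sum L2n_sq)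
  finally show "(L2n M (\<lambda>x. f x + h x))\<^sup>2 \<le> (L2n M f + L2n M h)\<^sup>2" .
qed simp

lemma L2n_triangle_diff:
  assumes "L2 M f" "L2 M h"
  shows "L2n M (\<lambda>x. f x - h x) \<le> L2n M f + L2n M h"
  using L2n_triangle[OF assms(1) L2_uminus[OF assms(2)]] L2n_scale[of M "-1" h] by simp

lemma L2n_diff_triangle:
  assumes "L2 M f" "L2 M h" "L2 M k"
  shows "L2n M (\<lambda>x. f x - k x) \<le> L2n M (\<lambda>x. f x - h x) + L2n M (\<lambda>x. h x - k x)"
  using L2n_triangle[of M "\<lambda>x. f x - h x" "\<lambda>x. h x - k x"] assms by auto

lemma L2n_diff_bound:
  assumes "L2 M f" "L2 M h"
  shows "\<bar>L2n M f - L2n M h\<bar> \<le> L2n M (\<lambda>x. f x - h x)"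
  using L2n_diff_triangle[OF assms L2_zero] L2n_diff_triangle[OF assms(2,1) L2_zero]
    L2n_minus_commute[of M f h] by auto

lemma L2n_mono:
  assumes "L2 M f" "L2 M h" "AE x in M. norm (f x) \<le> norm (h x)"
  shows "L2n M f \<le> L2n M h"
  unfolding L2n_def ip_def
proof (intro real_sqrt_le_mono integral_mono_AE)
  show "AE x in M. f x \<bullet> f x \<le> h x \<bullet> h x"
    using assms(3) by eventually_elim (metis norm_ge_zero power2_norm_eq_inner power_mono)
qed (use assms in auto)

lemma L2n_eq_0_iff:
  assumes "L2 M f"
  shows "L2n M f = 0 \<longleftrightarrow> (AE x in M. f x = 0)"
proof -
  have "L2n M f = 0 \<longleftrightarrow> (LINT x|M. f x \<bullet> f x) = 0"
    by (simp add: L2n_def ip_def)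
  also have "\<dots> \<longleftrightarrow> (AE x in M. f x \<bullet> f x = 0)"
    using assms by (intro integral_nonneg_eq_0_iff_AE) auto
  finally show ?thesis by simp
qed

section \<open>Limits, completeness and domination\<close>

lemma tendsto_ip:
  assumes "\<And>k. L2 M (F k)" "L2 M f" "\<And>k. L2 M (H k)" "L2 M h"
    "(\<lambda>k. L2n M (\<lambda>x. F k x - f x)) \<longlonglongrightarrow> 0" "(\<lambda>k. L2n M (\<lambda>x. H k x - h x)) \<longlonglongrightarrow> 0"
  shows "(\<lambda>k. ip M (F k) (H k)) \<longlonglongrightarrow> ip M f h"
proof -
  define B where "B k = L2n M (\<lambda>x. F k x - f x) * L2n M (\<lambda>x. H k x - h x)
      + L2n M (\<lambda>x. F k x - f x) * L2n M h + L2n M f * L2n M (\<lambda>x. H k x - h x)" for k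
  have "B \<longlonglongrightarrow> 0 * 0 + 0 * L2n M h + L2n M f * 0"
    unfolding B_def by (intro tendsto_intros assms)
  then have B0: "B \<longlonglongrightarrow> 0" by simp
  have "\<bar>ip M (F k) (H k) - ip M f h\<bar> \<le> B k" for k
  proof -
    have "ip M (F k) (H k) - ip M f h
      = ip M (\<lambda>x. F k x - f x) (\<lambda>x. H k x - h x) + ip M (\<lambda>x. F k x - f x) h + ip M f (\<lambda>x. H k x - h x)"
      using assms(1-4) by (simp add: ip_diff_left ip_diff_right L2_diff)
    then show ?thesis
      unfolding B_def
      using ip_Cauchy_Schwarz[of M "\<lambda>x. F k x - f x" "\<lambda>x. H k x - h x"]
        ip_Cauchy_Schwarz[of M "\<lambda>x. F k x - f x" h] ip_Cauchy_Schwarz[of M f "\<lambda>x. H k x - h x"]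
        assms(1-4) L2_diff by fastforce
  qed
  then have "(\<lambda>k. ip M (F k) (H k) - ip M f h) \<longlonglongrightarrow> 0"
    by (intro Lim_null_comparison[OF _ B0]) auto
  then show ?thesis by (simp add: LIM_zero_iff)
qed

lemma tendsto_L2n:
  assumes "\<And>k. L2 M (F k)" "L2 M f" "(\<lambda>k. L2n M (\<lambda>x. F k x - f x)) \<longlonglongrightarrow> 0"
  shows "(\<lambda>k. L2n M (F k)) \<longlonglongrightarrow> L2n M f"
  unfolding L2n_def using assms by (intro tendsto_real_sqrt tendsto_ip)

lemma (in finite_measure) L1_le_L2n:
  assumes "L2 M f"
  shows "integrable M (\<lambda>x. norm (f x))"
    and "(LINT x|M. norm (f x)) \<le> L2n M f * sqrt (measure M (space M))"
proof -
  have 1: "L2 M (\<lambda>x. 1::real)" by (simp add: L2_def)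
  have 2: "L2 M (\<lambda>x. norm (f x))" using assms by (auto simp: L2_def)
  show "integrable M (\<lambda>x. norm (f x))"
    using L2_integrable_ip[OF 2 1] by simp
  have "(LINT x|M. norm (f x)) = ip M (\<lambda>x. norm (f x)) (\<lambda>x. 1)"
    by (simp add: ip_def)
  also have "\<dots> \<le> L2n M (\<lambda>x. norm (f x)) * L2n M (\<lambda>x. 1::real)"
    using ip_Cauchy_Schwarz[OF 2 1] by simp
  also have "L2n M (\<lambda>x. norm (f x)) = L2n M f"
    by (simp add: L2n_def ip_def power2_norm_eq_inner flip: power2_eq_square)
  also have "L2n M (\<lambda>x. 1::real) = sqrt (measure M (space M))"
    by (simp add: L2n_def ip_def)
  finally show "(LINT x|M. norm (f x)) \<le> L2n M f * sqrt (measure M (space M))" .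
qed

text \<open>Finite total mass turns \<open>L2\<close> convergence into \<open>L1\<close>
  convergence, which has almost everywhere convergent subsequences.\<close>

lemma (in finite_measure) L2_AE_subseq:
  fixes F :: "nat \<Rightarrow> 'a \<Rightarrow> 'b::euclidean_space"
  assumes F: "\<And>k. L2 M (F k)" "L2 M f" "(\<lambda>k. L2n M (\<lambda>x. F k x - f x)) \<longlonglongrightarrow> 0"
  obtains r where "strict_mono (r::nat \<Rightarrow> nat)" "AE x in M. (\<lambda>k. F (r k) x) \<longlonglongrightarrow> f x"
proof -
  have D: "L2 M (\<lambda>x. F k x - f x)" for k using F by auto
  have int: "integrable M (\<lambda>x. F k x - f x)" for k
    using L1_le_L2n(1)[OF D] F D by (subst integrable_norm_iff[symmetric]) (auto simp: L2_def)
  have "(\<lambda>k. LINT x|M. norm (F k x - f x)) \<longlonglongrightarrow> 0"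
  proof (rule tendsto_sandwich[OF _ _ tendsto_const])
    have "(\<lambda>k. L2n M (\<lambda>x. F k x - f x) * sqrt (measure M (space M))) \<longlonglongrightarrow> 0 * sqrt (measure M (space M))"
      by (intro tendsto_intros F)
    then show "(\<lambda>k. L2n M (\<lambda>x. F k x - f x) * sqrt (measure M (space M))) \<longlonglongrightarrow> 0" by simp
  qed (use L1_le_L2n(2)[OF D] in auto)
  from tendsto_L1_AE_subseq[OF int this] obtain r where
    r: "strict_mono r" "AE x in M. (\<lambda>k. F (r k) x - f x) \<longlonglongrightarrow> 0" by auto
  from r(2) have "AE x in M. (\<lambda>k. F (r k) x) \<longlonglongrightarrow> f x"
    by eventually_elim (simp add: LIM_zero_iff)
  with r(1) show ?thesis by (rule that)
qed

text \<open>Fatou's lemma for the squared norms; finiteness of the bound is what puts the pointwise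
  limit into \<open>L2\<close>. A bound on a tail is enough, which is the form in which Cauchy
  sequences provide it.\<close>

lemma L2_Fatou:
  fixes F :: "nat \<Rightarrow> 'a \<Rightarrow> 'b::euclidean_space"
  assumes F: "\<And>k. L2 M (F k)" "f \<in> borel_measurable M" "AE x in M. (\<lambda>k. F k x) \<longlonglongrightarrow> f x"
    and B: "\<And>k. k \<ge> N \<Longrightarrow> L2n M (F k) \<le> B"
  shows "L2 M f" "L2n M f \<le> B"
proof -
  have B0: "0 \<le> B" using B[of N] L2n_nonneg[of M "F N"] by linarith
  have "(\<integral>\<^sup>+x. ennreal ((norm (f x))\<^sup>2) \<partial>M) = (\<integral>\<^sup>+x. liminf (\<lambda>k. ennreal ((norm (F k x))\<^sup>2)) \<partial>M)"
  proof (rule nn_integral_cong_AE)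
    show "AE x in M. ennreal ((norm (f x))\<^sup>2) = liminf (\<lambda>k. ennreal ((norm (F k x))\<^sup>2))"
      using F(3)
    proof eventually_elim
      case (elim x)
      then have "(\<lambda>k. ennreal ((norm (F k x))\<^sup>2)) \<longlonglongrightarrow> ennreal ((norm (f x))\<^sup>2)"
        by (intro tendsto_intros)
      then show ?case
        by (metis lim_imp_Liminf trivial_limit_sequentially)
    qed
  qed
  also have "\<dots> \<le> liminf (\<lambda>k. \<integral>\<^sup>+x. ennreal ((norm (F k x))\<^sup>2) \<partial>M)"
    by (rule nn_integral_liminf) (use F(1) in \<open>auto simp: L2_def\<close>)
  also have "\<dots> \<le> ennreal (B\<^sup>2)"
  proof -
    have eq: "(\<integral>\<^sup>+x. ennreal ((norm (F k x))\<^sup>2) \<partial>M) = ennreal ((L2n M (F k))\<^sup>2)" for k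
      using F(1)[of k] by (subst nn_integral_eq_integral)
        (auto simp: L2_def L2n_sq ip_def power2_norm_eq_inner)
    have "\<forall>\<^sub>F k in sequentially. (\<integral>\<^sup>+x. ennreal ((norm (F k x))\<^sup>2) \<partial>M) \<le> ennreal (B\<^sup>2)"
      unfolding eq using eventually_ge_at_top[of N]
      by eventually_elim (auto intro!: ennreal_leI power_mono B)
    then show ?thesis
      using Liminf_mono[of _ "\<lambda>_. ennreal (B\<^sup>2)" sequentially] by (simp add: Liminf_const)
  qed
  finally have le: "(\<integral>\<^sup>+x. ennreal ((norm (f x))\<^sup>2) \<partial>M) \<le> ennreal (B\<^sup>2)" .
  show L: "L2 M f"
    unfolding L2_def using F(2) le
    by (auto intro!: integrableI_nonneg simp: order_le_less_trans)
  have "ennreal ((L2n M f)\<^sup>2) \<le> ennreal (B\<^sup>2)"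
    using le L by (subst (asm) nn_integral_eq_integral)
      (auto simp: L2_def L2n_sq ip_def power2_norm_eq_inner)
  then show "L2n M f \<le> B"
    using B0 by (simp add: power_mono_iff)
qed

text \<open>Riesz-Fischer: along a subsequence with increments below \<open>(1/2)^j\<close> the
  \<open>L1\<close> norms of the increments are summable, so it converges absolutely almost
  everywhere. Fatou then passes the Cauchy estimate on to the limit.\<close>

lemma (in finite_measure) L2_complete:
  fixes F :: "nat \<Rightarrow> 'a \<Rightarrow> 'b::euclidean_space"
  assumes F: "\<And>k. L2 M (F k)"
    and C: "\<And>e. e > 0 \<Longrightarrow> \<exists>N. \<forall>m\<ge>N. \<forall>n\<ge>N. L2n M (\<lambda>x. F m x - F n x) < e"
  obtains f where "L2 M f" "(\<lambda>k. L2n M (\<lambda>x. F k x - f x)) \<longlonglongrightarrow> 0"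
proof -
  define c where "c = sqrt (measure M (space M))"
  have D: "L2 M (\<lambda>x. F m x - F n x)" for m n using F by auto
  obtain N where N: "\<And>j m n. m \<ge> N j \<Longrightarrow> n \<ge> N j \<Longrightarrow> L2n M (\<lambda>x. F m x - F n x) < (1/2)^j"
    using C[of "(1/2)^j" for j] by (metis zero_less_power half_gt_zero zero_less_one)
  \<comment> \<open>The partial sum dominates \<open>N j\<close>, and the extra \<open>j\<close>
    makes the indices strictly increasing.\<close>
  define r where "r j = (\<Sum>i\<le>j. N i) + j" for j
  have rN: "r j \<ge> N j" for j
    unfolding r_def by (rule trans_le_add1) (rule member_le_sum, auto)
  have rS: "r (Suc j) \<ge> N j" for j
    using rN[of j] by (simp add: r_def)
  have "r j < r (Suc j)" for j by (simp add: r_def)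
  then have rm: "strict_mono r" by (rule strict_monoI_Suc)
  define d where "d j x = norm (F (r (Suc j)) x - F (r j) x)" for j x
  have dm[measurable]: "d j \<in> borel_measurable M" for j
    unfolding d_def using L2_measurable[OF F] by measurable
  have di: "integrable M (d j)" "(LINT x|M. d j x) \<le> (1/2)^j * c" for j
  proof -
    show "integrable M (d j)" unfolding d_def by (rule L1_le_L2n(1)[OF D])
    have "(LINT x|M. d j x) \<le> L2n M (\<lambda>x. F (r (Suc j)) x - F (r j) x) * c"
      unfolding d_def c_def by (rule L1_le_L2n(2)[OF D])
    also have "\<dots> \<le> (1/2)^j * c"
      using N[OF rS rN, of j] by (intro mult_right_mono) (auto simp: c_def)
    finally show "(LINT x|M. d j x) \<le> (1/2)^j * c" .
  qed
  have "(\<integral>\<^sup>+x. (\<Sum>j. ennreal (d j x)) \<partial>M) = (\<Sum>j. \<integral>\<^sup>+x. ennreal (d j x) \<partial>M)"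
    by (rule nn_integral_suminf) auto
  also have "\<dots> = (\<Sum>j. ennreal (LINT x|M. d j x))"
    using di(1) by (subst nn_integral_eq_integral) (auto simp: d_def)
  also have "\<dots> \<le> (\<Sum>j. ennreal ((1/2)^j * c))"
    by (intro suminf_le ennreal_leI di) auto
  also have "\<dots> < \<infinity>"
  proof -
    have "summable (\<lambda>j. (1/2::real)^j * c)"
      by (intro summable_mult2 summable_geometric) auto
    then have "(\<Sum>j. ennreal ((1/2)^j * c)) = ennreal (\<Sum>j. (1/2)^j * c)"
      by (intro suminf_ennreal2) (auto simp: c_def)
    then show ?thesis by simp
  qed
  finally have fin: "(\<integral>\<^sup>+x. (\<Sum>j. ennreal (d j x)) \<partial>M) \<noteq> \<infinity>" by simp
  have "AE x in M. (\<Sum>j. ennreal (d j x)) \<noteq> \<infinity>"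
    by (rule nn_integral_PInf_AE[OF _ fin]) auto
  then have conv: "AE x in M. convergent (\<lambda>j. F (r j) x)"
  proof eventually_elim
    case (elim x)
    have "summable (\<lambda>j. d j x)"
      by (rule summable_suminf_not_top) (use elim in \<open>auto simp: d_def\<close>)
    then have "summable (\<lambda>j. F (r (Suc j)) x - F (r j) x)"
      unfolding d_def by (rule summable_norm_cancel)
    then have "convergent (\<lambda>j. (\<Sum>i<j. F (r (Suc i)) x - F (r i) x) + F (r 0) x)"
      by (intro convergent_add convergent_const) (simp add: summable_iff_convergent)
    then show ?case
      using sum_lessThan_telescope[of "\<lambda>j. F (r j) x"] by simp
  qed
  define f where "f x = lim (\<lambda>j. F (r j) x)" for x
  have fm: "f \<in> borel_measurable M"
    unfolding f_def by (rule borel_measurable_lim_metric) (use F in \<open>auto simp: L2_def\<close>)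
  have ae: "AE x in M. (\<lambda>j. F (r j) x) \<longlonglongrightarrow> f x"
    using conv by eventually_elim (simp add: f_def convergent_LIMSEQ_iff)
  have "L2n M (F k) \<le> 1 + L2n M (F (N 0))" if "k \<ge> N 0" for k
    using L2n_diff_bound[OF F[of k] F[of "N 0"]] N[of 0 k "N 0"] that by auto
  then have "L2n M (F (r k)) \<le> 1 + L2n M (F (N 0))" if "k \<ge> N 0" for k
    using that strict_mono_imp_increasing[OF rm, of k] by auto
  then have Lf: "L2 M f"
    by (rule L2_Fatou(1)[OF F fm ae])
  have est: "L2n M (\<lambda>x. F m x - f x) \<le> (1/2)^j" if "m \<ge> N j" for m j
  proof (rule L2_Fatou(2))
    show "L2 M (\<lambda>x. F m x - F (r k) x)" for k by (rule D)
    show "(\<lambda>x. F m x - f x) \<in> borel_measurable M"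
      using L2_measurable[OF F] fm by measurable
    show "AE x in M. (\<lambda>k. F m x - F (r k) x) \<longlonglongrightarrow> F m x - f x"
      using ae by eventually_elim (intro tendsto_intros)
    show "L2n M (\<lambda>x. F m x - F (r k) x) \<le> (1/2)^j" if "k \<ge> N j" for k
      using N[of j m "r k"] \<open>m \<ge> N j\<close> that strict_mono_imp_increasing[OF rm, of k] by auto
  qed
  have "(\<lambda>k. L2n M (\<lambda>x. F k x - f x)) \<longlonglongrightarrow> 0"
  proof (rule LIMSEQ_I)
    fix e :: real assume "e > 0"
    then obtain j where j: "(1/2)^j < e" using real_arch_pow_inv[of e "1/2"] by auto
    show "\<exists>n0. \<forall>n\<ge>n0. norm (L2n M (\<lambda>x. F n x - f x) - 0) < e"
      using est[of j] j by (intro exI[of _ "N j"]) force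
  qed
  with Lf show ?thesis by (rule that)
qed

lemma L2_dominated:
  fixes F :: "nat \<Rightarrow> 'a \<Rightarrow> 'b::euclidean_space"
  assumes F: "\<And>k. F k \<in> borel_measurable M" "f \<in> borel_measurable M" "L2 M G"
    and ae: "AE x in M. (\<lambda>k. F k x) \<longlonglongrightarrow> f x"
    and bd: "\<And>k. AE x in M. norm (F k x) \<le> norm (G x)"
  shows "L2 M f" "\<And>k. L2 M (F k)" "(\<lambda>k. L2n M (\<lambda>x. F k x - f x)) \<longlonglongrightarrow> 0"
proof -
  have G: "integrable M (\<lambda>x. (norm (G x))\<^sup>2)" using F(3) by (simp add: L2_def)
  show LF: "L2 M (F k)" for k
    by (rule L2I_bound[OF F(1) G]) (use bd[of k] in \<open>eventually_elim, auto intro: power_mono\<close>)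
  have bf: "AE x in M. norm (f x) \<le> norm (G x)"
  proof -
    have "AE x in M. \<forall>k. norm (F k x) \<le> norm (G x)" using bd by (simp add: AE_all_countable)
    with ae show ?thesis
    proof eventually_elim
      case (elim x)
      have "(\<lambda>k. norm (F k x)) \<longlonglongrightarrow> norm (f x)" using elim by (intro tendsto_intros)
      then show ?case using elim by (intro LIMSEQ_le_const2) auto
    qed
  qed
  show Lf: "L2 M f"
    by (rule L2I_bound[OF F(2) G]) (use bf in \<open>eventually_elim, auto intro: power_mono\<close>)
  have "(\<lambda>k. LINT x|M. (norm (F k x - f x))\<^sup>2) \<longlonglongrightarrow> (LINT x|M. 0)"
  proof (rule integral_dominated_convergence)
    show "integrable M (\<lambda>x. 4 * (norm (G x))\<^sup>2)" using G by simp
    show "(\<lambda>x. (norm (F k x - f x))\<^sup>2) \<in> borel_measurable M" for k using F by measurable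
    show "AE x in M. (\<lambda>k. (norm (F k x - f x))\<^sup>2) \<longlonglongrightarrow> 0"
      using ae
    proof eventually_elim
      case (elim x)
      then have "(\<lambda>k. (norm (F k x - f x))\<^sup>2) \<longlonglongrightarrow> (norm (f x - f x))\<^sup>2"
        by (intro tendsto_intros)
      then show ?case by simp
    qed
    show "AE x in M. norm ((norm (F k x - f x))\<^sup>2) \<le> 4 * (norm (G x))\<^sup>2" for k
      using bf bd[of k]
    proof eventually_elim
      case (elim x)
      have "norm (F k x - f x) \<le> 2 * norm (G x)"
        using norm_triangle_ineq4[of "F k x" "f x"] elim by linarith
      then have "(norm (F k x - f x))\<^sup>2 \<le> (2 * norm (G x))\<^sup>2" by (intro power_mono) auto
      then show ?case by (simp add: power_mult_distrib)
    qed
  qed simp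
  then have "(\<lambda>k. sqrt (LINT x|M. (norm (F k x - f x))\<^sup>2)) \<longlonglongrightarrow> sqrt 0"
    by (intro tendsto_real_sqrt) simp
  then show "(\<lambda>k. L2n M (\<lambda>x. F k x - f x)) \<longlonglongrightarrow> 0"
    by (simp add: L2n_def ip_def power2_norm_eq_inner)
qed

lemma (in finite_measure) L2_bounded:
  fixes f :: "'a \<Rightarrow> 'b::euclidean_space"
  assumes "f \<in> borel_measurable M" "\<And>x. norm (f x) \<le> B"
  shows "L2 M f" "L2n M f \<le> B * sqrt (measure M (space M))"
proof -
  have B: "B \<ge> 0" using assms(2) norm_ge_zero order_trans by blast
  show f: "L2 M f"
    by (rule L2I_bound[OF assms(1) integrable_const[of "B\<^sup>2"]])
      (intro always_eventually allI power_mono assms(2), simp)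
  have c: "L2 M (\<lambda>x. B)" by (simp add: L2_def)
  have "L2n M f \<le> L2n M (\<lambda>x. B)"
    using assms(2) B by (intro L2n_mono f c) auto
  also have "\<dots> = B * sqrt (measure M (space M))"
    using B by (simp add: L2n_def ip_def real_sqrt_mult)
  finally show "L2n M f \<le> B * sqrt (measure M (space M))" .
qed

section \<open>Smooth functions, cutoffs and truncations\<close>

lemma smooth_fnE:
  assumes "smooth_fn f"
  obtains D where "\<And>x. (f has_derivative (\<lambda>h. D h x)) (at x)" "\<And>h. smooth_fn (D h)"
  using assms by (cases rule: smooth_fn.cases) auto

lemma smooth_fn_derivative:
  "smooth_fn f \<Longrightarrow> \<exists>D. (\<forall>x. (f has_derivative (\<lambda>h. D h x)) (at x)) \<and> (\<forall>h. smooth_fn (D h))"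
  by (erule smooth_fnE) blast

text \<open>A form of coinduction in which it suffices that the candidate class contains one family
  of directional derivatives of each of its members.\<close>

lemma smooth_fn_coinduct_set:
  assumes "X f"
    and "\<And>f. X f \<Longrightarrow> \<exists>D. (\<forall>x. (f has_derivative (\<lambda>h. D h x)) (at x)) \<and> (\<forall>h. X (D h))"
  shows "smooth_fn f"
  using assms(1)
proof (coinduction arbitrary: f rule: smooth_fn.coinduct)
  case smooth_fn
  then obtain D where "\<forall>x. (f has_derivative (\<lambda>h. D h x)) (at x)" "\<forall>h. X (D h)"
    using assms(2) by blast
  then show ?case by (intro exI[of _ f] exI[of _ D]) auto
qed

text \<open>The Leibniz and chain rules lead out of any single smoothness class, so coinduction
  is done on the whole algebra generated by smooth functions and composition.\<close>

inductive smooth_alg :: "('a::euclidean_space \<Rightarrow> real) \<Rightarrow> bool" where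
  base: "smooth_fn f \<Longrightarrow> smooth_alg f"
| add: "smooth_alg f \<Longrightarrow> smooth_alg g \<Longrightarrow> smooth_alg (\<lambda>x. f x + g x)"
| mult: "smooth_alg f \<Longrightarrow> smooth_alg g \<Longrightarrow> smooth_alg (\<lambda>x. f x * g x)"
| comp: "smooth_fn T \<Longrightarrow> smooth_alg f \<Longrightarrow> smooth_alg (\<lambda>x. T (f x) :: real)"

text \<open>Induction over the generators shows that the algebra is closed under differentiation;
  \<open>smooth_fn_alg\<close> turns this into smoothness by coinduction.\<close>

lemma smooth_alg_derivative:
  assumes "smooth_alg f"
  shows "\<exists>D. (\<forall>x. (f has_derivative (\<lambda>h. D h x)) (at x)) \<and> (\<forall>h. smooth_alg (D h))"
  using assms
proof induction
  case (base f)
  then show ?case by (blast dest: smooth_fn_derivative intro: smooth_alg.base)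
next
  case (add f g)
  then obtain D E where DE: "\<And>x. (f has_derivative (\<lambda>h. D h x)) (at x)" "\<And>h. smooth_alg (D h)"
    "\<And>x. (g has_derivative (\<lambda>h. E h x)) (at x)" "\<And>h. smooth_alg (E h)" by blast
  then have "\<And>x. ((\<lambda>x. f x + g x) has_derivative (\<lambda>h. D h x + E h x)) (at x)"
    by (intro derivative_intros)
  then show ?case using DE
    by (intro exI[of _ "\<lambda>h x. D h x + E h x"]) (auto intro: smooth_alg.add)
next
  case (mult f g)
  then obtain D E where DE: "\<And>x. (f has_derivative (\<lambda>h. D h x)) (at x)" "\<And>h. smooth_alg (D h)"
    "\<And>x. (g has_derivative (\<lambda>h. E h x)) (at x)" "\<And>h. smooth_alg (E h)" by blast
  then have "\<And>x. ((\<lambda>x. f x * g x) has_derivative (\<lambda>h. f x * E h x + D h x * g x)) (at x)"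
    by (intro derivative_intros)
  then show ?case using DE mult
    by (intro exI[of _ "\<lambda>h x. f x * E h x + D h x * g x"])
      (auto intro!: smooth_alg.add smooth_alg.mult)
next
  case (comp T f)
  then obtain D where D: "\<And>x. (f has_derivative (\<lambda>h. D h x)) (at x)" "\<And>h. smooth_alg (D h)"
    by blast
  obtain E where E: "\<And>x. (T has_derivative (\<lambda>h. E h x)) (at x)" "\<And>h. smooth_fn (E h)"
    using comp(1) by (rule smooth_fnE) blast
  \<comment> \<open>A linear map on the reals is multiplication by its value at 1, which turns the
    chain rule into a product of members of the algebra.\<close>
  have lin: "E h x = E 1 x * h" for h x
    using linear_cmul[OF has_derivative_linear[OF E(1)[of x]], of h 1] by simp
  have "((\<lambda>x. T (f x)) has_derivative (\<lambda>h. E 1 (f x) * D h x)) (at x)" for x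
    using has_derivative_compose[OF D(1)[of x] E(1)[of "f x"]]
    by (rule has_derivative_eq_rhs) (rule ext, rule lin)
  moreover have "smooth_alg (\<lambda>x. E 1 (f x) * D h x)" for h
    by (rule smooth_alg.mult[OF smooth_alg.comp[OF E(2) comp(2)] D(2)])
  ultimately show ?case by (intro exI[of _ "\<lambda>h x. E 1 (f x) * D h x"]) simp
qed

lemma smooth_fn_alg: "smooth_alg f \<Longrightarrow> smooth_fn f"
  by (rule smooth_fn_coinduct_set[of smooth_alg]) (auto dest: smooth_alg_derivative)

lemma smooth_fn_add: "smooth_fn f \<Longrightarrow> smooth_fn g \<Longrightarrow> smooth_fn (\<lambda>x. f x + g x)"
  and smooth_fn_mult: "smooth_fn f \<Longrightarrow> smooth_fn g \<Longrightarrow> smooth_fn (\<lambda>x. f x * g x)"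
  and smooth_fn_comp: "smooth_fn T \<Longrightarrow> smooth_fn f \<Longrightarrow> smooth_fn (\<lambda>x. T (f x) :: real)"
  by (rule smooth_fn_alg, rule smooth_alg.add, (erule smooth_alg.base)+)
    (rule smooth_fn_alg, rule smooth_alg.mult, (erule smooth_alg.base)+,
      rule smooth_fn_alg, rule smooth_alg.comp, assumption, erule smooth_alg.base)

lemma smooth_fn_const: "smooth_fn (\<lambda>x. c)"
  by (rule smooth_fn_coinduct_set[of "\<lambda>f. \<exists>c. f = (\<lambda>x. c)"])
    (auto intro!: exI[of _ "\<lambda>h x. 0"] derivative_intros)

lemma smooth_fn_linear: "bounded_linear f \<Longrightarrow> smooth_fn f"
proof (rule smooth_fn_coinduct_set[of "\<lambda>f. smooth_fn f \<or> bounded_linear f"])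
  fix f :: "'a \<Rightarrow> real"
  assume "smooth_fn f \<or> bounded_linear f"
  then show "\<exists>D. (\<forall>x. (f has_derivative (\<lambda>h. D h x)) (at x)) \<and>
      (\<forall>h. smooth_fn (D h) \<or> bounded_linear (D h))"
  proof
    assume "smooth_fn f"
    then show ?thesis by (blast dest: smooth_fn_derivative)
  next
    assume "bounded_linear f"
    then show ?thesis
      by (intro exI[of _ "\<lambda>h x. f h"]) (auto intro: bounded_linear_imp_has_derivative smooth_fn_const)
  qed
qed auto

lemma smooth_fn_diff: "smooth_fn f \<Longrightarrow> smooth_fn g \<Longrightarrow> smooth_fn (\<lambda>x. f x - g x)"
  using smooth_fn_add[of f "\<lambda>x. -1 * g x"] smooth_fn_mult[OF smooth_fn_const[of "-1"], of g] by simp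

lemma smooth_fn_sum: "(\<And>i. i \<in> I \<Longrightarrow> smooth_fn (f i)) \<Longrightarrow> smooth_fn (\<lambda>x. \<Sum>i\<in>I. f i x)"
  by (induction I rule: infinite_finite_induct) (auto intro: smooth_fn_const smooth_fn_add)

lemma smooth_fn_norm_sq: "smooth_fn (\<lambda>x::'a::euclidean_space. (norm (x - c))\<^sup>2)"
proof -
  have "smooth_fn (\<lambda>x::'a. \<Sum>b\<in>Basis. (x \<bullet> b - c \<bullet> b) * (x \<bullet> b - c \<bullet> b))"
    by (intro smooth_fn_sum smooth_fn_mult smooth_fn_diff smooth_fn_const smooth_fn_linear
        bounded_linear_inner_left)
  moreover have "(\<Sum>b\<in>Basis. (x \<bullet> b - c \<bullet> b) * (x \<bullet> b - c \<bullet> b)) = (norm (x - c))\<^sup>2" for x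
    by (subst power2_norm_eq_inner, subst euclidean_inner) (simp add: inner_diff_left)
  ultimately show ?thesis by simp
qed

section \<open>The flat function, smooth truncation and cutoffs\<close>

definition ebump :: "real \<Rightarrow> real" where
  "ebump x = (if x > 0 then exp (- 1 / x) else 0)"

lemma poly_exp_decay: "((\<lambda>x. poly p (1 / x) * exp (- 1 / x)) \<longlongrightarrow> (0::real)) (at_right 0)"
proof -
  have "((\<lambda>y. poly p y * exp (- y)) \<longlongrightarrow> (0::real)) at_top"
  proof -
    have "((\<lambda>y. coeff p i * (y ^ i / exp y)) \<longlongrightarrow> coeff p i * 0) at_top" for i
      by (intro tendsto_intros tendsto_power_div_exp_0)
    then have "((\<lambda>y. \<Sum>i\<le>degree p. coeff p i * (y ^ i / exp y)) \<longlongrightarrow> (\<Sum>i\<le>degree p. coeff p i * 0)) at_top"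
      by (intro tendsto_sum)
    moreover have "(\<Sum>i\<le>degree p. coeff p i * (y ^ i / exp y)) = poly p y * exp (- y)" for y
      by (simp add: poly_altdef sum_distrib_right exp_minus divide_inverse mult.assoc)
    ultimately show ?thesis by simp
  qed
  then have "((\<lambda>x. poly p (inverse x) * exp (- inverse x)) \<longlongrightarrow> (0::real)) (at_right 0)"
    by (rule filterlim_compose[OF _ filterlim_inverse_at_top_right])
  then show ?thesis by (simp add: divide_inverse)
qed

text \<open>All derivatives of \<open>ebump\<close> have this shape. In the variable
  \<open>y = 1 / x\<close>, differentiation replaces \<open>p\<close> by
  \<open>y^2 * (p - p')\<close>, so the class is closed under it and coinduction applies
  directly.\<close>

definition exp_poly_fn :: "real poly \<Rightarrow> real \<Rightarrow> real" where
  "exp_poly_fn p x = (if x > 0 then poly p (1 / x) * exp (- 1 / x) else 0)"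

lemma exp_poly_fn_deriv:
  "(exp_poly_fn p has_real_derivative exp_poly_fn ([:0,0,1:] * (p - pderiv p)) x) (at x)"
proof -
  consider "x > 0" | "x < 0" | "x = 0" by linarith
  then show ?thesis
  proof cases
    case 1
    have "((\<lambda>x. poly p (1 / x) * exp (- 1 / x)) has_real_derivative
        exp_poly_fn ([:0,0,1:] * (p - pderiv p)) x) (at x)"
      using 1 unfolding exp_poly_fn_def
      by (auto intro!: derivative_eq_intros poly_DERIV simp: field_simps power2_eq_square)
    then show ?thesis
      by (rule DERIV_cong_ev[THEN iffD1, rotated 3])
        (use 1 in \<open>auto simp: exp_poly_fn_def eventually_nhds intro!: exI[of _ "{0<..}"]\<close>)
  next
    case 2
    have "((\<lambda>x. 0) has_real_derivative exp_poly_fn ([:0,0,1:] * (p - pderiv p)) x) (at x)"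
      using 2 unfolding exp_poly_fn_def by auto
    then show ?thesis
      by (rule DERIV_cong_ev[THEN iffD1, rotated 3])
        (use 2 in \<open>auto simp: exp_poly_fn_def eventually_nhds intro!: exI[of _ "{..<0}"]\<close>)
  next
    case 3
    \<comment> \<open>From the right, the difference quotient at the origin is again a polynomial in
      \<open>1 / y\<close>, of degree one higher, times the exponential, which wins.\<close>
    have "((\<lambda>y. exp_poly_fn p y / y) \<longlongrightarrow> 0) (at_right 0)"
    proof (rule Lim_transform_eventually)
      show "((\<lambda>y. poly ([:0,1:] * p) (1 / y) * exp (- 1 / y)) \<longlongrightarrow> 0) (at_right 0)"
        by (rule poly_exp_decay)
      show "\<forall>\<^sub>F y in at_right 0. poly ([:0,1:] * p) (1 / y) * exp (- 1 / y) = exp_poly_fn p y / y"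
        using eventually_at_right_less[of 0]
        by eventually_elim (auto simp: exp_poly_fn_def field_simps)
    qed
    moreover have "((\<lambda>y. exp_poly_fn p y / y) \<longlongrightarrow> 0) (at_left 0)"
    proof (rule Lim_transform_eventually)
      show "\<forall>\<^sub>F y in at_left 0. 0 = exp_poly_fn p y / y"
        unfolding eventually_at_filter by (simp add: exp_poly_fn_def)
    qed simp
    ultimately have "((\<lambda>y. exp_poly_fn p y / y) \<longlongrightarrow> 0) (at 0)"
      by (simp add: filterlim_at_split)
    then show ?thesis using 3 by (simp add: has_field_derivative_iff exp_poly_fn_def)
  qed
qed

lemma smooth_fn_exp_poly: "smooth_fn (exp_poly_fn p)"
proof (rule smooth_fn_coinduct_set[of "\<lambda>f. \<exists>p. f = exp_poly_fn p"])
  fix f :: "real \<Rightarrow> real" assume "\<exists>p. f = exp_poly_fn p"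
  then obtain p where f: "f = exp_poly_fn p" by blast
  show "\<exists>D. (\<forall>x. (f has_derivative (\<lambda>h. D h x)) (at x)) \<and> (\<forall>h. \<exists>p. D h = exp_poly_fn p)"
  proof (intro exI conjI allI)
    fix x h :: real
    show "(f has_derivative (\<lambda>h. exp_poly_fn (smult h ([:0,0,1:] * (p - pderiv p))) x)) (at x)"
      using exp_poly_fn_deriv[of p x] unfolding f has_field_derivative_def
      by (rule has_derivative_eq_rhs) (auto simp: exp_poly_fn_def fun_eq_iff)
    show "exp_poly_fn (smult h ([:0,0,1:] * (p - pderiv p))) =
        exp_poly_fn (smult h ([:0,0,1:] * (p - pderiv p)))" ..
  qed
qed auto

lemma ebump_eq: "ebump = exp_poly_fn 1"
  by (auto simp: fun_eq_iff ebump_def exp_poly_fn_def)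

lemma smooth_fn_ebump: "smooth_fn ebump"
  unfolding ebump_eq by (rule smooth_fn_exp_poly)

definition ebump' :: "real \<Rightarrow> real" where
  "ebump' = exp_poly_fn [:0,0,1:]"

lemma ebump_deriv: "(ebump has_real_derivative ebump' x) (at x)"
  using exp_poly_fn_deriv[of 1 x] by (simp add: ebump_eq ebump'_def pderiv_1)

lemma ebump'_eq: "ebump' x = (if x > 0 then (1 / x)\<^sup>2 * exp (- 1 / x) else 0)"
  by (simp add: ebump'_def exp_poly_fn_def power2_eq_square)

lemma ebump_nonneg: "0 \<le> ebump x" and ebump_pos: "0 < ebump x \<longleftrightarrow> 0 < x"
  and ebump_eq_0: "ebump x = 0 \<longleftrightarrow> x \<le> 0" and ebump_mono: "x \<le> y \<Longrightarrow> ebump x \<le> ebump y"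
  by (auto simp: ebump_def field_simps)

lemma smooth_fn_continuous: "smooth_fn f \<Longrightarrow> continuous_on S f"
  by (blast dest: smooth_fn_derivative intro: continuous_at_imp_continuous_on has_derivative_continuous)

lemma smooth_fn_ebump': "smooth_fn ebump'"
  unfolding ebump'_def by (rule smooth_fn_exp_poly)

lemma continuous_on_ebump' [continuous_intros]:
  "continuous_on S f \<Longrightarrow> continuous_on S (\<lambda>x. ebump' (f x))"
  using smooth_fn_continuous[OF smooth_fn_ebump', of UNIV]
  by (rule continuous_on_compose2) auto

text \<open>A smooth substitute for the truncation \<open>(s - \<epsilon>)\<^sup>+\<close>, with slope between 0 and 1.\<close>

definition trunc :: "real \<Rightarrow> real \<Rightarrow> real" where
  "trunc \<epsilon> s = (s - \<epsilon>) * ebump ((s - \<epsilon>) / \<epsilon>)"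

definition trunc' :: "real \<Rightarrow> real \<Rightarrow> real" where
  "trunc' \<epsilon> s = (s - \<epsilon>) / \<epsilon> * ebump' ((s - \<epsilon>) / \<epsilon>) + ebump ((s - \<epsilon>) / \<epsilon>)"

lemma smooth_fn_trunc: "smooth_fn (trunc \<epsilon>)"
proof -
  have "smooth_fn (\<lambda>s. (s - \<epsilon>) * ebump ((s - \<epsilon>) * (1 / \<epsilon>)))"
    by (intro smooth_fn_mult smooth_fn_comp[OF smooth_fn_ebump] smooth_fn_diff smooth_fn_const
        smooth_fn_linear bounded_linear_ident)
  then show ?thesis by (simp add: trunc_def[abs_def])
qed

lemma trunc_deriv:
  assumes "\<epsilon> > 0"
  shows "(trunc \<epsilon> has_real_derivative trunc' \<epsilon> s) (at s)"
  unfolding trunc_def[abs_def] trunc'_def using assms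
  by (auto intro!: derivative_eq_intros DERIV_chain2[OF ebump_deriv] simp: field_simps)

lemma continuous_on_trunc': "\<epsilon> > 0 \<Longrightarrow> continuous_on UNIV (trunc' \<epsilon>)"
  unfolding trunc'_def using smooth_fn_continuous[OF smooth_fn_ebump, of UNIV]
  by (auto intro!: continuous_intros continuous_on_compose2[of UNIV ebump])

lemma trunc_le: "\<epsilon> > 0 \<Longrightarrow> s \<le> \<epsilon> \<Longrightarrow> trunc \<epsilon> s = 0" "\<epsilon> > 0 \<Longrightarrow> s \<le> \<epsilon> \<Longrightarrow> trunc' \<epsilon> s = 0"
  by (auto simp: trunc_def trunc'_def ebump_def ebump'_eq divide_simps)

lemma trunc_gt:
  assumes "\<epsilon> > 0" "s > \<epsilon>"
  shows "trunc \<epsilon> s = (s - \<epsilon>) * exp (- (\<epsilon> / (s - \<epsilon>)))"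
    "trunc' \<epsilon> s = (1 + \<epsilon> / (s - \<epsilon>)) * exp (- (\<epsilon> / (s - \<epsilon>)))"
proof -
  define q where "q = (s - \<epsilon>) / \<epsilon>"
  have q: "q > 0" and iq: "\<epsilon> / (s - \<epsilon>) = 1 / q" using assms by (auto simp: q_def)
  show "trunc \<epsilon> s = (s - \<epsilon>) * exp (- (\<epsilon> / (s - \<epsilon>)))"
    unfolding trunc_def iq using q by (simp add: ebump_def flip: q_def)
  have "q * ((1 / q)\<^sup>2 * exp (- 1 / q)) + exp (- 1 / q) = (1 + 1 / q) * exp (- (1 / q))"
    using q by (simp add: field_simps power2_eq_square)
  then show "trunc' \<epsilon> s = (1 + \<epsilon> / (s - \<epsilon>)) * exp (- (\<epsilon> / (s - \<epsilon>)))"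
    unfolding trunc'_def iq using q by (simp add: ebump_def ebump'_eq flip: q_def)
qed

text \<open>With \<open>q = \<epsilon> / (s - \<epsilon>)\<close> the slope above the threshold is
  \<open>(1 + q) * exp (- q)\<close>, and \<open>1 + q \<le> exp q\<close>. The bound 1 keeps
  truncated gradients dominated by the original gradient.\<close>

lemma trunc'_bounds:
  assumes "\<epsilon> > 0"
  shows "0 \<le> trunc' \<epsilon> s" "trunc' \<epsilon> s \<le> 1"
proof -
  show "0 \<le> trunc' \<epsilon> s"
    using assms by (cases "s > \<epsilon>") (auto simp: trunc_gt trunc_le)
  show "trunc' \<epsilon> s \<le> 1"
  proof (cases "s > \<epsilon>")
    case True
    have "(1 + \<epsilon> / (s - \<epsilon>)) * exp (- (\<epsilon> / (s - \<epsilon>))) \<le> exp (\<epsilon> / (s - \<epsilon>)) * exp (- (\<epsilon> / (s - \<epsilon>)))"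
      by (intro mult_right_mono exp_ge_add_one_self) auto
    then show ?thesis using True assms by (simp add: trunc_gt flip: exp_add)
  qed (use assms in \<open>auto simp: trunc_le\<close>)
qed

lemma trunc_abs_le:
  assumes "\<epsilon> > 0"
  shows "\<bar>trunc \<epsilon> s\<bar> \<le> \<bar>s\<bar>"
proof (cases "s > \<epsilon>")
  case True
  have "(s - \<epsilon>) * exp (- (\<epsilon> / (s - \<epsilon>))) \<le> (s - \<epsilon>) * 1"
    using True assms by (intro mult_left_mono) auto
  then have "(s - \<epsilon>) * exp (- (\<epsilon> / (s - \<epsilon>))) \<le> s"
    using assms by (rule_tac order_trans) (assumption, simp)
  then show ?thesis using True assms by (simp add: trunc_gt abs_mult)
qed (use assms in \<open>auto simp: trunc_le\<close>)

text \<open>The slope at \<open>s = 0\<close> is 0 for every \<open>\<epsilon>\<close>, so in the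
  limit the gradient is kept exactly where the function is strictly positive.\<close>

lemma trunc_tendsto:
  assumes "\<And>k. \<epsilon> k > 0" "\<epsilon> \<longlonglongrightarrow> 0"
  shows "(\<lambda>k. trunc (\<epsilon> k) s) \<longlonglongrightarrow> max s 0"
    "(\<lambda>k. trunc' (\<epsilon> k) s) \<longlonglongrightarrow> (if s > 0 then 1 else 0)"
proof -
  have "(\<lambda>k. trunc (\<epsilon> k) s) \<longlonglongrightarrow> max s 0 \<and> (\<lambda>k. trunc' (\<epsilon> k) s) \<longlonglongrightarrow> (if s > 0 then 1 else 0)"
  proof (cases "s > 0")
    case True
    then have ev: "\<forall>\<^sub>F k in sequentially. \<epsilon> k < s" using assms(2) by (simp add: order_tendstoD)
    have "(\<lambda>k. (s - \<epsilon> k) * exp (- (\<epsilon> k / (s - \<epsilon> k)))) \<longlonglongrightarrow> (s - 0) * exp (- (0 / (s - 0)))"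
      "(\<lambda>k. (1 + \<epsilon> k / (s - \<epsilon> k)) * exp (- (\<epsilon> k / (s - \<epsilon> k)))) \<longlonglongrightarrow> (1 + 0 / (s - 0)) * exp (- (0 / (s - 0)))"
      using True by (intro tendsto_intros assms(2); simp)+
    moreover have "\<forall>\<^sub>F k in sequentially. (s - \<epsilon> k) * exp (- (\<epsilon> k / (s - \<epsilon> k))) = trunc (\<epsilon> k) s"
      "\<forall>\<^sub>F k in sequentially. (1 + \<epsilon> k / (s - \<epsilon> k)) * exp (- (\<epsilon> k / (s - \<epsilon> k))) = trunc' (\<epsilon> k) s"
      using ev by (eventually_elim, simp add: trunc_gt assms(1))+
    ultimately show ?thesis
      using True by (auto intro: Lim_transform_eventually)
  next
    case False
    then have "s \<le> \<epsilon> k" for k using assms(1)[of k] by linarith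
    then show ?thesis using False assms(1) by (simp add: trunc_le)
  qed
  then show "(\<lambda>k. trunc (\<epsilon> k) s) \<longlonglongrightarrow> max s 0"
    "(\<lambda>k. trunc' (\<epsilon> k) s) \<longlonglongrightarrow> (if s > 0 then 1 else 0)" by auto
qed

lemma smooth_fn_ball_bump: "smooth_fn (\<lambda>x. ebump (r\<^sup>2 - (norm (x - c))\<^sup>2))"
  by (intro smooth_fn_comp[OF smooth_fn_ebump] smooth_fn_diff smooth_fn_const smooth_fn_norm_sq)

text \<open>A finite sum of ball bumps is positive on \<open>K\<close> and vanishes off a compact
  subset of \<open>U\<close>; a smooth step applied to the sum levels it off to 1 on
  \<open>K\<close>.\<close>

lemma smooth_cutoff:
  fixes K U :: "'a::euclidean_space set"
  assumes "compact K" "open U" "K \<subseteq> U"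
  obtains \<eta> where "smooth_fn \<eta>" "\<And>x. 0 \<le> \<eta> x" "\<And>x. \<eta> x \<le> 1" "\<And>x. x \<in> K \<Longrightarrow> \<eta> x = 1"
    "compact (closure {x. \<eta> x \<noteq> 0})" "closure {x. \<eta> x \<noteq> 0} \<subseteq> U"
proof (cases "K = {}")
  case True
  show ?thesis by (rule that[of "\<lambda>x. 0"]) (use True smooth_fn_const in auto)
next
  case False
  have "\<forall>x\<in>K. \<exists>r>0. cball x r \<subseteq> U"
    using assms open_contains_cball by blast
  then obtain r where r: "\<And>x. x \<in> K \<Longrightarrow> r x > 0 \<and> cball x (r x) \<subseteq> U" by metis
  have "K \<subseteq> (\<Union>x\<in>K. ball x (r x))" using r by auto
  then obtain C where C: "C \<subseteq> K" "finite C" "K \<subseteq> (\<Union>x\<in>C. ball x (r x))"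
    using compactE_image[OF assms(1), of K "\<lambda>x. ball x (r x)"] by auto
  define S where "S x = (\<Sum>c\<in>C. ebump ((r c)\<^sup>2 - (norm (x - c))\<^sup>2))" for x
  have S: "smooth_fn S" unfolding S_def by (intro smooth_fn_sum smooth_fn_ball_bump)
  have S0: "S x \<ge> 0" for x unfolding S_def by (intro sum_nonneg ebump_nonneg)
  have Spos: "S x > 0" if x: "x \<in> K" for x
  proof -
    obtain c where c: "c \<in> C" "x \<in> ball c (r c)" using C x by blast
    then have "norm (x - c) < r c" by (simp add: dist_norm norm_minus_commute)
    then have "(norm (x - c))\<^sup>2 < (r c)\<^sup>2" by (intro power_strict_mono) auto
    then have "ebump ((r c)\<^sup>2 - (norm (x - c))\<^sup>2) > 0" by (simp add: ebump_pos)
    then show ?thesis unfolding S_def using c C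
      by (intro sum_pos2[of _ c]) (auto intro: ebump_nonneg)
  qed
  have Sz: "S x = 0" if "x \<notin> (\<Union>c\<in>C. cball c (r c))" for x
    unfolding S_def
  proof (intro sum.neutral ballI)
    fix c assume c: "c \<in> C"
    then have "r c < norm (x - c)" using that by (auto simp: dist_norm norm_minus_commute)
    moreover have "r c > 0" using r c C by auto
    ultimately have "(r c)\<^sup>2 \<le> (norm (x - c))\<^sup>2" by (intro power_mono) auto
    then show "ebump ((r c)\<^sup>2 - (norm (x - c))\<^sup>2) = 0" by (simp add: ebump_eq_0)
  qed
  obtain x0 where x0: "x0 \<in> K" "\<And>x. x \<in> K \<Longrightarrow> S x0 \<le> S x"
    using continuous_attains_inf[OF assms(1) False smooth_fn_continuous[OF S]] by blast
  \<comment> \<open>Since \<open>ebump\<close> vanishes on nonpositive numbers, this is 1 as soon as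
    \<open>S\<close> reaches its minimum over \<open>K\<close>, and it is 0 where \<open>S\<close>
    is 0.\<close>
  define \<eta> where "\<eta> x = 1 - ebump (1 - S x * (1 / S x0)) * (1 / ebump 1)" for x
  have e1: "ebump 1 > 0" by (simp add: ebump_pos)
  have bd: "0 \<le> ebump (1 - S x * (1 / S x0))" "ebump (1 - S x * (1 / S x0)) \<le> ebump 1" for x
    using S0[of x] Spos[OF x0(1)] by (auto intro: ebump_nonneg ebump_mono)
  have nz: "{x. \<eta> x \<noteq> 0} \<subseteq> (\<Union>c\<in>C. cball c (r c))"
  proof (intro subsetI, rule ccontr)
    fix x assume "x \<in> {x. \<eta> x \<noteq> 0}" "x \<notin> (\<Union>c\<in>C. cball c (r c))"
    then show False using Sz[of x] e1 by (simp add: \<eta>_def)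
  qed
  have cp: "compact (\<Union>c\<in>C. cball c (r c))" using C by (intro compact_UN) auto
  have cl: "closure {x. \<eta> x \<noteq> 0} \<subseteq> (\<Union>c\<in>C. cball c (r c))"
    using nz cp by (intro closure_minimal) (auto dest: compact_imp_closed)
  show ?thesis
  proof (rule that[of \<eta>])
    show "smooth_fn \<eta>" unfolding \<eta>_def
      by (intro smooth_fn_diff smooth_fn_mult smooth_fn_comp[OF smooth_fn_ebump] smooth_fn_const S)
    show "0 \<le> \<eta> x" "\<eta> x \<le> 1" for x using bd[of x] e1 by (auto simp: \<eta>_def field_simps)
    show "\<eta> x = 1" if "x \<in> K" for x
      using x0(2)[OF that] Spos[OF x0(1)] by (simp add: \<eta>_def ebump_def field_simps)
    show "compact (closure {x. \<eta> x \<noteq> 0})"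
      using compact_Int_closed[OF cp closed_closure, of "{x. \<eta> x \<noteq> 0}"] cl by (simp add: Int_absorb1)
    show "closure {x. \<eta> x \<noteq> 0} \<subseteq> U" using cl r C by fastforce
  qed
qed

section \<open>Gradients of smooth functions and test functions\<close>

lemma grad_inner:
  assumes "(\<phi> has_derivative D) (at x)"
  shows "grad \<phi> x \<bullet> h = D h"
proof -
  have D: "frechet_derivative \<phi> (at x) = D" using assms by (metis frechet_derivative_at)
  have "D h = D (\<Sum>b\<in>Basis. (h \<bullet> b) *\<^sub>R b)" by (simp add: euclidean_representation)
  also have "\<dots> = (\<Sum>b\<in>Basis. (h \<bullet> b) * D b)"
    using has_derivative_linear[OF assms] by (simp add: linear_sum linear_cmul)
  finally show ?thesis
    unfolding grad_def D by (simp add: inner_sum_left inner_commute[of h] mult.commute)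
qed

lemma grad_eqI:
  assumes "(\<phi> has_derivative (\<lambda>h. v \<bullet> h)) (at x)"
  shows "grad \<phi> x = v"
  using grad_inner[OF assms] by (metis vector_eq_rdot inner_commute)

lemma smooth_fn_has_grad:
  assumes "smooth_fn \<phi>"
  shows "(\<phi> has_derivative (\<lambda>h. grad \<phi> x \<bullet> h)) (at x)"
proof -
  obtain D where D: "\<And>x. (\<phi> has_derivative (\<lambda>h. D h x)) (at x)" using assms by (rule smooth_fnE) blast
  have "(\<lambda>h. grad \<phi> x \<bullet> h) = (\<lambda>h. D h x)" using grad_inner[OF D] by auto
  with D[of x] show ?thesis by simp
qed

lemma continuous_on_grad:
  assumes "smooth_fn \<phi>"
  shows "continuous_on S (grad \<phi>)"
proof -
  obtain D where D: "\<And>x. (\<phi> has_derivative (\<lambda>h. D h x)) (at x)" "\<And>h. smooth_fn (D h)"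
    using assms by (rule smooth_fnE) blast
  have "frechet_derivative \<phi> (at x) = (\<lambda>h. D h x)" for x using D by (metis frechet_derivative_at)
  then have "grad \<phi> = (\<lambda>x. \<Sum>b\<in>Basis. D b x *\<^sub>R b)" by (auto simp: grad_def)
  then show ?thesis using D by (auto intro!: continuous_intros smooth_fn_continuous)
qed

lemma grad_zero_outside:
  assumes "x \<notin> closure {x. \<phi> x \<noteq> 0}"
  shows "grad \<phi> x = 0"
proof (rule grad_eqI)
  have "((\<lambda>x. 0) has_derivative (\<lambda>h. 0 \<bullet> h)) (at x)" by simp
  then show "(\<phi> has_derivative (\<lambda>h. 0 \<bullet> h)) (at x)"
    by (rule has_derivative_transform_within_open[of _ _ _ _ "- closure {x. \<phi> x \<noteq> 0}"])
      (use assms closure_subset[of "{x. \<phi> x \<noteq> 0}"] in auto)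
qed

lemma grad_chain:
  assumes "smooth_fn \<phi>" "smooth_fn \<eta>" "\<And>s. (T has_real_derivative T' s) (at s)"
  shows "grad (\<lambda>x. \<eta> x * T (\<phi> x)) x = (\<eta> x * T' (\<phi> x)) *\<^sub>R grad \<phi> x + T (\<phi> x) *\<^sub>R grad \<eta> x"
proof (rule grad_eqI)
  have T: "(T has_derivative (\<lambda>h. h * T' (\<phi> x))) (at (\<phi> x))"
    using assms(3)[of "\<phi> x"] unfolding has_field_derivative_def
    by (rule has_derivative_eq_rhs) (simp add: fun_eq_iff)
  have "((\<lambda>x. \<eta> x * T (\<phi> x)) has_derivative
      (\<lambda>h. \<eta> x * ((grad \<phi> x \<bullet> h) * T' (\<phi> x)) + (grad \<eta> x \<bullet> h) * T (\<phi> x))) (at x)"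
    by (intro has_derivative_mult smooth_fn_has_grad assms
        has_derivative_compose[OF smooth_fn_has_grad[OF assms(1)] T])
  then show "((\<lambda>x. \<eta> x * T (\<phi> x)) has_derivative
      (\<lambda>h. ((\<eta> x * T' (\<phi> x)) *\<^sub>R grad \<phi> x + T (\<phi> x) *\<^sub>R grad \<eta> x) \<bullet> h)) (at x)"
    by (rule has_derivative_eq_rhs) (auto simp: inner_add_left algebra_simps)
qed

lemma test_fnD:
  assumes "test_fn \<Omega> \<phi>"
  shows "smooth_fn \<phi>" "compact (closure {x. \<phi> x \<noteq> 0})" "closure {x. \<phi> x \<noteq> 0} \<subseteq> \<Omega>"
    "x \<notin> \<Omega> \<Longrightarrow> \<phi> x = 0" "x \<notin> \<Omega> \<Longrightarrow> grad \<phi> x = 0"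
  using assms grad_zero_outside[of x \<phi>] closure_subset[of "{x. \<phi> x \<noteq> 0}"]
  by (auto simp: test_fn_def)

lemma closure_support_subset:
  assumes "\<And>x. \<psi> x \<noteq> 0 \<Longrightarrow> \<phi> x \<noteq> (0::real)" "compact (closure {x. \<phi> x \<noteq> 0})"
  shows "compact (closure {x. \<psi> x \<noteq> (0::real)})" "closure {x. \<psi> x \<noteq> 0} \<subseteq> closure {x. \<phi> x \<noteq> 0}"
proof -
  show 1: "closure {x. \<psi> x \<noteq> 0} \<subseteq> closure {x. \<phi> x \<noteq> 0}"
    using assms(1) by (intro closure_mono) auto
  show "compact (closure {x. \<psi> x \<noteq> (0::real)})"
    using compact_Int_closed[OF assms(2) closed_closure, of "{x. \<psi> x \<noteq> 0}"] 1
    by (simp add: Int_absorb1)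
qed

lemma test_fn_subsupport:
  assumes "test_fn \<Omega> \<phi>" "smooth_fn \<psi>" "\<And>x. \<psi> x \<noteq> 0 \<Longrightarrow> \<phi> x \<noteq> 0"
  shows "test_fn \<Omega> \<psi>"
  using assms closure_support_subset[of \<psi> \<phi>] by (auto simp: test_fn_def)

lemma test_fn_lincomb:
  assumes "test_fn \<Omega> \<phi>" "test_fn \<Omega> \<psi>"
  shows "test_fn \<Omega> (\<lambda>x. \<phi> x + c * \<psi> x)"
  unfolding test_fn_def
proof (intro conjI)
  show "smooth_fn (\<lambda>x. \<phi> x + c * \<psi> x)"
    using assms by (intro smooth_fn_add smooth_fn_mult smooth_fn_const) (auto simp: test_fn_def)
  have sub: "{x. \<phi> x + c * \<psi> x \<noteq> 0} \<subseteq> {x. \<phi> x \<noteq> 0} \<union> {x. \<psi> x \<noteq> 0}" by auto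
  have cp: "compact (closure {x. \<phi> x \<noteq> 0} \<union> closure {x. \<psi> x \<noteq> 0})"
    using assms by (auto simp: test_fn_def)
  have cl: "closure {x. \<phi> x + c * \<psi> x \<noteq> 0} \<subseteq> closure {x. \<phi> x \<noteq> 0} \<union> closure {x. \<psi> x \<noteq> 0}"
    using closure_mono[OF sub] by simp
  then show "closure {x. \<phi> x + c * \<psi> x \<noteq> 0} \<subseteq> \<Omega>" using assms by (auto simp: test_fn_def)
  show "compact (closure {x. \<phi> x + c * \<psi> x \<noteq> 0})"
    using compact_Int_closed[OF cp closed_closure, of "{x. \<phi> x + c * \<psi> x \<noteq> 0}"] cl
    by (simp add: Int_absorb1)
qed

lemma grad_lincomb:
  assumes "smooth_fn \<phi>" "smooth_fn \<psi>"
  shows "grad (\<lambda>x. \<phi> x + c * \<psi> x) x = grad \<phi> x + c *\<^sub>R grad \<psi> x"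
proof (rule grad_eqI)
  have "((\<lambda>x. \<phi> x + c * \<psi> x) has_derivative (\<lambda>h. grad \<phi> x \<bullet> h + c * (grad \<psi> x \<bullet> h))) (at x)"
    by (intro has_derivative_add has_derivative_mult_right smooth_fn_has_grad assms)
  then show "((\<lambda>x. \<phi> x + c * \<psi> x) has_derivative (\<lambda>h. (grad \<phi> x + c *\<^sub>R grad \<psi> x) \<bullet> h)) (at x)"
    by (simp add: inner_add_left)
qed

lemma test_fn_bounded:
  assumes "test_fn \<Omega> \<phi>"
  obtains B where "\<And>x. \<bar>\<phi> x\<bar> \<le> B" "\<And>x. norm (grad \<phi> x) \<le> B" "B \<ge> 0"
proof -
  let ?K = "closure {x. \<phi> x \<noteq> 0}"
  have "compact (\<phi> ` ?K)" "compact (grad \<phi> ` ?K)"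
    using test_fnD[OF assms] by (auto intro!: compact_continuous_image smooth_fn_continuous continuous_on_grad)
  then obtain B1 B2 where B: "\<forall>y\<in>\<phi> ` ?K. norm y \<le> B1" "\<forall>y\<in>grad \<phi> ` ?K. norm y \<le> B2"
    using compact_imp_bounded bounded_iff by metis
  have "\<bar>\<phi> x\<bar> \<le> max 0 (max B1 B2)" "norm (grad \<phi> x) \<le> max 0 (max B1 B2)" for x
  proof -
    show "\<bar>\<phi> x\<bar> \<le> max 0 (max B1 B2)"
      using B(1) closure_subset[of "{x. \<phi> x \<noteq> 0}"] by (cases "\<phi> x = 0") (auto simp: le_max_iff_disj)
    show "norm (grad \<phi> x) \<le> max 0 (max B1 B2)"
      using B(2) grad_zero_outside[of x \<phi>] by (cases "x \<in> ?K") (auto simp: le_max_iff_disj)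
  qed
  then show ?thesis by (intro that[of "max 0 (max B1 B2)"]) auto
qed

section \<open>Ball growth and integrals over the unit cube\<close>

text \<open>The support is defined point by point through balls. By the Lindelof property countably
  many null balls already cover everything outside it.\<close>

lemma emeasure_disjoint_msupp:
  fixes \<mu> :: "'a::euclidean_space measure"
  assumes "sets \<mu> = sets borel" "open U" "U \<inter> msupp \<mu> = {}"
  shows "emeasure \<mu> U = 0"
proof -
  define F where "F = {B. \<exists>x e. B = ball x e \<and> emeasure \<mu> (ball x e) = 0}"
  have "\<And>S. S \<in> F \<Longrightarrow> open S" by (auto simp: F_def)
  then obtain F' where F': "F' \<subseteq> F" "countable F'" "\<Union>F' = \<Union>F" by (rule Lindelof) blast
  have U: "U \<subseteq> \<Union>F'"
  proof
    fix x assume "x \<in> U"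
    then have "x \<notin> msupp \<mu>" using assms by auto
    then obtain e where "e > 0" "emeasure \<mu> (ball x e) = 0" by (auto simp: msupp_def not_gr_zero)
    then have "ball x e \<in> F" "x \<in> ball x e" by (auto simp: F_def)
    then show "x \<in> \<Union>F'" using F' by blast
  qed
  have "\<Union>F' \<in> null_sets \<mu>"
    using F' assms(1) by (intro null_sets_UN'[of F' "\<lambda>B. B", simplified]) (auto simp: F_def null_sets_def)
  then have "U \<in> null_sets \<mu>"
    using U assms by (rule_tac null_sets_subset) auto
  then show ?thesis by (rule null_setsD1)
qed

text \<open>The lower limit bounds small balls centred in the support by
  \<open>\<delta> powr s\<close>. A ball centred elsewhere is null or lies in a ball of twice the
  radius about a support point, and large radii are covered by the total mass.\<close>

lemma ball_growth_of_lower_Linf_dim: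
  fixes \<mu> :: "'a::euclidean_space measure"
  assumes sets: "sets \<mu> = sets borel" and fin: "finite_measure \<mu>"
    and dim: "lower_Linf_dim \<mu> > ereal (real DIM('a) - 2)"
  obtains C s where "0 \<le> C" "0 \<le> s" "s > real DIM('a) - 2"
    "\<And>x r. 0 < r \<Longrightarrow> measure \<mu> (ball x r) \<le> C * r powr s"
proof -
  interpret finite_measure \<mu> by fact
  define M where "M = measure \<mu> (space \<mu>)"
  have M: "measure \<mu> A \<le> M" for A by (simp add: M_def bounded_measure)
  have M0: "0 \<le> M" by (simp add: M_def)
  obtain s where s: "s > real DIM('a) - 2" "ereal s < lower_Linf_dim \<mu>"
    using ereal_dense3[OF dim] by auto
  show ?thesis
  proof (cases "s < 0")
    case True
    \<comment> \<open>A negative \<open>s\<close> exceeds \<open>real DIM('a) - 2\<close> only in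
      dimension one, where the exponent 0 is also above that threshold and the total mass is a
      bound.\<close>
    show ?thesis
      by (rule that[of M 0]) (use M M0 True s in auto)
  next
    case False
    define X where "X \<delta> = (SUP x\<in>msupp \<mu>. measure \<mu> (ball x \<delta>))" for \<delta>
    have "\<forall>\<^sub>F \<delta> in at_right 0. ereal s < ereal (ln (X \<delta>) / ln \<delta>)"
      using s(2) unfolding lower_Linf_dim_def X_def by (rule less_LiminfD)
    then obtain b where b: "b > 0" "\<And>\<delta>. 0 < \<delta> \<Longrightarrow> \<delta> < b \<Longrightarrow> s < ln (X \<delta>) / ln \<delta>"
      by (auto simp: eventually_at_right_field)
    \<comment> \<open>Capping at 1 makes \<open>ln \<delta>\<close> negative, so multiplying by it
      turns the lower bound on the quotient into an upper bound on the supremum.\<close>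
    define d where "d = min b 1"
    have d: "0 < d" "d \<le> 1" using b by (auto simp: d_def)
    have small: "measure \<mu> (ball x \<delta>) \<le> \<delta> powr s" if x: "x \<in> msupp \<mu>" and "0 < \<delta>" "\<delta> < d" for x \<delta>
    proof -
      have "measure \<mu> (ball x \<delta>) > 0"
        using x \<open>0 < \<delta>\<close> by (auto simp: msupp_def emeasure_eq_measure)
      moreover have le: "measure \<mu> (ball x \<delta>) \<le> X \<delta>"
        unfolding X_def by (rule cSUP_upper[OF x]) (use M in \<open>auto intro!: bdd_aboveI2\<close>)
      ultimately have X: "X \<delta> > 0" by linarith
      have "s < ln (X \<delta>) / ln \<delta>" "ln \<delta> < 0" using b(2)[of \<delta>] that d by (auto simp: d_def)
      then have "ln (X \<delta>) < s * ln \<delta>" by (simp add: neg_less_divide_eq)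
      then have "X \<delta> < exp (s * ln \<delta>)" using X by (metis exp_less_cancel_iff exp_ln)
      also have "\<dots> = \<delta> powr s" using \<open>0 < \<delta>\<close> by (simp add: powr_def)
      finally show ?thesis using le by linarith
    qed
    \<comment> \<open>The first summand pays for doubling the radius when moving to a support point;
      the second makes the bound exceed the total mass once \<open>r \<ge> d/2\<close>.\<close>
    define C where "C = 2 powr s + M / (d/2) powr s"
    have C0: "0 \<le> C" using M0 by (simp add: C_def)
    have "measure \<mu> (ball x r) \<le> C * r powr s" if r: "0 < r" for x r
    proof (cases "r < d/2")
      case True
      show ?thesis
      proof (cases "ball x r \<inter> msupp \<mu> = {}")
        case True
        then have "measure \<mu> (ball x r) = 0"
          using emeasure_disjoint_msupp[OF sets open_ball] by (simp add: measure_def)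
        then show ?thesis using C0 by simp
      next
        case False
        then obtain y where y: "y \<in> ball x r" "y \<in> msupp \<mu>" by auto
        have "ball x r \<subseteq> ball y (2 * r)"
        proof
          fix z assume "z \<in> ball x r"
          then show "z \<in> ball y (2 * r)"
            using y dist_triangle[of y z x] by (auto simp: dist_commute)
        qed
        then have "measure \<mu> (ball x r) \<le> measure \<mu> (ball y (2 * r))"
          using sets by (intro finite_measure_mono) auto
        also have "\<dots> \<le> (2 * r) powr s" using small[OF y(2), of "2 * r"] True r by simp
        also have "\<dots> = 2 powr s * r powr s" using r by (simp add: powr_mult)
        also have "\<dots> \<le> C * r powr s" using M0 by (intro mult_right_mono) (auto simp: C_def)
        finally show ?thesis .
      qed
    next
      case False
      have "(d/2) powr s \<le> r powr s" using False d \<open>\<not> s < 0\<close> by (intro powr_mono2) auto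
      then have "M \<le> M / (d/2) powr s * r powr s"
        using M0 d by (simp add: field_simps mult_left_mono)
      also have "\<dots> \<le> C * r powr s" by (intro mult_right_mono) (auto simp: C_def)
      finally show ?thesis using M[of "ball x r"] by linarith
    qed
    then show ?thesis using that[of C s] C0 False s by auto
  qed
qed

section \<open>Integration over the unit cube and along curves\<close>

lemma integral_density_indicator:
  fixes f :: "'a \<Rightarrow> 'b::{banach, second_countable_topology}"
  assumes "f \<in> borel_measurable M" "A \<in> sets M"
  shows "(LINT x|density M (indicator A). f x) = (LINT x|M. indicator A x *\<^sub>R f x)"
proof -
  have eq: "(\<lambda>x. ennreal (indicator A x)) = indicator A" by (auto simp: indicator_def)
  show ?thesis
    using integral_density[of f M "indicator A"] assms by (simp add: eq)
qed

text \<open>Having total mass 1, it lets the square of a mean be estimated by the mean of the square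
  without constants. On the reals it is the interval from 0 to 1 and also serves as the parameter
  domain of curves.\<close>

definition unit_cube :: "'a::euclidean_space measure" where
  "unit_cube = density lborel (indicator (cbox 0 One))"

lemma sets_unit_cube [simp, measurable_cong]: "sets unit_cube = sets borel"
  and space_unit_cube [simp]: "space unit_cube = UNIV"
  by (auto simp: unit_cube_def)

lemma emeasure_unit_cube: "emeasure unit_cube (UNIV :: 'a::euclidean_space set) = 1"
proof -
  have One: "One \<bullet> b = 1" if "b \<in> Basis" for b :: 'a
    using that by (simp add: inner_sum_left inner_Basis)
  then have "emeasure lborel (cbox 0 One :: 'a set) = 1"
    by (subst emeasure_lborel_cbox) auto
  then show ?thesis by (simp add: unit_cube_def emeasure_density)
qed

interpretation unit_cube: finite_measure unit_cube
  by standard (simp add: emeasure_unit_cube)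

lemma measure_unit_cube [simp]: "measure unit_cube (UNIV :: 'a::euclidean_space set) = 1"
  by (simp add: measure_def emeasure_unit_cube)

lemma AE_unit_cube: "AE z in unit_cube. z \<in> cbox 0 One"
  unfolding unit_cube_def by (subst AE_density) (auto simp: indicator_def)

lemma norm_unit_cube: "z \<in> cbox 0 One \<Longrightarrow> norm (z::'a::euclidean_space) \<le> DIM('a)"
proof -
  assume z: "z \<in> cbox 0 One"
  have "norm z \<le> (\<Sum>b\<in>Basis. \<bar>z \<bullet> b\<bar>)" by (rule norm_le_l1)
  also have "\<dots> \<le> (\<Sum>b\<in>(Basis::'a set). 1)"
    using z by (intro sum_mono) (auto simp: mem_box)
  finally show ?thesis by simp
qed

lemma nn_integral_lborel_affine:
  fixes h :: "'a::euclidean_space \<Rightarrow> ennreal"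
  assumes [measurable]: "h \<in> borel_measurable borel" and R: "R > 0"
  shows "(\<integral>\<^sup>+z. h (x + R *\<^sub>R z) \<partial>lborel) = ennreal (1 / R ^ DIM('a)) * (\<integral>\<^sup>+y. h y \<partial>lborel)"
proof -
  have "(\<integral>\<^sup>+y. h y \<partial>lborel) = (\<integral>\<^sup>+y. h y \<partial>density (distr lborel borel (\<lambda>z. x + R *\<^sub>R z)) (\<lambda>_. \<bar>R\<bar> ^ DIM('a)))"
    using R by (subst lborel_affine[of R x]) auto
  also have "\<dots> = ennreal (R ^ DIM('a)) * (\<integral>\<^sup>+z. h (x + R *\<^sub>R z) \<partial>lborel)"
    using R by (subst nn_integral_density) (auto simp: nn_integral_cmult nn_integral_distr)
  finally have "ennreal (1 / R ^ DIM('a)) * (\<integral>\<^sup>+y. h y \<partial>lborel) =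
      ennreal (1 / R ^ DIM('a) * R ^ DIM('a)) * (\<integral>\<^sup>+z. h (x + R *\<^sub>R z) \<partial>lborel)"
    using R by (simp only: mult.assoc[symmetric]) (simp flip: ennreal_mult')
  then show ?thesis using R by simp
qed

lemma nn_integral_unit_cube_affine:
  fixes h :: "'a::euclidean_space \<Rightarrow> ennreal"
  assumes [measurable]: "h \<in> borel_measurable borel" and R: "R > 0"
  shows "(\<integral>\<^sup>+z. h (x + R *\<^sub>R z) \<partial>unit_cube)
     = ennreal (1 / R ^ DIM('a)) * (\<integral>\<^sup>+y. h y * indicator (cbox 0 One) ((1 / R) *\<^sub>R (y - x)) \<partial>lborel)"
  using nn_integral_lborel_affine[of "\<lambda>y. h y * indicator (cbox 0 One) ((1 / R) *\<^sub>R (y - x))" R x] R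
  by (simp add: unit_cube_def nn_integral_density mult.commute)

lemma nn_integral_unit_cube_affine_le:
  fixes h :: "'a::euclidean_space \<Rightarrow> ennreal"
  assumes "h \<in> borel_measurable borel" and "R > 0"
  shows "(\<integral>\<^sup>+z. h (x + R *\<^sub>R z) \<partial>unit_cube) \<le> ennreal (1 / R ^ DIM('a)) * (\<integral>\<^sup>+y. h y \<partial>lborel)"
  unfolding nn_integral_unit_cube_affine[OF assms]
  by (intro mult_left_mono nn_integral_mono) (auto simp: indicator_def)

lemma nn_integral_L2:
  "L2 M f \<Longrightarrow> (\<integral>\<^sup>+x. ennreal ((norm (f x))\<^sup>2) \<partial>M) = ennreal ((L2n M f)\<^sup>2)"
  unfolding L2n_sq ip_def power2_norm_eq_inner[symmetric]
  by (rule nn_integral_eq_integral) (auto simp: L2_def)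

lemma (in finite_measure) square_integral_le:
  assumes "f \<in> borel_measurable M" "\<And>x. \<bar>f x\<bar> \<le> (B::real)"
  shows "ennreal ((LINT x|M. f x)\<^sup>2) \<le> ennreal (measure M (space M)) * (\<integral>\<^sup>+x. ennreal ((f x)\<^sup>2) \<partial>M)"
proof -
  have f: "L2 M f" by (rule L2_bounded(1)[of f B]) (use assms in auto)
  have "\<bar>LINT x|M. f x\<bar> \<le> L2n M f * sqrt (measure M (space M))"
    using order_trans[OF integral_norm_bound L1_le_L2n(2)[OF f]] by (simp only: real_norm_def)
  then have "(LINT x|M. f x)\<^sup>2 \<le> (L2n M f * sqrt (measure M (space M)))\<^sup>2"
    by (metis abs_ge_zero power2_abs power_mono)
  then have "ennreal ((LINT x|M. f x)\<^sup>2) \<le> ennreal (measure M (space M) * (L2n M f)\<^sup>2)"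
    by (intro ennreal_leI) (simp add: power_mult_distrib mult.commute)
  also have "\<dots> = ennreal (measure M (space M)) * (\<integral>\<^sup>+x. ennreal ((f x)\<^sup>2) \<partial>M)"
    using nn_integral_L2[OF f] by (simp add: ennreal_mult)
  finally show ?thesis .
qed

lemmas square_integral_unit_cube_le =
  unit_cube.square_integral_le[unfolded space_unit_cube measure_unit_cube ennreal_1 mult_1]

text \<open>The fundamental theorem of calculus along the curve, followed by Cauchy-Schwarz on the
  parameter interval. The curve is general because shifts use straight lines at constant speed
  whereas \<open>avg_approx\<close> needs a curve of varying speed.\<close>

lemma square_increment_le:
  fixes \<phi> :: "'a::euclidean_space \<Rightarrow> real"
  assumes \<phi>: "test_fn \<Omega> \<phi>"
    and c: "\<And>t. (c has_vector_derivative c' t) (at t)" "continuous_on UNIV c'"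
  shows "ennreal ((\<phi> (c 1) - \<phi> (c 0))\<^sup>2)
     \<le> (\<integral>\<^sup>+t. ennreal ((norm (grad \<phi> (c t)))\<^sup>2 * (norm (c' t))\<^sup>2) \<partial>unit_cube)"
proof -
  define h where "h t = grad \<phi> (c t) \<bullet> c' t" for t
  have cc: "continuous_on UNIV c"
    using c(1) by (meson continuous_at_imp_continuous_on has_vector_derivative_continuous)
  have contg: "continuous_on UNIV (grad \<phi>)" using continuous_on_grad test_fnD(1)[OF \<phi>] by blast
  have conth: "continuous_on UNIV h"
    unfolding h_def by (intro continuous_intros c(2) continuous_on_compose2[OF contg cc]) auto
  have der: "((\<lambda>t. \<phi> (c t)) has_real_derivative h t) (at t)" for t
  proof -
    have "((\<lambda>t. \<phi> (c t)) has_derivative (\<lambda>s. grad \<phi> (c t) \<bullet> (s *\<^sub>R c' t))) (at t)"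
      using has_derivative_compose[OF c(1)[unfolded has_vector_derivative_def]
          smooth_fn_has_grad[OF test_fnD(1)[OF \<phi>]]] .
    then show ?thesis
      unfolding has_field_derivative_def h_def by (rule has_derivative_eq_rhs) (auto simp: fun_eq_iff)
  qed
  have hm: "h \<in> borel_measurable borel" using conth by (rule borel_measurable_continuous_onI)
  have "\<phi> (c 1) - \<phi> (c 0) = (LBINT t. h t * indicator {0..1} t)"
    by (rule integral_FTC_Icc_real[symmetric])
      (use der conth in \<open>auto simp: continuous_on_eq_continuous_at\<close>)
  also have "\<dots> = (LINT t|unit_cube. h t)"
    unfolding unit_cube_def using hm
    by (subst integral_density_indicator) (auto simp: mult.commute)
  \<comment> \<open>The indicator makes the integrand bounded everywhere, not just on the parameter
    interval, as \<open>square_integral_unit_cube_le\<close> asks.\<close>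
  also have "\<dots> = (LINT t|unit_cube. h t * indicator {0..1} t)"
  proof (rule integral_cong_AE)
    show "AE t in unit_cube. h t = h t * indicator {0..1} t"
      using AE_unit_cube[where 'a=real] by (rule eventually_mono) auto
  qed (use hm in measurable)
  finally have eq: "\<phi> (c 1) - \<phi> (c 0) = (LINT t|unit_cube. h t * indicator {0..1} t)" .
  have "compact (h ` {0..1})"
    using conth continuous_on_subset by (intro compact_continuous_image) auto
  then obtain B where B: "\<And>t. t \<in> {0..1} \<Longrightarrow> \<bar>h t\<bar> \<le> B"
    using compact_imp_bounded[of "h ` {0..1}"] unfolding bounded_iff by (metis imageI real_norm_def)
  have "ennreal ((\<phi> (c 1) - \<phi> (c 0))\<^sup>2) \<le> (\<integral>\<^sup>+t. ennreal ((h t * indicator {0..1} t)\<^sup>2) \<partial>unit_cube)"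
    unfolding eq
  proof (rule square_integral_unit_cube_le)
    show "\<bar>h t * indicator {0..1} t\<bar> \<le> max B 0" for t
      using B[of t] by (auto simp: indicator_def)
  qed (use hm in measurable)
  also have "\<dots> \<le> (\<integral>\<^sup>+t. ennreal ((norm (grad \<phi> (c t)))\<^sup>2 * (norm (c' t))\<^sup>2) \<partial>unit_cube)"
  proof (intro nn_integral_mono ennreal_leI)
    fix t
    have "(h t)\<^sup>2 \<le> (norm (grad \<phi> (c t)) * norm (c' t))\<^sup>2"
      unfolding h_def using Cauchy_Schwarz_ineq2 by (metis abs_ge_zero power2_abs power_mono)
    then show "(h t * indicator {0..1} t)\<^sup>2 \<le> (norm (grad \<phi> (c t)))\<^sup>2 * (norm (c' t))\<^sup>2"
      by (auto simp: indicator_def power_mult_distrib)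
  qed
  finally show ?thesis .
qed

text \<open>A density instead of a subspace measure: the space and the measurable sets of
  \<open>M\<close> are kept, so functions need no restriction and set integrals become plain
  integrals of the \<open>L2\<close> theory.\<close>

definition restr :: "'a::euclidean_space set \<Rightarrow> 'a measure \<Rightarrow> 'a measure" where
  "restr \<Omega> M = density M (indicator \<Omega>)"

lemma sets_restr [simp, measurable_cong]: "sets (restr \<Omega> M) = sets M"
  and space_restr [simp]: "space (restr \<Omega> M) = space M"
  by (auto simp: restr_def)

lemma measurable_restr [simp]: "borel_measurable (restr \<Omega> M) = borel_measurable M"
  by (rule measurable_cong_sets) simp_all

lemma set_lebesgue_integral_restr:
  fixes f :: "'a::euclidean_space \<Rightarrow> real"
  assumes "f \<in> borel_measurable M" "\<Omega> \<in> sets M"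
  shows "(LINT x:\<Omega>|M. f x) = (LINT x|restr \<Omega> M. f x)"
  unfolding restr_def set_lebesgue_integral_def using assms
  by (rule integral_density_indicator[symmetric])

lemma nn_integral_restr:
  assumes "f \<in> borel_measurable M" "\<Omega> \<in> sets M"
  shows "(\<integral>\<^sup>+x\<in>\<Omega>. f x \<partial>M) = (\<integral>\<^sup>+x. f x \<partial>restr \<Omega> M)"
  unfolding restr_def using assms by (subst nn_integral_density) (auto simp: mult.commute)

lemma AE_restr:
  assumes "\<Omega> \<in> sets M"
  shows "(AE x in restr \<Omega> M. P x) \<longleftrightarrow> (AE x in M. x \<in> \<Omega> \<longrightarrow> P x)"
  unfolding restr_def using assms by (subst AE_density) (auto simp: indicator_def)

section \<open>Trace inequality\<close>

lemma test_fn_measurable: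
  assumes "test_fn \<Omega> \<phi>"
  shows "\<phi> \<in> borel_measurable borel" "grad \<phi> \<in> borel_measurable borel"
  using test_fnD(1)[OF assms]
  by (auto intro!: borel_measurable_continuous_onI smooth_fn_continuous continuous_on_grad)

lemma test_fn_L2:
  assumes "test_fn \<Omega> \<phi>" "finite_measure M" "sets borel \<subseteq> sets M" "space M = UNIV"
  shows "L2 M \<phi>" "L2 M (grad \<phi>)"
proof -
  interpret finite_measure M by fact
  obtain B where B: "\<And>x. \<bar>\<phi> x\<bar> \<le> B" "\<And>x. norm (grad \<phi> x) \<le> B" "B \<ge> 0"
    by (rule test_fn_bounded[OF assms(1)]) (rule that)
  have m: "f \<in> borel_measurable M" if "f \<in> borel_measurable borel" for f :: "'a \<Rightarrow> 'c::euclidean_space"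
    using that assms(3,4) unfolding measurable_def by auto
  have c: "integrable M (\<lambda>x. B\<^sup>2)" by simp
  have sq: "(norm (\<phi> x))\<^sup>2 \<le> B\<^sup>2" "(norm (grad \<phi> x))\<^sup>2 \<le> B\<^sup>2" for x
    using B power_mono[of "norm (\<phi> x)" B 2] power_mono[of "norm (grad \<phi> x)" B 2] by auto
  show "L2 M \<phi>"
    by (rule L2I_bound[OF m[OF test_fn_measurable(1)[OF assms(1)]] c])
      (use sq in auto)
  show "L2 M (grad \<phi>)"
    by (rule L2I_bound[OF m[OF test_fn_measurable(2)[OF assms(1)]] c])
      (use sq in auto)
qed

abbreviation leb :: "'a::euclidean_space set \<Rightarrow> 'a measure" where
  "leb \<Omega> \<equiv> restr \<Omega> lebesgue"

lemma finite_measure_leb: "open \<Omega> \<Longrightarrow> bounded \<Omega> \<Longrightarrow> finite_measure (leb \<Omega>)"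
proof
  assume a: "open \<Omega>" "bounded \<Omega>"
  then have "\<Omega> \<in> lmeasurable" by (simp add: bounded_set_imp_lmeasurable lmeasurable_open)
  then show "emeasure (leb \<Omega>) (space (leb \<Omega>)) \<noteq> \<infinity>"
    unfolding restr_def by (subst emeasure_density) (auto simp: fmeasurable_def less_top)
qed

lemma nn_integral_lborel_eq_leb:
  fixes k :: "'a::euclidean_space \<Rightarrow> ennreal"
  assumes k: "k \<in> borel_measurable borel" and \<Omega>: "open \<Omega>" and 0: "\<And>x. x \<notin> \<Omega> \<Longrightarrow> k x = 0"
  shows "(\<integral>\<^sup>+x. k x \<partial>lborel) = (\<integral>\<^sup>+x. k x \<partial>leb \<Omega>)"
proof -
  have kl: "k \<in> borel_measurable lebesgue"
    by (rule measurable_completion) (use k in simp)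
  have "(\<integral>\<^sup>+x. k x \<partial>leb \<Omega>) = (\<integral>\<^sup>+x. indicator \<Omega> x * k x \<partial>lebesgue)"
    unfolding restr_def
    by (rule nn_integral_density[OF borel_measurable_indicator kl]) (use \<Omega> lebesgue_openin in auto)
  also have "\<dots> = (\<integral>\<^sup>+x. k x \<partial>lebesgue)"
    using 0 by (intro nn_integral_cong) (auto simp: indicator_def)
  finally show ?thesis using k by (simp add: nn_integral_completion)
qed

lemma sets_borel_le_lebesgue: "sets (borel :: 'a::euclidean_space measure) \<subseteq> sets lebesgue"
  by (metis sets_completionI_sets sets_lborel subsetI)

lemma nn_integral_test_fn:
  fixes \<Omega> :: "'a::euclidean_space set"
  assumes \<phi>: "test_fn \<Omega> \<phi>" and \<Omega>: "open \<Omega>" "bounded \<Omega>"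
  shows "(\<integral>\<^sup>+x. ennreal ((\<phi> x)\<^sup>2) \<partial>lborel) = ennreal ((L2n (leb \<Omega>) \<phi>)\<^sup>2)"
    "(\<integral>\<^sup>+x. ennreal ((norm (grad \<phi> x))\<^sup>2) \<partial>lborel) = ennreal ((L2n (leb \<Omega>) (grad \<phi>))\<^sup>2)"
proof -
  note m = test_fn_measurable[OF \<phi>]
  have L: "L2 (leb \<Omega>) \<phi>" "L2 (leb \<Omega>) (grad \<phi>)"
    by (rule test_fn_L2[OF \<phi> finite_measure_leb[OF \<Omega>]]; use sets_borel_le_lebesgue in simp)+
  show "(\<integral>\<^sup>+x. ennreal ((\<phi> x)\<^sup>2) \<partial>lborel) = ennreal ((L2n (leb \<Omega>) \<phi>)\<^sup>2)"
    using nn_integral_L2[OF L(1)] nn_integral_lborel_eq_leb[of "\<lambda>x. ennreal ((\<phi> x)\<^sup>2)" \<Omega>] m \<Omega> test_fnD(4)[OF \<phi>]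
    by simp
  show "(\<integral>\<^sup>+x. ennreal ((norm (grad \<phi> x))\<^sup>2) \<partial>lborel) = ennreal ((L2n (leb \<Omega>) (grad \<phi>))\<^sup>2)"
    using nn_integral_L2[OF L(2)] nn_integral_lborel_eq_leb[of "\<lambda>x. ennreal ((norm (grad \<phi> x))\<^sup>2)" \<Omega>] m \<Omega>
      test_fnD(5)[OF \<phi>]
    by simp
qed

text \<open>The increment along the segment from \<open>x\<close> to \<open>x + v\<close> is
  integrated over all of space; Fubini and translation invariance reduce it to the energy. As
  \<open>\<phi>\<close> vanishes off \<open>\<Omega>\<close>, shifts may leave the domain.\<close>

lemma nn_integral_shift_diff:
  fixes \<Omega> :: "'a::euclidean_space set"
  assumes \<phi>: "test_fn \<Omega> \<phi>" and \<Omega>: "open \<Omega>" "bounded \<Omega>"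
  shows "(\<integral>\<^sup>+x. ennreal ((\<phi> (x + v) - \<phi> x)\<^sup>2) \<partial>lborel) \<le> ennreal ((norm v * L2n (leb \<Omega>) (grad \<phi>))\<^sup>2)"
proof -
  note [measurable] = test_fn_measurable[OF \<phi>]
  define N where "N = ennreal ((norm v)\<^sup>2)"
  define k where "k y = ennreal ((norm (grad \<phi> y))\<^sup>2)" for y
  have [measurable]: "k \<in> borel_measurable borel" unfolding k_def by measurable
  have kE: "(\<integral>\<^sup>+y. k y \<partial>lborel) = ennreal ((L2n (leb \<Omega>) (grad \<phi>))\<^sup>2)"
    unfolding k_def by (rule nn_integral_test_fn(2)[OF \<phi> \<Omega>])
  have pt: "ennreal ((\<phi> (x + v) - \<phi> x)\<^sup>2) \<le> (\<integral>\<^sup>+t. k (x + t *\<^sub>R v) * N \<partial>unit_cube)" for x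
  proof -
    have "((\<lambda>t. x + t *\<^sub>R v) has_vector_derivative v) (at t)" for t
      by (auto intro!: derivative_eq_intros simp: has_vector_derivative_def)
    from square_increment_le[OF \<phi> this] show ?thesis
      by (simp add: k_def N_def ennreal_mult)
  qed
  have "(\<integral>\<^sup>+x. ennreal ((\<phi> (x + v) - \<phi> x)\<^sup>2) \<partial>lborel) \<le> (\<integral>\<^sup>+x. (\<integral>\<^sup>+t. k (x + t *\<^sub>R v) * N \<partial>unit_cube) \<partial>lborel)"
    by (intro nn_integral_mono pt)
  also have "\<dots> = (\<integral>\<^sup>+t. (\<integral>\<^sup>+x. k (x + t *\<^sub>R v) * N \<partial>lborel) \<partial>unit_cube)"
    by (rule pair_sigma_finite.Fubini')
      (auto simp: pair_sigma_finite_def sigma_finite_lborel unit_cube.sigma_finite_measure_axioms N_def)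
  also have "\<dots> = (\<integral>\<^sup>+t. ennreal ((L2n (leb \<Omega>) (grad \<phi>))\<^sup>2) * N \<partial>(unit_cube :: real measure))"
  proof (intro nn_integral_cong)
    fix t :: real
    have "(\<integral>\<^sup>+x. k (x + t *\<^sub>R v) * N \<partial>lborel) = (\<integral>\<^sup>+x. k (t *\<^sub>R v + 1 *\<^sub>R x) \<partial>lborel) * N"
      by (subst nn_integral_multc[symmetric]) (auto simp: add.commute)
    also have "\<dots> = ennreal ((L2n (leb \<Omega>) (grad \<phi>))\<^sup>2) * N"
      by (subst nn_integral_lborel_affine) (auto simp: kE)
    finally show "(\<integral>\<^sup>+x. k (x + t *\<^sub>R v) * N \<partial>lborel) = ennreal ((L2n (leb \<Omega>) (grad \<phi>))\<^sup>2) * N" .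
  qed
  also have "\<dots> = ennreal ((norm v * L2n (leb \<Omega>) (grad \<phi>))\<^sup>2)"
    by (simp add: emeasure_unit_cube N_def power_mult_distrib mult.commute ennreal_mult)
  finally show ?thesis .
qed

text \<open>A shift by a vector longer than the diameter moves \<open>\<Omega>\<close> off itself.\<close>

lemma Poincare_leb:
  fixes \<Omega> :: "'a::euclidean_space set"
  assumes \<Omega>: "open \<Omega>" "bounded \<Omega>"
  obtains \<Lambda> where "\<Lambda> \<ge> 0" "\<And>\<phi>. test_fn \<Omega> \<phi> \<Longrightarrow> L2n (leb \<Omega>) \<phi> \<le> \<Lambda> * L2n (leb \<Omega>) (grad \<phi>)"
proof -
  obtain A where A: "A > 0" "\<And>x. x \<in> \<Omega> \<Longrightarrow> norm x \<le> A"
    using \<Omega>(2) by (auto simp: bounded_pos)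
  obtain e :: 'a where e: "norm e = 1" using vector_choose_size[of 1] by auto
  define v where "v = (3 * A) *\<^sub>R e"
  have nv: "norm v = 3 * A" using A e by (simp add: v_def)
  show ?thesis
  proof (rule that[of "3 * A"])
    fix \<phi> assume \<phi>: "test_fn \<Omega> \<phi>"
    \<comment> \<open>With \<open>norm v = 3 * A\<close> a point of norm at most \<open>A\<close> is
      moved to norm at least \<open>2 * A\<close>, where \<open>\<phi>\<close> is zero.\<close>
    have pt: "(\<phi> x)\<^sup>2 \<le> (\<phi> (x + v) - \<phi> x)\<^sup>2" for x
    proof (cases "x \<in> \<Omega>")
      case True
      have "norm (x + v) > A"
        using norm_triangle_ineq4[of "x + v" x] nv A(1) A(2)[OF True] by simp
      then have "x + v \<notin> \<Omega>" using A(2) by force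
      then show ?thesis using test_fnD(4)[OF \<phi>] by simp
    qed (use test_fnD(4)[OF \<phi>] in simp)
    have "(\<integral>\<^sup>+x. ennreal ((\<phi> x)\<^sup>2) \<partial>lborel) \<le> (\<integral>\<^sup>+x. ennreal ((\<phi> (x + v) - \<phi> x)\<^sup>2) \<partial>lborel)"
      by (intro nn_integral_mono ennreal_leI pt)
    also have "\<dots> \<le> ennreal ((norm v * L2n (leb \<Omega>) (grad \<phi>))\<^sup>2)"
      by (rule nn_integral_shift_diff[OF \<phi> \<Omega>])
    finally have "(L2n (leb \<Omega>) \<phi>)\<^sup>2 \<le> (3 * A * L2n (leb \<Omega>) (grad \<phi>))\<^sup>2"
      unfolding nn_integral_test_fn[OF \<phi> \<Omega>] nv by simp
    then show "L2n (leb \<Omega>) \<phi> \<le> 3 * A * L2n (leb \<Omega>) (grad \<phi>)"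
      using A by (simp add: power_mono_iff)
  qed (use A in simp)
qed

section \<open>Cube averages of test functions\<close>

definition avg :: "real \<Rightarrow> ('a::euclidean_space \<Rightarrow> real) \<Rightarrow> 'a \<Rightarrow> real" where
  "avg R \<phi> x = (LINT z|unit_cube. \<phi> (x + R *\<^sub>R z))"

lemma square_avg_diff_le:
  assumes \<phi>: "test_fn \<Omega> \<phi>"
  shows "ennreal ((avg R \<phi> x)\<^sup>2) \<le> (\<integral>\<^sup>+z. ennreal ((\<phi> (x + R *\<^sub>R z))\<^sup>2) \<partial>unit_cube)"
    "ennreal ((avg R \<phi> x - avg R \<phi> y)\<^sup>2)
      \<le> (\<integral>\<^sup>+z. ennreal ((\<phi> (x + R *\<^sub>R z) - \<phi> (y + R *\<^sub>R z))\<^sup>2) \<partial>unit_cube)"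
    "ennreal ((avg R \<phi> x - \<phi> x)\<^sup>2) \<le> (\<integral>\<^sup>+z. ennreal ((\<phi> (x + R *\<^sub>R z) - \<phi> x)\<^sup>2) \<partial>unit_cube)"
proof -
  note [measurable] = test_fn_measurable(1)[OF \<phi>]
  obtain B where B: "\<And>x. \<bar>\<phi> x\<bar> \<le> B" "\<And>x. norm (grad \<phi> x) \<le> B" "B \<ge> 0"
    by (rule test_fn_bounded[OF \<phi>]) (rule that)
  have B2: "\<bar>\<phi> x - \<phi> y\<bar> \<le> 2 * B" for x y using B(1)[of x] B(1)[of y] by linarith
  have int: "integrable unit_cube (\<lambda>z. \<phi> (x + R *\<^sub>R z))" for x
    by (rule unit_cube.integrable_const_bound[of _ B]) (use B in auto)
  have "avg R \<phi> x - avg R \<phi> y = (LINT z|unit_cube. \<phi> (x + R *\<^sub>R z) - \<phi> (y + R *\<^sub>R z))"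
    unfolding avg_def by (rule Bochner_Integration.integral_diff[symmetric]) (rule int)+
  then show "ennreal ((avg R \<phi> x - avg R \<phi> y)\<^sup>2)
      \<le> (\<integral>\<^sup>+z. ennreal ((\<phi> (x + R *\<^sub>R z) - \<phi> (y + R *\<^sub>R z))\<^sup>2) \<partial>unit_cube)"
    using square_integral_unit_cube_le[of "\<lambda>z. \<phi> (x + R *\<^sub>R z) - \<phi> (y + R *\<^sub>R z)" "2 * B"] B2
    by simp
  have "avg R \<phi> x - \<phi> x = (LINT z|unit_cube. \<phi> (x + R *\<^sub>R z) - \<phi> x)"
    unfolding avg_def by (subst Bochner_Integration.integral_diff[OF int]) auto
  then show "ennreal ((avg R \<phi> x - \<phi> x)\<^sup>2) \<le> (\<integral>\<^sup>+z. ennreal ((\<phi> (x + R *\<^sub>R z) - \<phi> x)\<^sup>2) \<partial>unit_cube)"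
    using square_integral_unit_cube_le[of "\<lambda>z. \<phi> (x + R *\<^sub>R z) - \<phi> x" "2 * B"] B2
    by simp
  show "ennreal ((avg R \<phi> x)\<^sup>2) \<le> (\<integral>\<^sup>+z. ennreal ((\<phi> (x + R *\<^sub>R z))\<^sup>2) \<partial>unit_cube)"
    using square_integral_unit_cube_le[of "\<lambda>z. \<phi> (x + R *\<^sub>R z)" B] B
    by (simp add: avg_def)
qed

lemma borel_measurable_avg [measurable]:
  assumes [measurable]: "\<phi> \<in> borel_measurable borel"
  shows "avg R \<phi> \<in> borel_measurable borel"
  unfolding avg_def by measurable

text \<open>The uniform measure on a cube of side \<open>R\<close> has density
  \<open>1 / R ^ DIM('a)\<close>, which bounds a mean square over the cube by the integral over all
  of space. For fixed \<open>R\<close> this makes the averages of an energy-bounded family bounded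
  and equi-Lipschitz.\<close>

lemma avg_bounds:
  fixes \<Omega> :: "'a::euclidean_space set"
  assumes \<phi>: "test_fn \<Omega> \<phi>" and \<Omega>: "open \<Omega>" "bounded \<Omega>" and R: "R > 0"
  shows "\<bar>avg R \<phi> x\<bar> \<le> sqrt (1 / R ^ DIM('a)) * L2n (leb \<Omega>) \<phi>"
    "\<bar>avg R \<phi> x - avg R \<phi> y\<bar> \<le> sqrt (1 / R ^ DIM('a)) * L2n (leb \<Omega>) (grad \<phi>) * norm (x - y)"
proof -
  note [measurable] = test_fn_measurable[OF \<phi>]
  have "ennreal ((avg R \<phi> x)\<^sup>2) \<le> ennreal (1 / R ^ DIM('a)) * ennreal ((L2n (leb \<Omega>) \<phi>)\<^sup>2)"
    using order_trans[OF square_avg_diff_le(1)[OF \<phi>]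
        nn_integral_unit_cube_affine_le[of "\<lambda>y. ennreal ((\<phi> y)\<^sup>2)" R x]] R
    by (simp add: nn_integral_test_fn[OF \<phi> \<Omega>])
  also have "\<dots> = ennreal (1 / R ^ DIM('a) * (L2n (leb \<Omega>) \<phi>)\<^sup>2)"
    using R by (intro ennreal_mult[symmetric]) auto
  finally have "(avg R \<phi> x)\<^sup>2 \<le> (1 / R ^ DIM('a)) * (L2n (leb \<Omega>) \<phi>)\<^sup>2"
    by (rule ennreal_le_iff[THEN iffD1, rotated]) (use R in auto)
  then have "sqrt ((avg R \<phi> x)\<^sup>2) \<le> sqrt ((1 / R ^ DIM('a)) * (L2n (leb \<Omega>) \<phi>)\<^sup>2)"
    by (rule real_sqrt_le_mono)
  then show "\<bar>avg R \<phi> x\<bar> \<le> sqrt (1 / R ^ DIM('a)) * L2n (leb \<Omega>) \<phi>"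
    by (simp add: real_sqrt_mult real_sqrt_divide)
  define N where "N = ennreal ((norm (x - y))\<^sup>2)"
  have pt: "ennreal ((\<phi> (x + R *\<^sub>R z) - \<phi> (y + R *\<^sub>R z))\<^sup>2)
    \<le> (\<integral>\<^sup>+t. ennreal ((norm (grad \<phi> ((y + t *\<^sub>R (x - y)) + R *\<^sub>R z)))\<^sup>2) * N \<partial>(unit_cube :: real measure))" for z
  proof -
    have "((\<lambda>t. y + t *\<^sub>R (x - y) + R *\<^sub>R z) has_vector_derivative x - y) (at t)" for t
      by (auto intro!: derivative_eq_intros)
    from square_increment_le[OF \<phi> this] show ?thesis
      by (simp add: ennreal_mult N_def)
  qed
  have "ennreal ((avg R \<phi> x - avg R \<phi> y)\<^sup>2)
      \<le> (\<integral>\<^sup>+z. ennreal ((\<phi> (x + R *\<^sub>R z) - \<phi> (y + R *\<^sub>R z))\<^sup>2) \<partial>unit_cube)"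
    by (rule square_avg_diff_le(2)[OF \<phi>])
  also have "\<dots> \<le> (\<integral>\<^sup>+z. (\<integral>\<^sup>+t. ennreal ((norm (grad \<phi> ((y + t *\<^sub>R (x - y)) + R *\<^sub>R z)))\<^sup>2) * N \<partial>(unit_cube :: real measure)) \<partial>unit_cube)"
    by (intro nn_integral_mono pt)
  also have "\<dots> = (\<integral>\<^sup>+t. (\<integral>\<^sup>+z. ennreal ((norm (grad \<phi> ((y + t *\<^sub>R (x - y)) + R *\<^sub>R z)))\<^sup>2) * N \<partial>unit_cube) \<partial>unit_cube)"
    by (rule pair_sigma_finite.Fubini')
      (auto simp: pair_sigma_finite_def unit_cube.sigma_finite_measure_axioms N_def)
  also have "\<dots> \<le> (\<integral>\<^sup>+t. ennreal (1 / R ^ DIM('a) * (L2n (leb \<Omega>) (grad \<phi>))\<^sup>2) * N \<partial>(unit_cube :: real measure))"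
  proof (intro nn_integral_mono)
    fix t :: real
    have "(\<integral>\<^sup>+z. ennreal ((norm (grad \<phi> ((y + t *\<^sub>R (x - y)) + R *\<^sub>R z)))\<^sup>2) * N \<partial>unit_cube)
      = (\<integral>\<^sup>+z. ennreal ((norm (grad \<phi> ((y + t *\<^sub>R (x - y)) + R *\<^sub>R z)))\<^sup>2) \<partial>unit_cube) * N"
      by (rule nn_integral_multc) measurable
    also have "\<dots> \<le> (ennreal (1 / R ^ DIM('a)) * ennreal ((L2n (leb \<Omega>) (grad \<phi>))\<^sup>2)) * N"
      using nn_integral_unit_cube_affine_le[of "\<lambda>y. ennreal ((norm (grad \<phi> y))\<^sup>2)" R "y + t *\<^sub>R (x - y)"] R
      by (intro mult_right_mono) (simp_all add: nn_integral_test_fn[OF \<phi> \<Omega>])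
    also have "ennreal (1 / R ^ DIM('a)) * ennreal ((L2n (leb \<Omega>) (grad \<phi>))\<^sup>2)
      = ennreal (1 / R ^ DIM('a) * (L2n (leb \<Omega>) (grad \<phi>))\<^sup>2)"
      using R by (intro ennreal_mult[symmetric]) auto
    finally show "(\<integral>\<^sup>+z. ennreal ((norm (grad \<phi> ((y + t *\<^sub>R (x - y)) + R *\<^sub>R z)))\<^sup>2) * N \<partial>unit_cube)
      \<le> ennreal (1 / R ^ DIM('a) * (L2n (leb \<Omega>) (grad \<phi>))\<^sup>2) * N" .
  qed
  also have "\<dots> = ennreal (1 / R ^ DIM('a) * (L2n (leb \<Omega>) (grad \<phi>))\<^sup>2 * (norm (x - y))\<^sup>2)"
  proof -
    have "ennreal (1 / R ^ DIM('a) * (L2n (leb \<Omega>) (grad \<phi>))\<^sup>2 * (norm (x - y))\<^sup>2)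
      = ennreal (1 / R ^ DIM('a) * (L2n (leb \<Omega>) (grad \<phi>))\<^sup>2) * N"
      unfolding N_def using R by (intro ennreal_mult) auto
    then show ?thesis by (simp add: emeasure_unit_cube)
  qed
  finally have "(avg R \<phi> x - avg R \<phi> y)\<^sup>2 \<le> 1 / R ^ DIM('a) * (L2n (leb \<Omega>) (grad \<phi>))\<^sup>2 * (norm (x - y))\<^sup>2"
    using R by simp
  then have "sqrt ((avg R \<phi> x - avg R \<phi> y)\<^sup>2)
      \<le> sqrt (1 / R ^ DIM('a) * (L2n (leb \<Omega>) (grad \<phi>))\<^sup>2 * (norm (x - y))\<^sup>2)"
    by (rule real_sqrt_le_mono)
  then show "\<bar>avg R \<phi> x - avg R \<phi> y\<bar> \<le> sqrt (1 / R ^ DIM('a)) * L2n (leb \<Omega>) (grad \<phi>) * norm (x - y)"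
    by (simp add: real_sqrt_mult real_sqrt_divide)
qed

locale growth_measure = finite_measure m for m :: "'a::euclidean_space measure" +
  fixes C s :: real
  assumes sets_m [simp, measurable_cong]: "sets m = sets borel"
    and C: "0 \<le> C" and s: "0 \<le> s" "s > real DIM('a) - 2"
    and growth: "\<And>x r. 0 < r \<Longrightarrow> measure m (ball x r) \<le> C * r powr s"
begin

lemma space_m [simp]: "space m = UNIV"
  using sets_eq_imp_space_eq[OF sets_m] by simp

text \<open>By Fubini every point \<open>y\<close> is weighted by the measure of the
  \<open>x\<close> whose cube of side \<open>r\<close> reaches \<open>y\<close>. These
  \<open>x\<close> lie in a ball of radius comparable to \<open>r\<close>, so the growth bound gives
  \<open>r powr s\<close>, divided by the volume of the cube.\<close>

lemma translate_energy_le: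
  fixes k :: "'a \<Rightarrow> ennreal"
  assumes [measurable]: "k \<in> borel_measurable borel" and r: "r > 0"
  shows "(\<integral>\<^sup>+x. (\<integral>\<^sup>+z. k (x + r *\<^sub>R z) \<partial>unit_cube) \<partial>m)
    \<le> ennreal (C * (real DIM('a) + 1) powr s * r powr (s - real DIM('a))) * (\<integral>\<^sup>+y. k y \<partial>lborel)"
proof -
  let ?d = "real DIM('a)"
  \<comment> \<open>Points of the unit cube have norm at most the dimension; adding 1 makes the
    inequality strict, as open balls require.\<close>
  define \<kappa> where "\<kappa> = (?d + 1) * r"
  have \<kappa>: "\<kappa> > 0" using r by (simp add: \<kappa>_def add_nonneg_pos)
  have [measurable]: "(\<lambda>x::'a \<times> 'a. snd x - fst x \<in> ball 0 \<kappa>) \<in> measurable (borel \<Otimes>\<^sub>M borel) (count_space UNIV)"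
      "(\<lambda>x::'a \<times> 'a. fst x - snd x \<in> ball 0 \<kappa>) \<in> measurable (borel \<Otimes>\<^sub>M borel) (count_space UNIV)"
      "(\<lambda>x::'a. y - x \<in> ball 0 \<kappa>) \<in> measurable borel (count_space UNIV)"
    for \<kappa> y unfolding mem_ball_0 by measurable
  have sub: "indicator (cbox 0 One) ((1 / r) *\<^sub>R (y - x)) \<le> (indicator (ball 0 \<kappa>) (y - x) :: ennreal)"
    for x y :: 'a
  proof (cases "(1 / r) *\<^sub>R (y - x) \<in> cbox 0 One")
    case True
    then have "norm ((1 / r) *\<^sub>R (y - x)) \<le> ?d" by (rule norm_unit_cube)
    then have "norm (y - x) \<le> ?d * r" unfolding norm_scaleR using r by (simp add: field_simps)
    also have "\<dots> < \<kappa>" using r by (simp add: \<kappa>_def)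
    finally show ?thesis by (simp add: indicator_def)
  qed simp
  have "(\<integral>\<^sup>+x. (\<integral>\<^sup>+z. k (x + r *\<^sub>R z) \<partial>unit_cube) \<partial>m)
    \<le> (\<integral>\<^sup>+x. (ennreal (1 / r ^ DIM('a)) * (\<integral>\<^sup>+y. k y * indicator (ball 0 \<kappa>) (y - x) \<partial>lborel)) \<partial>m)"
    using r by (subst nn_integral_unit_cube_affine)
      (auto intro!: nn_integral_mono mult_left_mono sub)
  also have "\<dots> = ennreal (1 / r ^ DIM('a)) * (\<integral>\<^sup>+x. (\<integral>\<^sup>+y. k y * indicator (ball 0 \<kappa>) (y - x) \<partial>lborel) \<partial>m)"
    by (rule nn_integral_cmult) measurable
  also have "(\<integral>\<^sup>+x. (\<integral>\<^sup>+y. k y * indicator (ball 0 \<kappa>) (y - x) \<partial>lborel) \<partial>m)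
    = (\<integral>\<^sup>+y. (\<integral>\<^sup>+x. k y * indicator (ball 0 \<kappa>) (y - x) \<partial>m) \<partial>lborel)"
    by (rule pair_sigma_finite.Fubini')
      (auto simp: pair_sigma_finite_def sigma_finite_lborel sigma_finite_measure_axioms)
  also have "\<dots> = (\<integral>\<^sup>+y. k y * emeasure m (ball y \<kappa>) \<partial>lborel)"
  proof (intro nn_integral_cong)
    fix y
    have "(\<integral>\<^sup>+x. k y * indicator (ball 0 \<kappa>) (y - x) \<partial>m) = k y * (\<integral>\<^sup>+x. indicator (ball 0 \<kappa>) (y - x) \<partial>m)"
      by (rule nn_integral_cmult) measurable
    also have "(\<integral>\<^sup>+x. indicator (ball 0 \<kappa>) (y - x) \<partial>m) = (\<integral>\<^sup>+x. indicator (ball y \<kappa>) x \<partial>m)"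
      by (intro nn_integral_cong) (auto simp: indicator_def dist_norm norm_minus_commute)
    finally show "(\<integral>\<^sup>+x. k y * indicator (ball 0 \<kappa>) (y - x) \<partial>m) = k y * emeasure m (ball y \<kappa>)" by simp
  qed
  also have "\<dots> \<le> (\<integral>\<^sup>+y. k y * ennreal (C * \<kappa> powr s) \<partial>lborel)"
    using growth[OF \<kappa>] by (intro nn_integral_mono mult_left_mono) (auto simp: emeasure_eq_measure intro!: ennreal_leI)
  also have "\<dots> = (\<integral>\<^sup>+y. k y \<partial>lborel) * ennreal (C * \<kappa> powr s)"
    by (rule nn_integral_multc) measurable
  finally have "(\<integral>\<^sup>+x. (\<integral>\<^sup>+z. k (x + r *\<^sub>R z) \<partial>unit_cube) \<partial>m)
      \<le> ennreal (1 / r ^ DIM('a)) * ((\<integral>\<^sup>+y. k y \<partial>lborel) * ennreal (C * \<kappa> powr s))"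
    by (simp add: mult_left_mono)
  also have "\<dots> = ennreal (C * \<kappa> powr s / r ^ DIM('a)) * (\<integral>\<^sup>+y. k y \<partial>lborel)"
    using r C by (simp add: mult_ac flip: ennreal_mult')
  also have "C * \<kappa> powr s / r ^ DIM('a) = C * (?d + 1) powr s * r powr (s - ?d)"
    using r by (simp add: \<kappa>_def powr_mult powr_diff powr_realpow)
  finally show ?thesis .
qed

text \<open>The path \<open>t \<mapsto> x + R t\<^sup>p z\<close> with \<open>p (s + 2 - d) \<ge> 2\<close> slows down near \<open>x\<close>, which absorbs the
  singular factor \<open>r powr (s - d)\<close> of the previous bound.\<close>

lemma avg_approx:
  assumes \<Omega>: "open \<Omega>" "bounded \<Omega>"
  obtains K where "K \<ge> 0" "\<And>\<phi> R. test_fn \<Omega> \<phi> \<Longrightarrow> 0 < R \<Longrightarrow>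
    L2n m (\<lambda>x. avg R \<phi> x - \<phi> x) \<le> K * R powr ((s + 2 - real DIM('a)) / 2) * L2n (leb \<Omega>) (grad \<phi>)"
proof -
  let ?d = "real DIM('a)"
  define \<gamma> where "\<gamma> = s + 2 - ?d"
  have \<gamma>: "\<gamma> > 0" using s by (simp add: \<gamma>_def)
  obtain p0 :: nat where p0: "2 / \<gamma> < real p0" using reals_Archimedean2 by blast
  \<comment> \<open>Large enough for \<open>p * \<gamma> - 2\<close>, the power of \<open>t\<close>
    left over in \<open>W\<close>, to be nonnegative.\<close>
  define p where "p = max 2 p0"
  have p: "p \<ge> 2" "real p * \<gamma> \<ge> 2"
  proof -
    have "2 / \<gamma> \<le> real p" using p0 by (simp add: p_def)
    then show "real p * \<gamma> \<ge> 2" using \<gamma> by (simp add: field_simps)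
  qed (simp add: p_def)
  define c0 where "c0 = C * (?d + 1) powr s"
  have c0: "c0 \<ge> 0" using C by (simp add: c0_def)
  define K where "K = sqrt c0 * p * ?d"
  have K0: "K \<ge> 0" using c0 by (simp add: K_def)
  have main: "L2n m (\<lambda>x. avg R \<phi> x - \<phi> x) \<le> K * R powr (\<gamma> / 2) * L2n (leb \<Omega>) (grad \<phi>)"
    if \<phi>: "test_fn \<Omega> \<phi>" and R: "0 < R" for \<phi> R
  proof -
    note [measurable] = test_fn_measurable[OF \<phi>]
    note cont_g = continuous_on_grad[OF test_fnD(1)[OF \<phi>], of UNIV]
    define E where "E = (L2n (leb \<Omega>) (grad \<phi>))\<^sup>2"
    define w where "w t = (R * (real p * t ^ (p - 1)) * ?d)\<^sup>2" for t
    have [measurable]: "w \<in> borel_measurable borel" unfolding w_def by measurable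
    define k where "k y = ennreal ((norm (grad \<phi> y))\<^sup>2)" for y
    have [measurable]: "k \<in> borel_measurable borel" unfolding k_def by measurable
    have kE: "(\<integral>\<^sup>+y. k y \<partial>lborel) = ennreal E"
      unfolding k_def E_def by (rule nn_integral_test_fn[OF \<phi> \<Omega>])
    have pt: "ennreal ((\<phi> (x + R *\<^sub>R z) - \<phi> x)\<^sup>2)
      \<le> (\<integral>\<^sup>+t. k (x + (R * t ^ p) *\<^sub>R z) * ennreal (w t) \<partial>unit_cube)"
      if z: "z \<in> cbox 0 One" for x z
    proof -
      define c' where "c' t = (R * (real p * t ^ (p - 1))) *\<^sub>R z" for t
      have 1: "((\<lambda>t. x + (R * t ^ p) *\<^sub>R z) has_vector_derivative c' t) (at t)" for t
        unfolding c'_def by (auto intro!: derivative_eq_intros simp: has_vector_derivative_def fun_eq_iff)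
      have 2: "continuous_on UNIV c'" unfolding c'_def by (intro continuous_intros)
      have p1: "(0::real) ^ p = 0" using p by simp
      have "ennreal ((\<phi> (x + R *\<^sub>R z) - \<phi> x)\<^sup>2)
        \<le> (\<integral>\<^sup>+t. ennreal ((norm (grad \<phi> (x + (R * t ^ p) *\<^sub>R z)))\<^sup>2 * (norm (c' t))\<^sup>2) \<partial>unit_cube)"
        using square_increment_le[OF \<phi> 1 2] p1 by simp
      also have "\<dots> \<le> (\<integral>\<^sup>+t. k (x + (R * t ^ p) *\<^sub>R z) * ennreal (w t) \<partial>unit_cube)"
      proof (intro nn_integral_mono)
        fix t
        have "norm (c' t) = \<bar>R * (real p * t ^ (p - 1))\<bar> * norm z" by (simp add: c'_def)
        then have "(norm (c' t))\<^sup>2 = (R * (real p * t ^ (p - 1)))\<^sup>2 * (norm z)\<^sup>2"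
          by (simp only: power_mult_distrib power2_abs)
        also have "\<dots> \<le> (R * (real p * t ^ (p - 1)))\<^sup>2 * ?d\<^sup>2"
          using norm_unit_cube[OF z] by (intro mult_left_mono power_mono) auto
        finally have "(norm (c' t))\<^sup>2 \<le> w t" by (simp add: w_def power_mult_distrib)
        then have "ennreal ((norm (c' t))\<^sup>2) \<le> ennreal (w t)" by (rule ennreal_leI)
        then show "ennreal ((norm (grad \<phi> (x + (R * t ^ p) *\<^sub>R z)))\<^sup>2 * (norm (c' t))\<^sup>2)
          \<le> k (x + (R * t ^ p) *\<^sub>R z) * ennreal (w t)"
          unfolding k_def by (simp add: ennreal_mult mult_left_mono)
      qed
      finally show ?thesis .
    qed
    have "(\<integral>\<^sup>+x. ennreal ((avg R \<phi> x - \<phi> x)\<^sup>2) \<partial>m)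
      \<le> (\<integral>\<^sup>+x. (\<integral>\<^sup>+z. ennreal ((\<phi> (x + R *\<^sub>R z) - \<phi> x)\<^sup>2) \<partial>unit_cube) \<partial>m)"
      by (intro nn_integral_mono square_avg_diff_le(3)[OF \<phi>])
    also have "\<dots> \<le> (\<integral>\<^sup>+x. (\<integral>\<^sup>+z. (\<integral>\<^sup>+t. k (x + (R * t ^ p) *\<^sub>R z) * ennreal (w t) \<partial>unit_cube) \<partial>unit_cube) \<partial>m)"
      by (intro nn_integral_mono nn_integral_mono_AE eventually_mono[OF AE_unit_cube] pt)
    \<comment> \<open>Two exchanges of integrals bring \<open>t\<close> to the outside, so that
      \<open>translate_energy_le\<close> applies for each fixed \<open>t\<close> with radius
      \<open>R * t ^ p\<close>.\<close>
    also have "\<dots> = (\<integral>\<^sup>+x. (\<integral>\<^sup>+t. (\<integral>\<^sup>+z. k (x + (R * t ^ p) *\<^sub>R z) * ennreal (w t) \<partial>unit_cube) \<partial>unit_cube) \<partial>m)"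
      by (intro nn_integral_cong pair_sigma_finite.Fubini')
        (auto simp: pair_sigma_finite_def unit_cube.sigma_finite_measure_axioms)
    also have "\<dots> = (\<integral>\<^sup>+t. (\<integral>\<^sup>+x. (\<integral>\<^sup>+z. k (x + (R * t ^ p) *\<^sub>R z) * ennreal (w t) \<partial>unit_cube) \<partial>m) \<partial>unit_cube)"
      by (rule pair_sigma_finite.Fubini')
        (auto simp: pair_sigma_finite_def unit_cube.sigma_finite_measure_axioms sigma_finite_measure_axioms)
    also have "\<dots> \<le> (\<integral>\<^sup>+t. ennreal (c0 * R powr \<gamma> * (real p * ?d)\<^sup>2 * E) \<partial>(unit_cube :: real measure))"
    proof (intro nn_integral_mono_AE eventually_mono[OF AE_unit_cube])
      fix t :: real assume "t \<in> cbox 0 One"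
      then have t: "0 \<le> t" "t \<le> 1" by auto
      show "(\<integral>\<^sup>+x. (\<integral>\<^sup>+z. k (x + (R * t ^ p) *\<^sub>R z) * ennreal (w t) \<partial>unit_cube) \<partial>m)
        \<le> ennreal (c0 * R powr \<gamma> * (real p * ?d)\<^sup>2 * E)"
      proof (cases "t = 0")
        case True
        \<comment> \<open>The growth bound needs a positive radius, so the start of the curve is
          treated apart; its speed vanishes there because \<open>p \<ge> 2\<close>.\<close>
        then have "w t = 0" using p by (simp add: w_def)
        then show ?thesis by simp
      next
        case False
        then have t0: "t > 0" using t by simp
        \<comment> \<open>The squared speed contributes the power \<open>2 * (p - 1)\<close> of
          \<open>t\<close>, the growth bound the power \<open>p * (s - d)\<close>; their sum is
          \<open>p * \<gamma> - 2\<close>.\<close>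
        have W: "(R * t ^ p) powr (s - ?d) * w t \<le> R powr \<gamma> * (real p * ?d)\<^sup>2"
        proof -
          have "(R * t ^ p) powr (s - ?d) = R powr (s - ?d) * t powr (real p * (s - ?d))"
          proof -
            have "t ^ p = t powr real p" using t0 by (rule powr_realpow[symmetric])
            then show ?thesis using R t0 by (simp add: powr_mult powr_powr)
          qed
          moreover have "w t = R powr 2 * t powr (2 * (real p - 1)) * (real p * ?d)\<^sup>2"
          proof -
            have "(t ^ (p - 1))\<^sup>2 = t ^ (2 * (p - 1))" by (simp add: power_mult[symmetric] mult.commute)
            also have "\<dots> = t powr (real (2 * (p - 1)))" using t0 by (rule powr_realpow[symmetric])
            also have "real (2 * (p - 1)) = 2 * (real p - 1)" using p by (simp add: of_nat_diff)
            finally have "(t ^ (p - 1))\<^sup>2 = t powr (2 * (real p - 1))" .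
            moreover have "R powr 2 = R\<^sup>2" using R by simp
            ultimately show ?thesis by (simp add: w_def power_mult_distrib)
          qed
          ultimately have "(R * t ^ p) powr (s - ?d) * w t
            = R powr (s - ?d + 2) * t powr (real p * (s - ?d) + 2 * (real p - 1)) * (real p * ?d)\<^sup>2"
            by (simp only: powr_add) (simp only: mult_ac)
          also have "\<dots> \<le> R powr (s - ?d + 2) * 1 * (real p * ?d)\<^sup>2"
          proof (intro mult_right_mono mult_left_mono)
            have "real p * (s - ?d) + 2 * (real p - 1) \<ge> 0"
              using p(2) by (simp add: \<gamma>_def algebra_simps)
            then show "t powr (real p * (s - ?d) + 2 * (real p - 1)) \<le> 1"
              using t t0 by (intro powr_le1) auto
          qed auto
          finally show ?thesis by (simp add: \<gamma>_def algebra_simps)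
        qed
        have nn: "0 \<le> c0 * (R * t ^ p) powr (s - ?d)" "0 \<le> w t" "0 \<le> E"
          using c0 by (auto simp: w_def E_def)
        have "(\<integral>\<^sup>+x. (\<integral>\<^sup>+z. k (x + (R * t ^ p) *\<^sub>R z) * ennreal (w t) \<partial>unit_cube) \<partial>m)
          = (\<integral>\<^sup>+x. (\<integral>\<^sup>+z. k (x + (R * t ^ p) *\<^sub>R z) \<partial>unit_cube) \<partial>m) * ennreal (w t)"
          by (subst nn_integral_multc[symmetric], measurable) (simp add: nn_integral_multc)
        also have "\<dots> \<le> (ennreal (c0 * (R * t ^ p) powr (s - ?d)) * ennreal E) * ennreal (w t)"
          using translate_energy_le[of k "R * t ^ p"] R t0 unfolding kE c0_def
          by (intro mult_right_mono) auto
        also have "\<dots> = ennreal (c0 * (R * t ^ p) powr (s - ?d) * E * w t)"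
          using nn by (simp only: ennreal_mult mult_nonneg_nonneg)
        also have "\<dots> \<le> ennreal (c0 * R powr \<gamma> * (real p * ?d)\<^sup>2 * E)"
        proof (rule ennreal_leI)
          have "(c0 * E) * ((R * t ^ p) powr (s - ?d) * w t) \<le> (c0 * E) * (R powr \<gamma> * (real p * ?d)\<^sup>2)"
            using W c0 nn by (intro mult_left_mono) auto
          then show "c0 * (R * t ^ p) powr (s - ?d) * E * w t \<le> c0 * R powr \<gamma> * (real p * ?d)\<^sup>2 * E"
            by (simp only: mult_ac)
        qed
        finally show ?thesis .
      qed
    qed
    also have "\<dots> = ennreal ((K * R powr (\<gamma> / 2) * L2n (leb \<Omega>) (grad \<phi>))\<^sup>2)"
    proof -
      have "(R powr (\<gamma> / 2))\<^sup>2 = R powr \<gamma>" using R by (simp add: power2_eq_square flip: powr_add)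
      then show ?thesis using c0
        by (simp add: emeasure_unit_cube K_def E_def power_mult_distrib mult_ac)
    qed
    finally have le: "(\<integral>\<^sup>+x. ennreal ((avg R \<phi> x - \<phi> x)\<^sup>2) \<partial>m)
      \<le> ennreal ((K * R powr (\<gamma> / 2) * L2n (leb \<Omega>) (grad \<phi>))\<^sup>2)" .
    have L2: "L2 m (\<lambda>x. avg R \<phi> x - \<phi> x)"
      unfolding L2_def using le by (auto intro!: integrableI_nonneg simp: order_le_less_trans)
    have "(L2n m (\<lambda>x. avg R \<phi> x - \<phi> x))\<^sup>2 \<le> (K * R powr (\<gamma> / 2) * L2n (leb \<Omega>) (grad \<phi>))\<^sup>2"
      using le nn_integral_L2[OF L2] by simp
    then show ?thesis using K0 by (simp add: power_mono_iff)
  qed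
  show ?thesis using that[OF K0] main by (simp add: \<gamma>_def)
qed

end

section \<open>Compact embedding and the space of weakly differentiable functions\<close>

context growth_measure
begin

lemma L2_avg:
  assumes \<phi>: "test_fn \<Omega> \<phi>" and \<Omega>: "open \<Omega>" "bounded \<Omega>" and R: "R > 0"
  shows "L2 m (avg R \<phi>)"
    "L2n m (avg R \<phi>) \<le> sqrt (1 / R ^ DIM('a)) * L2n (leb \<Omega>) \<phi> * sqrt (measure m UNIV)"
  using L2_bounded[of "avg R \<phi>" "sqrt (1 / R ^ DIM('a)) * L2n (leb \<Omega>) \<phi>"]
    avg_bounds(1)[OF \<phi> \<Omega> R] borel_measurable_avg[OF test_fn_measurable(1)[OF \<phi>]]
  by (simp_all add: measurable_cong_sets[OF sets_m refl])

lemma test_fn_L2_m: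
  assumes "test_fn \<Omega> \<phi>"
  shows "L2 m \<phi>" "L2 m (grad \<phi>)"
  by (rule test_fn_L2[OF assms finite_measure_axioms]; simp)+

text \<open>The average at scale 1 is controlled by the Lebesgue norm and hence, by
  \<open>Poincare_leb\<close>, by the energy; the remainder is the subject of
  \<open>avg_approx\<close>.\<close>

lemma trace_inequality:
  assumes \<Omega>: "open \<Omega>" "bounded \<Omega>"
  obtains K where "K \<ge> 0" "\<And>\<phi>. test_fn \<Omega> \<phi> \<Longrightarrow> L2n m \<phi> \<le> K * L2n (leb \<Omega>) (grad \<phi>)"
proof -
  obtain K where K: "K \<ge> 0" "\<And>\<phi> R. test_fn \<Omega> \<phi> \<Longrightarrow> 0 < R \<Longrightarrow>
    L2n m (\<lambda>x. avg R \<phi> x - \<phi> x) \<le> K * R powr ((s + 2 - real DIM('a)) / 2) * L2n (leb \<Omega>) (grad \<phi>)"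
    by (rule avg_approx[OF \<Omega>]) (rule that)
  obtain \<Lambda> where \<Lambda>: "\<Lambda> \<ge> 0" "\<And>\<phi>. test_fn \<Omega> \<phi> \<Longrightarrow> L2n (leb \<Omega>) \<phi> \<le> \<Lambda> * L2n (leb \<Omega>) (grad \<phi>)"
    by (rule Poincare_leb[OF \<Omega>]) (rule that)
  show ?thesis
  proof (rule that[of "\<Lambda> * sqrt (measure m UNIV) + K"])
    fix \<phi> assume \<phi>: "test_fn \<Omega> \<phi>"
    note L = L2_avg[OF \<phi> \<Omega>, of 1] test_fn_L2_m(1)[OF \<phi>]
    have "L2n m \<phi> = L2n m (\<lambda>x. avg 1 \<phi> x - (avg 1 \<phi> x - \<phi> x))" by simp
    also have "\<dots> \<le> L2n m (avg 1 \<phi>) + L2n m (\<lambda>x. avg 1 \<phi> x - \<phi> x)"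
      using L by (intro L2n_triangle_diff L2_diff) auto
    also have "L2n m (avg 1 \<phi>) \<le> L2n (leb \<Omega>) \<phi> * sqrt (measure m UNIV)"
      using L(2) by simp
    also have "\<dots> \<le> \<Lambda> * L2n (leb \<Omega>) (grad \<phi>) * sqrt (measure m UNIV)"
      using \<Lambda>(2)[OF \<phi>] by (intro mult_right_mono) auto
    also have "L2n m (\<lambda>x. avg 1 \<phi> x - \<phi> x) \<le> K * L2n (leb \<Omega>) (grad \<phi>)"
      using K(2)[OF \<phi>, of 1] by simp
    finally show "L2n m \<phi> \<le> (\<Lambda> * sqrt (measure m UNIV) + K) * L2n (leb \<Omega>) (grad \<phi>)"
      by (simp add: algebra_simps)
  qed (use K \<Lambda> in simp)
qed

text \<open>At each of countably many scales the averages are uniformly bounded and equi-Lipschitz,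
  so one subsequence makes them converge pointwise at all scales, and by dominated convergence in
  \<open>L2\<close>. Averages approximate the functions uniformly over the family, so the functions
  themselves are Cauchy.\<close>

lemma compact_embedding_test:
  assumes \<Omega>: "open \<Omega>" "bounded \<Omega>"
    and \<phi>: "\<And>k::nat. test_fn \<Omega> (\<phi> k)" and B: "\<And>k. L2n (leb \<Omega>) (grad (\<phi> k)) \<le> B"
  obtains r where "strict_mono (r :: nat \<Rightarrow> nat)"
    "\<And>e. e > 0 \<Longrightarrow> \<exists>N. \<forall>i\<ge>N. \<forall>j\<ge>N. L2n m (\<lambda>x. \<phi> (r i) x - \<phi> (r j) x) < e"
proof -
  have B0: "B \<ge> 0" using B[of 0] L2n_nonneg order_trans by blast
  define \<gamma> where "\<gamma> = (s + 2 - real DIM('a)) / 2"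
  have \<gamma>: "\<gamma> > 0" using s by (simp add: \<gamma>_def)
  obtain K where K: "K \<ge> 0" "\<And>\<phi> R. test_fn \<Omega> \<phi> \<Longrightarrow> 0 < R \<Longrightarrow>
    L2n m (\<lambda>x. avg R \<phi> x - \<phi> x) \<le> K * R powr \<gamma> * L2n (leb \<Omega>) (grad \<phi>)"
    by (rule avg_approx[OF \<Omega>, folded \<gamma>_def]) (rule that)
  obtain \<Lambda> where \<Lambda>: "\<Lambda> \<ge> 0" "\<And>\<phi>. test_fn \<Omega> \<phi> \<Longrightarrow> L2n (leb \<Omega>) \<phi> \<le> \<Lambda> * L2n (leb \<Omega>) (grad \<phi>)"
    by (rule Poincare_leb[OF \<Omega>]) (rule that)
  define \<rho> where "\<rho> j = 1 / real (Suc j)" for j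
  have \<rho>: "\<rho> j > 0" for j by (simp add: \<rho>_def)
  define b where "b j = sqrt (1 / \<rho> j ^ DIM('a)) * (\<Lambda> * B) + 1" for j
  have b1: "b j \<ge> 1" for j using \<Lambda> B0 \<rho>[of j] by (auto simp: b_def)
  have bd: "\<bar>avg (\<rho> j) (\<phi> n) x\<bar> \<le> b j" for j n x
  proof -
    have "\<bar>avg (\<rho> j) (\<phi> n) x\<bar> \<le> sqrt (1 / \<rho> j ^ DIM('a)) * L2n (leb \<Omega>) (\<phi> n)"
      by (rule avg_bounds(1)[OF \<phi> \<Omega> \<rho>])
    also have "L2n (leb \<Omega>) (\<phi> n) \<le> \<Lambda> * B"
      using \<Lambda>(2)[OF \<phi>[of n]] mult_left_mono[OF B[of n] \<Lambda>(1)] by linarith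
    finally show ?thesis using \<rho>[of j] by (auto simp: b_def mult_left_mono)
  qed
  obtain D :: "'a set" where D: "countable D" "\<And>X. open X \<Longrightarrow> X \<noteq> {} \<Longrightarrow> \<exists>d\<in>D. d \<in> X"
    using countable_dense_setE by blast
  \<comment> \<open>Dividing by \<open>b\<close> brings all scales under the bound 1, so one
    diagonal extraction over pairs of a scale and a dense point suffices. The summand 1 in
    \<open>b\<close> excludes division by zero.\<close>
  define f where "f n p = avg (\<rho> (fst p)) (\<phi> n) (snd p) / b (fst p)" for n p
  have "countable ((UNIV :: nat set) \<times> D)" using D by auto
  moreover have "norm (f n p) \<le> 1" for n p
    using bd[of "fst p" n "snd p"] b1[of "fst p"] by (auto simp: f_def field_simps)
  ultimately obtain r where r: "strict_mono (r::nat\<Rightarrow>nat)"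
    "\<And>p. p \<in> UNIV \<times> D \<Longrightarrow> \<exists>l. (\<lambda>n. f (r n) p) \<longlonglongrightarrow> l"
    by (rule function_convergent_subsequence[of "UNIV \<times> D" f 1]) blast
  have convD: "Cauchy (\<lambda>n. avg (\<rho> j) (\<phi> (r n)) d)" if "d \<in> D" for j d
  proof -
    obtain l where "(\<lambda>n. f (r n) (j, d)) \<longlonglongrightarrow> l" using r(2)[of "(j, d)"] \<open>d \<in> D\<close> by auto
    then have "(\<lambda>n. f (r n) (j, d) * b j) \<longlonglongrightarrow> l * b j" by (intro tendsto_intros)
    moreover have "f (r n) (j, d) * b j = avg (\<rho> j) (\<phi> (r n)) d" for n
      using b1[of j] by (simp add: f_def)
    ultimately show ?thesis using LIMSEQ_imp_Cauchy by auto
  qed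
  \<comment> \<open>At a fixed scale all averages share a Lipschitz constant, which carries
    convergence from the dense set to every point.\<close>
  have conv: "Cauchy (\<lambda>n. avg (\<rho> j) (\<phi> (r n)) x)" for j x
  proof (rule metric_CauchyI)
    fix e :: real assume e: "e > 0"
    define q where "q = sqrt (1 / \<rho> j ^ DIM('a)) * B + 1"
    have q: "q > 0" using B0 \<rho>[of j] by (auto simp: q_def add_nonneg_pos)
    obtain d where d: "d \<in> D" "d \<in> ball x (e / (3 * q))"
    proof -
      have "x \<in> ball x (e / (3 * q))" using e q by simp
      then show ?thesis using D(2)[OF open_ball, of x "e / (3 * q)"] that by blast
    qed
    have near: "\<bar>avg (\<rho> j) (\<phi> n) x - avg (\<rho> j) (\<phi> n) d\<bar> < e / 3" for n
    proof -
      have "\<bar>avg (\<rho> j) (\<phi> n) x - avg (\<rho> j) (\<phi> n) d\<bar>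
        \<le> sqrt (1 / \<rho> j ^ DIM('a)) * L2n (leb \<Omega>) (grad (\<phi> n)) * norm (x - d)"
        by (rule avg_bounds(2)[OF \<phi> \<Omega> \<rho>])
      also have "\<dots> \<le> q * norm (x - d)"
        unfolding q_def using B[of n] \<rho>[of j]
        by (intro mult_right_mono) (auto intro!: add_increasing2 mult_left_mono)
      also have "\<dots> < q * (e / (3 * q))"
        using d q by (intro mult_strict_left_mono) (auto simp: dist_norm)
      finally show ?thesis using q by simp
    qed
    obtain N where N: "\<And>m n. m \<ge> N \<Longrightarrow> n \<ge> N \<Longrightarrow>
      dist (avg (\<rho> j) (\<phi> (r m)) d) (avg (\<rho> j) (\<phi> (r n)) d) < e / 3"
      using metric_CauchyD[OF convD[OF d(1), of j], of "e / 3"] e by (auto simp del: less_divide_eq_numeral1)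
    show "\<exists>N. \<forall>m\<ge>N. \<forall>n\<ge>N. dist (avg (\<rho> j) (\<phi> (r m)) x) (avg (\<rho> j) (\<phi> (r n)) x) < e"
    proof (intro exI allI impI)
      fix m n assume "N \<le> m" "N \<le> n"
      from N[OF this] near[of "r m"] near[of "r n"]
      show "dist (avg (\<rho> j) (\<phi> (r m)) x) (avg (\<rho> j) (\<phi> (r n)) x) < e"
        unfolding dist_real_def by linarith
    qed
  qed
  define a where "a j x = lim (\<lambda>n. avg (\<rho> j) (\<phi> (r n)) x)" for j x
  have lim_a: "(\<lambda>n. avg (\<rho> j) (\<phi> (r n)) x) \<longlonglongrightarrow> a j x" for j x
    unfolding a_def using conv by (simp add: Cauchy_convergent convergent_LIMSEQ_iff[symmetric])
  have mA: "avg (\<rho> j) (\<phi> n) \<in> borel_measurable m" for j n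
    using L2_avg(1)[OF \<phi> \<Omega> \<rho>] by (simp add: L2_def)
  have aL: "L2 m (a j)" "(\<lambda>n. L2n m (\<lambda>x. avg (\<rho> j) (\<phi> (r n)) x - a j x)) \<longlonglongrightarrow> 0" for j
  proof -
    have 1: "a j \<in> borel_measurable m"
      by (rule borel_measurable_LIMSEQ_metric[OF mA lim_a])
    have 2: "L2 m (\<lambda>x. b j)" by (simp add: L2_def)
    have 3: "norm (avg (\<rho> j) (\<phi> (r n)) x) \<le> norm (b j)" for n x
      using bd[of j "r n" x] by auto
    show "L2 m (a j)" "(\<lambda>n. L2n m (\<lambda>x. avg (\<rho> j) (\<phi> (r n)) x - a j x)) \<longlonglongrightarrow> 0"
      using L2_dominated[where F="\<lambda>n. avg (\<rho> j) (\<phi> (r n))", OF mA 1 2] lim_a 3 by auto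
  qed
  show ?thesis
  proof (rule that[OF r(1)])
    fix e :: real assume e: "e > 0"
    \<comment> \<open>The scale is fixed first, making the averaging error small for all functions
      at once; the index is taken large only afterwards.\<close>
    have "(\<lambda>j. K * \<rho> j powr \<gamma> * B) \<longlonglongrightarrow> K * 0 powr \<gamma> * B"
      unfolding \<rho>_def using \<gamma> LIMSEQ_inverse_real_of_nat
      by (intro tendsto_intros tendsto_powr') (auto simp: inverse_eq_divide)
    then have "\<forall>\<^sub>F j in sequentially. K * \<rho> j powr \<gamma> * B < e / 4"
      using e by (intro order_tendstoD) auto
    then obtain j where j: "K * \<rho> j powr \<gamma> * B < e / 4"
      using eventually_happens sequentially_bot by blast
    have "\<forall>\<^sub>F n in sequentially. L2n m (\<lambda>x. avg (\<rho> j) (\<phi> (r n)) x - a j x) < e / 4"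
      using e by (intro order_tendstoD[OF aL(2)]) auto
    then obtain N where N: "\<And>n. n \<ge> N \<Longrightarrow> L2n m (\<lambda>x. avg (\<rho> j) (\<phi> (r n)) x - a j x) < e / 4"
      by (auto simp: eventually_sequentially)
    have est: "L2n m (\<lambda>x. \<phi> (r n) x - a j x) < e / 2" if "n \<ge> N" for n
    proof -
      have "L2n m (\<lambda>x. \<phi> (r n) x - a j x)
        \<le> L2n m (\<lambda>x. \<phi> (r n) x - avg (\<rho> j) (\<phi> (r n)) x) + L2n m (\<lambda>x. avg (\<rho> j) (\<phi> (r n)) x - a j x)"
        by (rule L2n_diff_triangle[OF test_fn_L2_m(1)[OF \<phi>] L2_avg(1)[OF \<phi> \<Omega> \<rho>] aL(1)])
      also have "L2n m (\<lambda>x. \<phi> (r n) x - avg (\<rho> j) (\<phi> (r n)) x) \<le> K * \<rho> j powr \<gamma> * B"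
        using order_trans[OF K(2)[OF \<phi>[of "r n"] \<rho>[of j]] mult_left_mono[OF B[of "r n"]]] K(1)
        by (simp add: L2n_minus_commute[of m "\<phi> (r n)"])
      finally show ?thesis using j N[OF that] by linarith
    qed
    show "\<exists>N. \<forall>i\<ge>N. \<forall>k\<ge>N. L2n m (\<lambda>x. \<phi> (r i) x - \<phi> (r k) x) < e"
    proof (intro exI allI impI)
      fix i k assume "N \<le> i" "N \<le> k"
      then show "L2n m (\<lambda>x. \<phi> (r i) x - \<phi> (r k) x) < e"
        using L2n_diff_triangle[OF test_fn_L2_m(1)[OF \<phi>] aL(1) test_fn_L2_m(1)[OF \<phi>], of "r i" "r k" j]
          est[of i] est[of k] L2n_minus_commute[of m "a j" "\<phi> (r k)"] by linarith
    qed
  qed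
qed

end

text \<open>\<open>H01_rep\<close> speaks of nonnegative integrals and does not state integrability.
  It is recovered here: one finite term of the sequence puts the difference, and with it the limit,
  into \<open>L2\<close>.\<close>

lemma L2_conv_iff:
  fixes F :: "nat \<Rightarrow> 'a \<Rightarrow> 'b::euclidean_space"
  assumes F: "\<And>k. L2 M (F k)" and f: "f \<in> borel_measurable M"
  shows "((\<lambda>k. \<integral>\<^sup>+x. ennreal ((norm (F k x - f x))\<^sup>2) \<partial>M) \<longlonglongrightarrow> 0) \<longleftrightarrow>
    L2 M f \<and> (\<lambda>k. L2n M (\<lambda>x. F k x - f x)) \<longlonglongrightarrow> 0"
proof
  have eq: "(\<lambda>k. \<integral>\<^sup>+x. ennreal ((norm (F k x - f x))\<^sup>2) \<partial>M) = (\<lambda>k. ennreal ((L2n M (\<lambda>x. F k x - f x))\<^sup>2))"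
    if "L2 M f" using nn_integral_L2[OF L2_diff[OF F that]] by simp
  {
    assume lim: "(\<lambda>k. \<integral>\<^sup>+x. ennreal ((norm (F k x - f x))\<^sup>2) \<partial>M) \<longlonglongrightarrow> 0"
    then have "\<forall>\<^sub>F k in sequentially. (\<integral>\<^sup>+x. ennreal ((norm (F k x - f x))\<^sup>2) \<partial>M) < 1"
      by (rule order_tendstoD) simp
    then obtain k where k: "(\<integral>\<^sup>+x. ennreal ((norm (F k x - f x))\<^sup>2) \<partial>M) < 1"
      using eventually_happens sequentially_bot by blast
    have [measurable]: "F k \<in> borel_measurable M" using F by (rule L2_measurable)
    have "L2 M (\<lambda>x. F k x - f x)"
      unfolding L2_def using f k
      by (auto intro!: integrableI_nonneg elim: order_less_trans)
    from L2_diff[OF F[of k] this] have L: "L2 M f" by simp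
    have "(\<lambda>k. (L2n M (\<lambda>x. F k x - f x))\<^sup>2) \<longlonglongrightarrow> 0"
      using lim unfolding eq[OF L] by (subst (asm) ennreal_tendsto_0_iff) auto
    then have "(\<lambda>k. sqrt ((L2n M (\<lambda>x. F k x - f x))\<^sup>2)) \<longlonglongrightarrow> sqrt 0"
      by (rule tendsto_real_sqrt)
    then show "L2 M f \<and> (\<lambda>k. L2n M (\<lambda>x. F k x - f x)) \<longlonglongrightarrow> 0" using L by simp
  }
  assume a: "L2 M f \<and> (\<lambda>k. L2n M (\<lambda>x. F k x - f x)) \<longlonglongrightarrow> 0"
  then have "(\<lambda>k. (L2n M (\<lambda>x. F k x - f x))\<^sup>2) \<longlonglongrightarrow> 0\<^sup>2" by (intro tendsto_power) auto
  then show "(\<lambda>k. \<integral>\<^sup>+x. ennreal ((norm (F k x - f x))\<^sup>2) \<partial>M) \<longlonglongrightarrow> 0"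
    using a eq by (subst eq) (auto simp: ennreal_tendsto_0_iff)
qed

section \<open>The space of triples: closedness, completeness, compactness\<close>

locale dirichlet_space =
  fixes \<Omega> :: "'a::euclidean_space set" and \<mu> :: "'a measure"
  assumes open_dom: "open \<Omega>" and connected_dom: "connected \<Omega>" and bounded_dom: "bounded \<Omega>"
    and nonempty_dom: "\<Omega> \<noteq> {}"
    and sets_\<mu>: "sets \<mu> = sets borel" and fin_\<mu>: "finite_measure \<mu>"
    and dim_\<mu>: "lower_Linf_dim \<mu> > ereal (real DIM('a) - 2)"
begin

abbreviation l :: "'a measure" where "l \<equiv> leb \<Omega>"
abbreviation m :: "'a measure" where "m \<equiv> restr \<Omega> \<mu>"
abbreviation H01 :: "('a \<Rightarrow> real) \<Rightarrow> ('a \<Rightarrow> 'a) \<Rightarrow> ('a \<Rightarrow> real) \<Rightarrow> bool" where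
  "H01 \<equiv> H01_rep \<Omega> \<mu>"

lemma dom_sets: "\<Omega> \<in> sets lebesgue" "\<Omega> \<in> sets \<mu>"
  using open_dom sets_\<mu> by auto

lemma space_\<mu> [simp]: "space \<mu> = UNIV"
  using sets_eq_imp_space_eq[OF sets_\<mu>] by simp

sublocale l: finite_measure l
  by (rule finite_measure_leb[OF open_dom bounded_dom])

lemma emeasure_m: "A \<in> sets borel \<Longrightarrow> emeasure m A = emeasure \<mu> (\<Omega> \<inter> A)"
  unfolding restr_def using dom_sets sets_\<mu> by (subst emeasure_density) (auto simp flip: indicator_inter_arith)

sublocale m: finite_measure m
proof
  interpret finite_measure \<mu> by (rule fin_\<mu>)
  show "emeasure m (space m) \<noteq> \<infinity>" using emeasure_m[of UNIV] by simp
qed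

lemma growth_measure_m: "\<exists>C s. growth_measure m C s"
proof -
  interpret finite_measure \<mu> by (rule fin_\<mu>)
  obtain C s where C: "0 \<le> C" "0 \<le> s" "s > real DIM('a) - 2"
    "\<And>x r. 0 < r \<Longrightarrow> measure \<mu> (ball x r) \<le> C * r powr s"
    using ball_growth_of_lower_Linf_dim[OF sets_\<mu> fin_\<mu> dim_\<mu>] by blast
  have "measure m (ball x r) \<le> C * r powr s" if "0 < r" for x r
  proof -
    have "measure m (ball x r) = measure \<mu> (\<Omega> \<inter> ball x r)"
      by (simp add: measure_def emeasure_m)
    also have "\<dots> \<le> measure \<mu> (ball x r)"
      using sets_\<mu> by (intro finite_measure_mono) auto
    finally show ?thesis using C(4)[OF that, of x] by linarith
  qed
  then have "growth_measure m C s"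
    using C sets_\<mu> by unfold_locales auto
  then show ?thesis by blast
qed

lemma test_L2:
  assumes "test_fn \<Omega> \<phi>"
  shows "L2 l \<phi>" "L2 l (grad \<phi>)" "L2 m \<phi>"
proof -
  show "L2 l \<phi>" "L2 l (grad \<phi>)"
    by (rule test_fn_L2[OF assms l.finite_measure_axioms]; use sets_borel_le_lebesgue in simp)+
  show "L2 m \<phi>"
    by (rule test_fn_L2[OF assms m.finite_measure_axioms]) (simp_all add: sets_\<mu>)
qed

text \<open>The passage from set integrals in the definition to the seminorms of \<open>l\<close>
  and \<open>m\<close>, with the \<open>L2\<close> membership that convergence implies made
  explicit.\<close>

lemma H01_rep_iff:
  "H01 u g f \<longleftrightarrow> L2 l u \<and> L2 l g \<and> L2 m f \<and>
     (\<exists>\<phi>::nat \<Rightarrow> 'a \<Rightarrow> real. (\<forall>k. test_fn \<Omega> (\<phi> k)) \<and>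
        (\<lambda>k. L2n l (\<lambda>x. \<phi> k x - u x)) \<longlonglongrightarrow> 0 \<and>
        (\<lambda>k. L2n l (\<lambda>x. grad (\<phi> k) x - g x)) \<longlonglongrightarrow> 0 \<and>
        (\<lambda>k. L2n m (\<lambda>x. \<phi> k x - f x)) \<longlonglongrightarrow> 0)"
proof -
  have key: "((\<forall>k. test_fn \<Omega> (\<phi> k)) \<and>
        ((\<lambda>k. \<integral>\<^sup>+x\<in>\<Omega>. ennreal ((\<phi> k x - u x)\<^sup>2) \<partial>lebesgue) \<longlonglongrightarrow> 0) \<and>
        ((\<lambda>k. \<integral>\<^sup>+x\<in>\<Omega>. ennreal ((norm (grad (\<phi> k) x - g x))\<^sup>2) \<partial>lebesgue) \<longlonglongrightarrow> 0) \<and>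
        ((\<lambda>k. \<integral>\<^sup>+x\<in>\<Omega>. ennreal ((\<phi> k x - f x)\<^sup>2) \<partial>\<mu>) \<longlonglongrightarrow> 0)) \<longleftrightarrow>
      ((\<forall>k. test_fn \<Omega> (\<phi> k)) \<and> (L2 l u \<and> (\<lambda>k. L2n l (\<lambda>x. \<phi> k x - u x)) \<longlonglongrightarrow> 0) \<and>
        (L2 l g \<and> (\<lambda>k. L2n l (\<lambda>x. grad (\<phi> k) x - g x)) \<longlonglongrightarrow> 0) \<and>
        (L2 m f \<and> (\<lambda>k. L2n m (\<lambda>x. \<phi> k x - f x)) \<longlonglongrightarrow> 0))"
    if meas: "u \<in> borel_measurable lebesgue" "g \<in> borel_measurable lebesgue" "f \<in> borel_measurable \<mu>"
    for \<phi> :: "nat \<Rightarrow> 'a \<Rightarrow> real"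
  proof (rule conj_cong[OF refl])
    assume \<phi>: "\<forall>k. test_fn \<Omega> (\<phi> k)"
    have L: "\<And>k. L2 l (\<phi> k)" "\<And>k. L2 l (grad (\<phi> k))" "\<And>k. L2 m (\<phi> k)"
      using test_L2 \<phi> by auto
    have [measurable]: "\<And>k. \<phi> k \<in> borel_measurable lebesgue" "\<And>k. grad (\<phi> k) \<in> borel_measurable lebesgue"
      "\<And>k. \<phi> k \<in> borel_measurable \<mu>"
      using L by (auto simp: L2_def)
    note [measurable] = meas
    have 1: "(\<lambda>k. \<integral>\<^sup>+x\<in>\<Omega>. ennreal ((\<phi> k x - u x)\<^sup>2) \<partial>lebesgue) = (\<lambda>k. \<integral>\<^sup>+x. ennreal ((norm (\<phi> k x - u x))\<^sup>2) \<partial>l)"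
      "(\<lambda>k. \<integral>\<^sup>+x\<in>\<Omega>. ennreal ((norm (grad (\<phi> k) x - g x))\<^sup>2) \<partial>lebesgue)
        = (\<lambda>k. \<integral>\<^sup>+x. ennreal ((norm (grad (\<phi> k) x - g x))\<^sup>2) \<partial>l)"
      "(\<lambda>k. \<integral>\<^sup>+x\<in>\<Omega>. ennreal ((\<phi> k x - f x)\<^sup>2) \<partial>\<mu>) = (\<lambda>k. \<integral>\<^sup>+x. ennreal ((norm (\<phi> k x - f x))\<^sup>2) \<partial>m)"
      by (subst nn_integral_restr; use dom_sets in \<open>simp; measurable\<close>)+
    show "(((\<lambda>k. \<integral>\<^sup>+x\<in>\<Omega>. ennreal ((\<phi> k x - u x)\<^sup>2) \<partial>lebesgue) \<longlonglongrightarrow> 0) \<and>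
        ((\<lambda>k. \<integral>\<^sup>+x\<in>\<Omega>. ennreal ((norm (grad (\<phi> k) x - g x))\<^sup>2) \<partial>lebesgue) \<longlonglongrightarrow> 0) \<and>
        ((\<lambda>k. \<integral>\<^sup>+x\<in>\<Omega>. ennreal ((\<phi> k x - f x)\<^sup>2) \<partial>\<mu>) \<longlonglongrightarrow> 0)) \<longleftrightarrow>
      ((L2 l u \<and> (\<lambda>k. L2n l (\<lambda>x. \<phi> k x - u x)) \<longlonglongrightarrow> 0) \<and>
        (L2 l g \<and> (\<lambda>k. L2n l (\<lambda>x. grad (\<phi> k) x - g x)) \<longlonglongrightarrow> 0) \<and>
        (L2 m f \<and> (\<lambda>k. L2n m (\<lambda>x. \<phi> k x - f x)) \<longlonglongrightarrow> 0))"
      unfolding 1 using L2_conv_iff[OF L(1), of u] L2_conv_iff[OF L(2), of g] L2_conv_iff[OF L(3), of f] meas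
      by simp
  qed
  show ?thesis
  proof
    assume "H01 u g f"
    then show "L2 l u \<and> L2 l g \<and> L2 m f \<and>
     (\<exists>\<phi>::nat \<Rightarrow> 'a \<Rightarrow> real. (\<forall>k. test_fn \<Omega> (\<phi> k)) \<and>
        (\<lambda>k. L2n l (\<lambda>x. \<phi> k x - u x)) \<longlonglongrightarrow> 0 \<and>
        (\<lambda>k. L2n l (\<lambda>x. grad (\<phi> k) x - g x)) \<longlonglongrightarrow> 0 \<and>
        (\<lambda>k. L2n m (\<lambda>x. \<phi> k x - f x)) \<longlonglongrightarrow> 0)"
      unfolding H01_rep_def using key by blast
  next
    assume a: "L2 l u \<and> L2 l g \<and> L2 m f \<and>
     (\<exists>\<phi>::nat \<Rightarrow> 'a \<Rightarrow> real. (\<forall>k. test_fn \<Omega> (\<phi> k)) \<and>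
        (\<lambda>k. L2n l (\<lambda>x. \<phi> k x - u x)) \<longlonglongrightarrow> 0 \<and>
        (\<lambda>k. L2n l (\<lambda>x. grad (\<phi> k) x - g x)) \<longlonglongrightarrow> 0 \<and>
        (\<lambda>k. L2n m (\<lambda>x. \<phi> k x - f x)) \<longlonglongrightarrow> 0)"
    then have "u \<in> borel_measurable lebesgue" "g \<in> borel_measurable lebesgue" "f \<in> borel_measurable \<mu>"
      by (auto simp: L2_def)
    with a key show "H01 u g f" unfolding H01_rep_def by blast
  qed
qed

lemma H01_L2:
  assumes "H01 u g f"
  shows "L2 l u" "L2 l g" "L2 m f"
  using assms by (auto simp: H01_rep_iff)

lemma H01_approx:
  assumes "H01 u g f"
  obtains \<phi> where "\<And>k. test_fn \<Omega> (\<phi> (k::nat))"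
    "(\<lambda>k. L2n l (\<lambda>x. \<phi> k x - u x)) \<longlonglongrightarrow> 0"
    "(\<lambda>k. L2n l (\<lambda>x. grad (\<phi> k) x - g x)) \<longlonglongrightarrow> 0"
    "(\<lambda>k. L2n m (\<lambda>x. \<phi> k x - f x)) \<longlonglongrightarrow> 0"
  using assms unfolding H01_rep_iff by blast

lemma H01_near:
  assumes "H01 u g f" "e > 0"
  obtains \<phi> where "test_fn \<Omega> \<phi>" "L2n l (\<lambda>x. \<phi> x - u x) < e"
    "L2n l (\<lambda>x. grad \<phi> x - g x) < e" "L2n m (\<lambda>x. \<phi> x - f x) < e"
proof -
  obtain \<phi> where \<phi>: "\<And>k. test_fn \<Omega> (\<phi> (k::nat))"
    "(\<lambda>k. L2n l (\<lambda>x. \<phi> k x - u x)) \<longlonglongrightarrow> 0"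
    "(\<lambda>k. L2n l (\<lambda>x. grad (\<phi> k) x - g x)) \<longlonglongrightarrow> 0"
    "(\<lambda>k. L2n m (\<lambda>x. \<phi> k x - f x)) \<longlonglongrightarrow> 0"
    by (rule H01_approx[OF assms(1)]) (rule that)
  have "\<forall>\<^sub>F k in sequentially. L2n l (\<lambda>x. \<phi> k x - u x) < e \<and>
    L2n l (\<lambda>x. grad (\<phi> k) x - g x) < e \<and> L2n m (\<lambda>x. \<phi> k x - f x) < e"
    using \<phi>(2-4) assms(2) by (intro eventually_conj order_tendstoD) auto
  then obtain k where "L2n l (\<lambda>x. \<phi> k x - u x) < e \<and>
    L2n l (\<lambda>x. grad (\<phi> k) x - g x) < e \<and> L2n m (\<lambda>x. \<phi> k x - f x) < e"
    using eventually_happens sequentially_bot by blast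
  then show ?thesis using that[of "\<phi> k"] \<phi>(1) by blast
qed

text \<open>Approximation within every \<open>e\<close> by a single test function replaces
  sequences, so limits and linear combinations of triples need no diagonal extraction.\<close>

lemma H01I_near:
  assumes "L2 l u" "L2 l g" "L2 m f"
    "\<And>e. e > 0 \<Longrightarrow> \<exists>\<phi>. test_fn \<Omega> \<phi> \<and> L2n l (\<lambda>x. \<phi> x - u x) < e
      \<and> L2n l (\<lambda>x. grad \<phi> x - g x) < e \<and> L2n m (\<lambda>x. \<phi> x - f x) < e"
  shows "H01 u g f"
proof -
  have "\<forall>k::nat. \<exists>\<phi>. test_fn \<Omega> \<phi> \<and> L2n l (\<lambda>x. \<phi> x - u x) < 1 / real (Suc k)
      \<and> L2n l (\<lambda>x. grad \<phi> x - g x) < 1 / real (Suc k) \<and> L2n m (\<lambda>x. \<phi> x - f x) < 1 / real (Suc k)"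
    by (intro allI assms(4)) simp
  from choice[OF this] obtain \<phi> where "\<forall>k. test_fn \<Omega> (\<phi> k) \<and> L2n l (\<lambda>x. \<phi> k x - u x) < 1 / real (Suc k)
      \<and> L2n l (\<lambda>x. grad (\<phi> k) x - g x) < 1 / real (Suc k) \<and> L2n m (\<lambda>x. \<phi> k x - f x) < 1 / real (Suc k)"
    by (rule exE)
  then have \<phi>: "\<And>k. test_fn \<Omega> (\<phi> k)" "\<And>k. L2n l (\<lambda>x. \<phi> k x - u x) < 1 / real (Suc k)"
    "\<And>k. L2n l (\<lambda>x. grad (\<phi> k) x - g x) < 1 / real (Suc k)" "\<And>k. L2n m (\<lambda>x. \<phi> k x - f x) < 1 / real (Suc k)"
    by blast+
  have lim: "A \<longlonglongrightarrow> 0" if "\<And>k. 0 \<le> A k" "\<And>k. A k < 1 / real (Suc k)" for A :: "nat \<Rightarrow> real"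
    using that LIMSEQ_inverse_real_of_nat
    by (intro tendsto_sandwich[of "\<lambda>_. 0" A sequentially "\<lambda>k. 1 / real (Suc k)"])
      (auto simp: less_imp_le inverse_eq_divide)
  show ?thesis unfolding H01_rep_iff using assms(1-3) \<phi>
    by (intro conjI exI[of _ \<phi>] allI lim) auto
qed

lemma H01_closed:
  assumes H: "\<And>k::nat. H01 (U k) (G k) (F k)" and L: "L2 l u" "L2 l g" "L2 m f"
    and lim: "(\<lambda>k. L2n l (\<lambda>x. U k x - u x)) \<longlonglongrightarrow> 0" "(\<lambda>k. L2n l (\<lambda>x. G k x - g x)) \<longlonglongrightarrow> 0"
    "(\<lambda>k. L2n m (\<lambda>x. F k x - f x)) \<longlonglongrightarrow> 0"
  shows "H01 u g f"
proof (rule H01I_near[OF L])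
  fix e :: real assume e: "e > 0"
  have "\<forall>\<^sub>F k in sequentially. L2n l (\<lambda>x. U k x - u x) < e / 2 \<and>
    L2n l (\<lambda>x. G k x - g x) < e / 2 \<and> L2n m (\<lambda>x. F k x - f x) < e / 2"
    using lim e by (intro eventually_conj order_tendstoD) auto
  then obtain k where k: "L2n l (\<lambda>x. U k x - u x) < e / 2" "L2n l (\<lambda>x. G k x - g x) < e / 2"
    "L2n m (\<lambda>x. F k x - f x) < e / 2"
    using eventually_happens sequentially_bot by blast
  have e2: "e / 2 > 0" using e by simp
  obtain \<phi> where \<phi>: "test_fn \<Omega> \<phi>" "L2n l (\<lambda>x. \<phi> x - U k x) < e / 2"
    "L2n l (\<lambda>x. grad \<phi> x - G k x) < e / 2" "L2n m (\<lambda>x. \<phi> x - F k x) < e / 2"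
    by (rule H01_near[OF H[of k] e2]) (rule that)
  note T = test_L2[OF \<phi>(1)] and HL = H01_L2[OF H[of k]]
  show "\<exists>\<phi>. test_fn \<Omega> \<phi> \<and> L2n l (\<lambda>x. \<phi> x - u x) < e
      \<and> L2n l (\<lambda>x. grad \<phi> x - g x) < e \<and> L2n m (\<lambda>x. \<phi> x - f x) < e"
    using \<phi> k L2n_diff_triangle[OF T(1) HL(1) L(1)] L2n_diff_triangle[OF T(2) HL(2) L(2)]
      L2n_diff_triangle[OF T(3) HL(3) L(3)]
    by (intro exI[of _ \<phi>]) auto
qed

lemma H01_test: "test_fn \<Omega> \<phi> \<Longrightarrow> H01 \<phi> (grad \<phi>) \<phi>"
  unfolding H01_rep_iff using test_L2[of \<phi>] by (intro conjI exI[of _ "\<lambda>k. \<phi>"]) auto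

lemma H01_lincomb:
  assumes "H01 u g f" "H01 u' g' f'"
  shows "H01 (\<lambda>x. u x + c * u' x) (\<lambda>x. g x + c *\<^sub>R g' x) (\<lambda>x. f x + c * f' x)"
proof (rule H01I_near)
  note L = H01_L2[OF assms(1)] H01_L2[OF assms(2)]
  show "L2 l (\<lambda>x. u x + c * u' x)" "L2 l (\<lambda>x. g x + c *\<^sub>R g' x)" "L2 m (\<lambda>x. f x + c * f' x)"
    using L by auto
  fix e :: real assume e: "e > 0"
  define d where "d = e / (1 + \<bar>c\<bar>)"
  have c1: "1 + \<bar>c\<bar> > 0" by simp
  then have d: "d > 0" using e by (simp add: d_def)
  have "d * (1 + \<bar>c\<bar>) = e" using c1 by (simp add: d_def)
  then have dd: "d + \<bar>c\<bar> * d = e" by (simp add: algebra_simps)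
  obtain \<phi> where \<phi>: "test_fn \<Omega> \<phi>" "L2n l (\<lambda>x. \<phi> x - u x) < d"
    "L2n l (\<lambda>x. grad \<phi> x - g x) < d" "L2n m (\<lambda>x. \<phi> x - f x) < d"
    by (rule H01_near[OF assms(1) d]) (rule that)
  obtain \<psi> where \<psi>: "test_fn \<Omega> \<psi>" "L2n l (\<lambda>x. \<psi> x - u' x) < d"
    "L2n l (\<lambda>x. grad \<psi> x - g' x) < d" "L2n m (\<lambda>x. \<psi> x - f' x) < d"
    by (rule H01_near[OF assms(2) d]) (rule that)
  have est: "L2n M (\<lambda>x. (A x + c *\<^sub>R B x) - (A' x + c *\<^sub>R B' x)) < e"
    if "L2n M (\<lambda>x. A x - A' x) < d" "L2n M (\<lambda>x. B x - B' x) < d" "L2 M A" "L2 M A'" "L2 M B" "L2 M B'"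
    for M :: "'a measure" and A A' B B' :: "'a \<Rightarrow> 'c::euclidean_space"
  proof -
    have "L2n M (\<lambda>x. (A x + c *\<^sub>R B x) - (A' x + c *\<^sub>R B' x))
      = L2n M (\<lambda>x. (A x - A' x) + c *\<^sub>R (B x - B' x))" by (simp add: algebra_simps)
    also have "\<dots> \<le> L2n M (\<lambda>x. A x - A' x) + L2n M (\<lambda>x. c *\<^sub>R (B x - B' x))"
      using that by (intro L2n_triangle L2_diff L2_scale)
    also have "L2n M (\<lambda>x. c *\<^sub>R (B x - B' x)) = \<bar>c\<bar> * L2n M (\<lambda>x. B x - B' x)" by (rule L2n_scale)
    also have "\<dots> \<le> \<bar>c\<bar> * d" using that by (intro mult_left_mono) auto
    finally show ?thesis using that dd by linarith
  qed
  note T = test_L2[OF \<phi>(1)] test_L2[OF \<psi>(1)]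
  have gr: "grad (\<lambda>x. \<phi> x + c * \<psi> x) = (\<lambda>x. grad \<phi> x + c *\<^sub>R grad \<psi> x)"
    using grad_lincomb test_fnD(1) \<phi>(1) \<psi>(1) by blast
  show "\<exists>\<phi>. test_fn \<Omega> \<phi> \<and> L2n l (\<lambda>x. \<phi> x - (u x + c * u' x)) < e
      \<and> L2n l (\<lambda>x. grad \<phi> x - (g x + c *\<^sub>R g' x)) < e \<and> L2n m (\<lambda>x. \<phi> x - (f x + c * f' x)) < e"
    using test_fn_lincomb[OF \<phi>(1) \<psi>(1)] est[OF \<phi>(2) \<psi>(2)] est[OF \<phi>(3) \<psi>(3)] est[OF \<phi>(4) \<psi>(4)] T L
    by (intro exI[of _ "\<lambda>x. \<phi> x + c * \<psi> x"]) (simp add: gr)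
qed

lemma test_fn_zero: "test_fn \<Omega> (\<lambda>x. 0)"
  by (simp add: test_fn_def smooth_fn_const)

lemma grad_zero: "grad (\<lambda>x. 0) = (\<lambda>x::'a. 0)"
  by (rule ext, rule grad_eqI) simp

lemma H01_zero: "H01 (\<lambda>x. 0) (\<lambda>x. 0) (\<lambda>x. 0)"
  using H01_test[OF test_fn_zero] by (simp add: grad_zero)

lemma H01_scale: "H01 u g f \<Longrightarrow> H01 (\<lambda>x. c * u x) (\<lambda>x. c *\<^sub>R g x) (\<lambda>x. c * f x)"
  using H01_lincomb[OF H01_zero, of u g f c] by simp

lemma H01_diff:
  assumes "H01 u g f" "H01 u' g' f'"
  shows "H01 (\<lambda>x. u x - u' x) (\<lambda>x. g x - g' x) (\<lambda>x. f x - f' x)"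
  using H01_lincomb[OF assms, of "-1"] by simp

lemma H01_sum:
  assumes "finite I" "\<And>i. i \<in> I \<Longrightarrow> H01 (u i) (g i) (f i)"
  shows "H01 (\<lambda>x. \<Sum>i\<in>I. c i * u i x) (\<lambda>x. \<Sum>i\<in>I. c i *\<^sub>R g i x) (\<lambda>x. \<Sum>i\<in>I. c i * f i x)"
  using assms
proof (induction I rule: finite_induct)
  case (insert i I)
  have "H01 (\<lambda>x. (\<Sum>i\<in>I. c i * u i x) + c i * u i x) (\<lambda>x. (\<Sum>i\<in>I. c i *\<^sub>R g i x) + c i *\<^sub>R g i x)
      (\<lambda>x. (\<Sum>i\<in>I. c i * f i x) + c i * f i x)"
    using insert by (intro H01_lincomb) auto
  then show ?case using insert by (simp add: add.commute)
qed (simp add: H01_zero)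

text \<open>Both estimates pass from test functions to limits. Consequently the gradient seminorm
  alone controls a triple: a zero gradient forces both the function and its
  \<open>\<mu>\<close>-representative to be null.\<close>

lemma H01_Poincare:
  obtains K where "K \<ge> 0" "\<And>u g f. H01 u g f \<Longrightarrow> L2n l u \<le> K * L2n l g"
    "\<And>u g f. H01 u g f \<Longrightarrow> L2n m f \<le> K * L2n l g"
proof -
  obtain C s where "growth_measure m C s" using growth_measure_m by blast
  then interpret growth_measure m C s .
  obtain K1 where K1: "K1 \<ge> 0" "\<And>\<phi>. test_fn \<Omega> \<phi> \<Longrightarrow> L2n m \<phi> \<le> K1 * L2n l (grad \<phi>)"
    by (rule trace_inequality[OF open_dom bounded_dom]) (rule that)
  obtain K2 where K2: "K2 \<ge> 0" "\<And>\<phi>. test_fn \<Omega> \<phi> \<Longrightarrow> L2n l \<phi> \<le> K2 * L2n l (grad \<phi>)"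
    by (rule Poincare_leb[OF open_dom bounded_dom]) (rule that)
  have "L2n l u \<le> (K1 + K2) * L2n l g \<and> L2n m f \<le> (K1 + K2) * L2n l g" if H: "H01 u g f" for u g f
  proof -
    obtain \<phi> where \<phi>: "\<And>k. test_fn \<Omega> (\<phi> (k::nat))"
      "(\<lambda>k. L2n l (\<lambda>x. \<phi> k x - u x)) \<longlonglongrightarrow> 0"
      "(\<lambda>k. L2n l (\<lambda>x. grad (\<phi> k) x - g x)) \<longlonglongrightarrow> 0"
      "(\<lambda>k. L2n m (\<lambda>x. \<phi> k x - f x)) \<longlonglongrightarrow> 0"
      by (rule H01_approx[OF H]) (rule that)
    note T = test_L2[OF \<phi>(1)] and HL = H01_L2[OF H]
    have lims: "(\<lambda>k. L2n l (\<phi> k)) \<longlonglongrightarrow> L2n l u" "(\<lambda>k. L2n m (\<phi> k)) \<longlonglongrightarrow> L2n m f"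
      "(\<lambda>k. (K1 + K2) * L2n l (grad (\<phi> k))) \<longlonglongrightarrow> (K1 + K2) * L2n l g"
      by (intro tendsto_intros tendsto_L2n T HL \<phi>)+
    have "L2n l (\<phi> k) \<le> (K1 + K2) * L2n l (grad (\<phi> k))" "L2n m (\<phi> k) \<le> (K1 + K2) * L2n l (grad (\<phi> k))" for k
      using K1(2)[OF \<phi>(1)[of k]] K2(2)[OF \<phi>(1)[of k]] K1(1) K2(1)
      by (auto simp: distrib_right intro: add_increasing add_increasing2)
    then show ?thesis using lims by (blast intro: LIMSEQ_le)
  qed
  then show ?thesis using that[of "K1 + K2"] K1 K2 by auto
qed

text \<open>Cauchy gradients suffice, since \<open>H01_Poincare\<close> applied to differences makes
  the other two components Cauchy; the three limits fit together by
  \<open>H01_closed\<close>.\<close>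

lemma H01_complete:
  assumes H: "\<And>k::nat. H01 (U k) (G k) (F k)"
    and C: "\<And>e. e > 0 \<Longrightarrow> \<exists>N. \<forall>i\<ge>N. \<forall>j\<ge>N. L2n l (\<lambda>x. G i x - G j x) < e"
  obtains u g f where "H01 u g f" "(\<lambda>k. L2n l (\<lambda>x. U k x - u x)) \<longlonglongrightarrow> 0"
    "(\<lambda>k. L2n l (\<lambda>x. G k x - g x)) \<longlonglongrightarrow> 0" "(\<lambda>k. L2n m (\<lambda>x. F k x - f x)) \<longlonglongrightarrow> 0"
proof -
  obtain K where K: "K \<ge> 0" "\<And>u g f. H01 u g f \<Longrightarrow> L2n l u \<le> K * L2n l g"
    "\<And>u g f. H01 u g f \<Longrightarrow> L2n m f \<le> K * L2n l g"
    by (rule H01_Poincare) (rule that)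
  have C2: "\<exists>N. \<forall>i\<ge>N. \<forall>j\<ge>N. L2n l (\<lambda>x. U i x - U j x) < e \<and> L2n m (\<lambda>x. F i x - F j x) < e"
    if e: "e > 0" for e
  proof -
    have e': "e / (K + 1) > 0" using e K(1) by simp
    obtain N where N: "\<forall>i\<ge>N. \<forall>j\<ge>N. L2n l (\<lambda>x. G i x - G j x) < e / (K + 1)"
      using C[OF e'] by blast
    show ?thesis
    proof (intro exI[of _ N] allI impI)
      fix i j assume ij: "i \<ge> N" "j \<ge> N"
      have "K * L2n l (\<lambda>x. G i x - G j x) \<le> K * (e / (K + 1))"
        using N ij K(1) by (intro mult_left_mono) (auto simp: less_imp_le)
      also have "\<dots> < e" using K(1) e by (simp add: field_simps)
      finally show "L2n l (\<lambda>x. U i x - U j x) < e \<and> L2n m (\<lambda>x. F i x - F j x) < e"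
        using K(2,3)[OF H01_diff[OF H[of i] H[of j]]] by linarith
    qed
  qed
  have LU: "\<And>k. L2 l (U k)" and LG: "\<And>k. L2 l (G k)" and LF: "\<And>k. L2 m (F k)"
    using H01_L2[OF H] by auto
  have CU: "\<exists>N. \<forall>i\<ge>N. \<forall>j\<ge>N. L2n l (\<lambda>x. U i x - U j x) < e" if "e > 0" for e
    using C2[OF that] by (elim exE) (rule exI, blast)
  have CF: "\<exists>N. \<forall>i\<ge>N. \<forall>j\<ge>N. L2n m (\<lambda>x. F i x - F j x) < e" if "e > 0" for e
    using C2[OF that] by (elim exE) (rule exI, blast)
  obtain u where u: "L2 l u" "(\<lambda>k. L2n l (\<lambda>x. U k x - u x)) \<longlonglongrightarrow> 0"
    by (rule l.L2_complete[OF LU CU]) (assumption, rule that)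
  obtain g where g: "L2 l g" "(\<lambda>k. L2n l (\<lambda>x. G k x - g x)) \<longlonglongrightarrow> 0"
    by (rule l.L2_complete[OF LG C]) (assumption, rule that)
  obtain f where f: "L2 m f" "(\<lambda>k. L2n m (\<lambda>x. F k x - f x)) \<longlonglongrightarrow> 0"
    by (rule m.L2_complete[OF LF CF]) (assumption, rule that)
  show ?thesis
    by (rule that[OF H01_closed[OF H u(1) g(1) f(1) u(2) g(2) f(2)] u(2) g(2) f(2)])
qed

text \<open>Replacing the term of index \<open>k\<close> by a test function within
  \<open>1 / real (Suc k)\<close> changes neither boundedness of the energies nor the Cauchy
  property, and reduces the claim to \<open>compact_embedding_test\<close>.\<close>

lemma H01_compact:
  assumes H: "\<And>k::nat. H01 (U k) (G k) (F k)" and B: "\<And>k. L2n l (G k) \<le> B"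
  obtains r where "strict_mono (r :: nat \<Rightarrow> nat)"
    "\<And>e. e > 0 \<Longrightarrow> \<exists>N. \<forall>i\<ge>N. \<forall>j\<ge>N. L2n m (\<lambda>x. F (r i) x - F (r j) x) < e"
proof -
  obtain C s where "growth_measure m C s" using growth_measure_m by blast
  then interpret growth_measure m C s .
  have "\<forall>k. \<exists>\<phi>. test_fn \<Omega> \<phi> \<and> L2n l (\<lambda>x. grad \<phi> x - G k x) < 1 / real (Suc k)
      \<and> L2n m (\<lambda>x. \<phi> x - F k x) < 1 / real (Suc k)"
  proof
    fix k
    have k: "1 / real (Suc k) > 0" by simp
    show "\<exists>\<phi>. test_fn \<Omega> \<phi> \<and> L2n l (\<lambda>x. grad \<phi> x - G k x) < 1 / real (Suc k)
      \<and> L2n m (\<lambda>x. \<phi> x - F k x) < 1 / real (Suc k)"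
      by (rule H01_near[OF H[of k] k]) blast
  qed
  from choice[OF this] obtain \<phi> where "\<forall>k. test_fn \<Omega> (\<phi> k) \<and> L2n l (\<lambda>x. grad (\<phi> k) x - G k x) < 1 / real (Suc k)
      \<and> L2n m (\<lambda>x. \<phi> k x - F k x) < 1 / real (Suc k)" by (rule exE)
  then have \<phi>: "\<And>k. test_fn \<Omega> (\<phi> k)" "\<And>k. L2n l (\<lambda>x. grad (\<phi> k) x - G k x) < 1 / real (Suc k)"
    "\<And>k. L2n m (\<lambda>x. \<phi> k x - F k x) < 1 / real (Suc k)" by blast+
  note T = test_L2[OF \<phi>(1)] and HL = H01_L2[OF H]
  have gB: "L2n l (grad (\<phi> k)) \<le> B + 1" for k
  proof -
    have "1 / real (Suc k) \<le> 1" by simp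
    then show ?thesis
      using L2n_diff_bound[OF T(2)[of k] HL(2)[of k]] \<phi>(2)[of k] B[of k] by linarith
  qed
  obtain r where r: "strict_mono (r :: nat \<Rightarrow> nat)"
    "\<And>e. e > 0 \<Longrightarrow> \<exists>N. \<forall>i\<ge>N. \<forall>j\<ge>N. L2n m (\<lambda>x. \<phi> (r i) x - \<phi> (r j) x) < e"
    by (rule compact_embedding_test[OF open_dom bounded_dom \<phi>(1) gB]) (rule that)
  show ?thesis
  proof (rule that[OF r(1)])
    fix e :: real assume e: "e > 0"
    obtain N1 where N1: "\<forall>i\<ge>N1. \<forall>j\<ge>N1. L2n m (\<lambda>x. \<phi> (r i) x - \<phi> (r j) x) < e / 3"
      using r(2)[of "e / 3"] e by auto
    obtain N2 where N2: "1 / real (Suc N2) < e / 3"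
      using nat_approx_posE[of "e / 3"] e by auto
    have small: "L2n m (\<lambda>x. \<phi> (r i) x - F (r i) x) < e / 3" if "i \<ge> N2" for i
    proof -
      have "r i \<ge> N2" using that strict_mono_imp_increasing[OF r(1), of i] by linarith
      then have "1 / real (Suc (r i)) \<le> 1 / real (Suc N2)" by (intro divide_left_mono) auto
      then show ?thesis using \<phi>(3)[of "r i"] N2 by linarith
    qed
    show "\<exists>N. \<forall>i\<ge>N. \<forall>j\<ge>N. L2n m (\<lambda>x. F (r i) x - F (r j) x) < e"
    proof (intro exI[of _ "max N1 N2"] allI impI)
      fix i j assume ij: "max N1 N2 \<le> i" "max N1 N2 \<le> j"
      have "L2n m (\<lambda>x. F (r i) x - F (r j) x)
        \<le> L2n m (\<lambda>x. F (r i) x - \<phi> (r i) x) + L2n m (\<lambda>x. \<phi> (r i) x - F (r j) x)"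
        by (rule L2n_diff_triangle[OF HL(3) T(3) HL(3)])
      also have "L2n m (\<lambda>x. \<phi> (r i) x - F (r j) x)
        \<le> L2n m (\<lambda>x. \<phi> (r i) x - \<phi> (r j) x) + L2n m (\<lambda>x. \<phi> (r j) x - F (r j) x)"
        by (rule L2n_diff_triangle[OF T(3) T(3) HL(3)])
      finally show "L2n m (\<lambda>x. F (r i) x - F (r j) x) < e"
        using small[of i] small[of j] N1[rule_format, of i j] ij
          L2n_minus_commute[of m "F (r i)" "\<phi> (r i)"] by linarith
    qed
  qed
qed

end

section \<open>Eigenfunctions and truncation\<close>

lemma L2I_le:
  assumes "f \<in> borel_measurable M" "L2 M h" "\<And>x. norm (f x) \<le> norm (h x)"
  shows "L2 M f"
  by (rule L2I_bound[OF assms(1), of "\<lambda>x. (norm (h x))\<^sup>2"])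
    (use assms(2) in \<open>simp add: L2_def\<close>, intro always_eventually allI power_mono assms(3), simp)

context dirichlet_space
begin

lemma set_integral_ip:
  fixes g h :: "'a \<Rightarrow> 'b::euclidean_space"
  shows "L2 l g \<Longrightarrow> L2 l h \<Longrightarrow> (LINT x:\<Omega>|lebesgue. g x \<bullet> h x) = ip l g h"
    and "L2 m g \<Longrightarrow> L2 m h \<Longrightarrow> (LINT x:\<Omega>|\<mu>. g x \<bullet> h x) = ip m g h"
  unfolding ip_def using dom_sets
  by (auto intro!: set_lebesgue_integral_restr borel_measurable_inner simp: L2_def)

text \<open>Both sides are continuous along approximating test functions. This admits
  eigenfunctions, positive parts and nodal pieces as test elements.\<close>

lemma weak_equation_H01:
  assumes L: "L2 l g" "L2 m f"
    and eq: "\<And>\<phi>. test_fn \<Omega> \<phi> \<Longrightarrow> ip l g (grad \<phi>) = t * ip m f \<phi>"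
    and H: "H01 v h k"
  shows "ip l g h = t * ip m f k"
proof -
  obtain \<phi> where \<phi>: "\<And>k. test_fn \<Omega> (\<phi> (k::nat))"
    "(\<lambda>j. L2n l (\<lambda>x. \<phi> j x - v x)) \<longlonglongrightarrow> 0"
    "(\<lambda>j. L2n l (\<lambda>x. grad (\<phi> j) x - h x)) \<longlonglongrightarrow> 0"
    "(\<lambda>j. L2n m (\<lambda>x. \<phi> j x - k x)) \<longlonglongrightarrow> 0"
    by (rule H01_approx[OF H]) (rule that)
  have z: "(\<lambda>j::nat. L2n l (\<lambda>x. g x - g x)) \<longlonglongrightarrow> 0" "(\<lambda>j::nat. L2n m (\<lambda>x. f x - f x)) \<longlonglongrightarrow> 0"
    by simp_all
  have "(\<lambda>j. ip l g (grad (\<phi> j))) \<longlonglongrightarrow> ip l g h"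
    by (rule tendsto_ip[OF L(1) L(1) test_L2(2)[OF \<phi>(1)] H01_L2(2)[OF H] z(1) \<phi>(3)])
  moreover have "(\<lambda>j. t * ip m f (\<phi> j)) \<longlonglongrightarrow> t * ip m f k"
    by (intro tendsto_mult tendsto_const tendsto_ip[OF L(2) L(2) test_L2(3)[OF \<phi>(1)] H01_L2(3)[OF H] z(2) \<phi>(4)])
  ultimately show ?thesis
    unfolding eq[OF \<phi>(1)] by (rule LIMSEQ_unique)
qed

text \<open>The weak equation extends by density to all triples; tested against one with zero
  \<open>\<mu>\<close>-representative it yields the orthogonality in
  \<open>in_N_perp\<close>.\<close>

lemma eigen_iff:
  "is_eigenfunction \<Omega> \<mu> t u g f \<longleftrightarrow> H01 u g f \<and> L2n m f \<noteq> 0 \<and>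
     (\<forall>\<phi>. test_fn \<Omega> \<phi> \<longrightarrow> ip l g (grad \<phi>) = t * ip m f \<phi>)"
proof (cases "H01 u g f")
  case True
  note L = H01_L2[OF True]
  have "(\<integral>\<^sup>+x\<in>\<Omega>. ennreal ((f x)\<^sup>2) \<partial>\<mu>) = (\<integral>\<^sup>+x. ennreal ((f x)\<^sup>2) \<partial>m)"
    by (rule nn_integral_restr) (use L(3) dom_sets in \<open>auto simp: L2_def\<close>)
  also have "\<dots> = ennreal ((L2n m f)\<^sup>2)" using nn_integral_L2[OF L(3)] by simp
  finally have nn: "(\<integral>\<^sup>+x\<in>\<Omega>. ennreal ((f x)\<^sup>2) \<partial>\<mu>) = ennreal ((L2n m f)\<^sup>2)" .
  have eq: "(LINT x:\<Omega>|lebesgue. g x \<bullet> grad \<phi> x) = t * (LINT x:\<Omega>|\<mu>. f x * \<phi> x) \<longleftrightarrow>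
      ip l g (grad \<phi>) = t * ip m f \<phi>" if "test_fn \<Omega> \<phi>" for \<phi>
    using set_integral_ip(1)[OF L(2) test_L2(2)[OF that]] set_integral_ip(2)[OF L(3) test_L2(3)[OF that]]
    by simp
  have "in_N_perp \<Omega> \<mu> g" if "\<forall>\<phi>. test_fn \<Omega> \<phi> \<longrightarrow> ip l g (grad \<phi>) = t * ip m f \<phi>"
    unfolding in_N_perp_def
  proof (intro allI impI)
    fix v h assume H: "H01 v h (\<lambda>_. 0)"
    have "ip l g h = t * ip m f (\<lambda>_. 0)"
      by (rule weak_equation_H01[OF L(2,3) _ H]) (use that in blast)
    then show "(LINT x:\<Omega>|lebesgue. g x \<bullet> h x) = 0"
      using set_integral_ip(1)[OF L(2) H01_L2(2)[OF H]] by (simp add: ip_def)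
  qed
  then show ?thesis using True eq unfolding is_eigenfunction_def nn by auto
qed (simp add: is_eigenfunction_def)

lemma eigenD:
  assumes "is_eigenfunction \<Omega> \<mu> t u g f"
  shows "H01 u g f" "L2n m f \<noteq> 0" "H01 v h k \<Longrightarrow> ip l g h = t * ip m f k"
    "L2 l u" "L2 l g" "L2 m f"
proof -
  show H: "H01 u g f" and "L2n m f \<noteq> 0" using assms by (auto simp: eigen_iff)
  show L: "L2 l u" "L2 l g" "L2 m f" using H01_L2[OF H] .
  show "H01 v h k \<Longrightarrow> ip l g h = t * ip m f k"
    by (rule weak_equation_H01[OF L(2,3)]) (use assms in \<open>auto simp: eigen_iff\<close>)
qed

lemma ip_m_pos: "L2n m f \<noteq> 0 \<Longrightarrow> ip m f f > 0"
  by (metis L2n_def ip_self_nonneg order_le_less real_sqrt_zero)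

lemma eigenvalue_nonneg:
  assumes "is_eigenfunction \<Omega> \<mu> t u g f"
  shows "0 \<le> t"
proof -
  have "t * ip m f f = ip l g g" using eigenD(3)[OF assms eigenD(1)[OF assms]] by simp
  then have "0 \<le> t * ip m f f" by simp
  then show ?thesis using ip_m_pos[OF eigenD(2)[OF assms]] by (simp add: zero_le_mult_iff)
qed

text \<open>\<open>T 0 = 0\<close> keeps the supports of the approximants compact inside
  \<open>\<Omega>\<close>, even though \<open>\<eta>\<close> itself may be constant. The difficulty
  is the gradient, in which \<open>T'\<close> is evaluated at functions that converge only in
  \<open>L2\<close>.\<close>

lemma H01_truncate:
  assumes H: "H01 u g f"
    and T: "smooth_fn T" "\<And>s. (T has_real_derivative T' s) (at s)" "continuous_on UNIV T'"
      "\<And>s. \<bar>T' s\<bar> \<le> 1" "T 0 = 0"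
    and \<eta>: "smooth_fn \<eta>" "\<And>x. \<bar>\<eta> x\<bar> \<le> 1" "\<And>x. norm (grad \<eta> x) \<le> B"
  shows "H01 (\<lambda>x. \<eta> x * T (u x)) (\<lambda>x. (\<eta> x * T' (u x)) *\<^sub>R g x + T (u x) *\<^sub>R grad \<eta> x) (\<lambda>x. \<eta> x * T (f x))"
proof -
  note L = H01_L2[OF H]
  obtain \<psi> where \<psi>: "\<And>k. test_fn \<Omega> (\<psi> (k::nat))"
    "(\<lambda>k. L2n l (\<lambda>x. \<psi> k x - u x)) \<longlonglongrightarrow> 0"
    "(\<lambda>k. L2n l (\<lambda>x. grad (\<psi> k) x - g x)) \<longlonglongrightarrow> 0"
    "(\<lambda>k. L2n m (\<lambda>x. \<psi> k x - f x)) \<longlonglongrightarrow> 0"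
    by (rule H01_approx[OF H]) (rule that)
  \<comment> \<open>\<open>T'\<close> is merely continuous, so its convergence along the
    approximants needs pointwise convergence, which a subsequence provides.\<close>
  obtain r where r: "strict_mono (r::nat\<Rightarrow>nat)" "AE x in l. (\<lambda>k. \<psi> (r k) x) \<longlonglongrightarrow> u x"
    by (rule l.L2_AE_subseq[OF test_L2(1)[OF \<psi>(1)] L(1) \<psi>(2)]) (rule that)
  define \<phi> where "\<phi> k = \<psi> (r k)" for k
  have \<phi>: "\<And>k. test_fn \<Omega> (\<phi> k)" "(\<lambda>k. L2n l (\<lambda>x. \<phi> k x - u x)) \<longlonglongrightarrow> 0"
    "(\<lambda>k. L2n l (\<lambda>x. grad (\<phi> k) x - g x)) \<longlonglongrightarrow> 0" "(\<lambda>k. L2n m (\<lambda>x. \<phi> k x - f x)) \<longlonglongrightarrow> 0"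
    "AE x in l. (\<lambda>k. \<phi> k x) \<longlonglongrightarrow> u x"
    unfolding \<phi>_def using \<psi>(1) r(2)
      LIMSEQ_subseq_LIMSEQ[OF \<psi>(2) r(1)] LIMSEQ_subseq_LIMSEQ[OF \<psi>(3) r(1)]
      LIMSEQ_subseq_LIMSEQ[OF \<psi>(4) r(1)] by (auto simp: o_def)
  note TL = test_L2[OF \<phi>(1)]
  have lip: "\<bar>T a - T b\<bar> \<le> \<bar>a - b\<bar>" for a b
  proof -
    have "norm (T a - T b) \<le> 1 * norm (a - b)"
      by (rule field_differentiable_bound[of UNIV T T' 1]) (use T in auto)
    then show ?thesis by simp
  qed
  have T0: "\<bar>T a\<bar> \<le> \<bar>a\<bar>" for a using lip[of a 0] T(5) by simp
  have cT: "continuous_on UNIV T" by (rule smooth_fn_continuous[OF T(1)])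
  have mT: "(\<lambda>x. T (w x)) \<in> borel_measurable M" "(\<lambda>x. T' (w x)) \<in> borel_measurable M"
    if "w \<in> borel_measurable M" for w :: "'a \<Rightarrow> real" and M
    using borel_measurable_continuous_on[OF cT that] borel_measurable_continuous_on[OF T(3) that] by auto
  have \<eta>b: "\<eta> \<in> borel_measurable borel" "grad \<eta> \<in> borel_measurable borel"
    using \<eta>(1) by (auto intro!: borel_measurable_continuous_onI smooth_fn_continuous continuous_on_grad)
  have \<eta>m: "\<eta> \<in> borel_measurable l" "grad \<eta> \<in> borel_measurable l" "\<eta> \<in> borel_measurable m"
    using \<eta>b by (auto intro!: measurable_completion simp: measurable_cong_sets[OF sets_\<mu> refl])
  have um: "u \<in> borel_measurable l" "g \<in> borel_measurable l" "f \<in> borel_measurable m"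
    "\<phi> k \<in> borel_measurable l" "grad (\<phi> k) \<in> borel_measurable l" "\<phi> k \<in> borel_measurable m" for k
    using L TL[of k] by (auto simp: L2_def)
  have B0: "B \<ge> 0" using \<eta>(3) norm_ge_zero order_trans by blast
  define G where "G k x = (\<eta> x * T' (\<phi> k x)) *\<^sub>R grad (\<phi> k) x + T (\<phi> k x) *\<^sub>R grad \<eta> x" for k x
  have test: "test_fn \<Omega> (\<lambda>x. \<eta> x * T (\<phi> k x))" for k
  proof (rule test_fn_subsupport[OF \<phi>(1)[of k]])
    show "smooth_fn (\<lambda>x. \<eta> x * T (\<phi> k x))"
      by (intro smooth_fn_mult \<eta> smooth_fn_comp[OF T(1)] test_fnD(1)[OF \<phi>(1)])
  qed (use T(5) in auto)
  have "grad (\<lambda>x. \<eta> x * T (\<phi> k x)) = G k" for k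
    unfolding G_def using grad_chain[OF test_fnD(1)[OF \<phi>(1)[of k]] \<eta>(1) T(2)] by auto
  then have HK: "H01 (\<lambda>x. \<eta> x * T (\<phi> k x)) (G k) (\<lambda>x. \<eta> x * T (\<phi> k x))" for k
    using H01_test[OF test[of k]] by simp
  have L2u: "L2 M (\<lambda>x. \<eta> x * T (w x))" if "L2 M w" "\<eta> \<in> borel_measurable M" for w M
  proof (rule L2I_bound)
    show "(\<lambda>x. \<eta> x * T (w x)) \<in> borel_measurable M"
      using that mT(1)[of w M] by (auto simp: L2_def)
    show "integrable M (\<lambda>x. (norm (w x))\<^sup>2)" using that by (simp add: L2_def)
    have "\<bar>\<eta> x * T (w x)\<bar> \<le> 1 * \<bar>w x\<bar>" for x
      unfolding abs_mult using \<eta>(2) T0 by (intro mult_mono) auto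
    then show "AE x in M. (norm (\<eta> x * T (w x)))\<^sup>2 \<le> (norm (w x))\<^sup>2"
      by (intro always_eventually allI power_mono) auto
  qed
  have L2g: "L2 l (\<lambda>x. (\<eta> x * T' (u x)) *\<^sub>R g x + T (u x) *\<^sub>R grad \<eta> x)"
  proof (rule L2_add)
    show "L2 l (\<lambda>x. (\<eta> x * T' (u x)) *\<^sub>R g x)"
    proof (rule L2I_bound)
      show "(\<lambda>x. (\<eta> x * T' (u x)) *\<^sub>R g x) \<in> borel_measurable l"
        using \<eta>m um mT(2)[OF um(1)] by (intro borel_measurable_scaleR borel_measurable_times)
      show "integrable l (\<lambda>x. (norm (g x))\<^sup>2)" using L by (simp add: L2_def)
      have "\<bar>\<eta> x * T' (u x)\<bar> * norm (g x) \<le> 1 * norm (g x)" for x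
        unfolding abs_mult using \<eta>(2) T(4) by (intro mult_right_mono mult_le_one) auto
      then show "AE x in l. (norm ((\<eta> x * T' (u x)) *\<^sub>R g x))\<^sup>2 \<le> (norm (g x))\<^sup>2"
        by (intro always_eventually allI power_mono) auto
    qed
    show "L2 l (\<lambda>x. T (u x) *\<^sub>R grad \<eta> x)"
    proof (rule L2I_bound)
      show "(\<lambda>x. T (u x) *\<^sub>R grad \<eta> x) \<in> borel_measurable l"
        using \<eta>m mT(1)[OF um(1)] by (intro borel_measurable_scaleR)
      show "integrable l (\<lambda>x. (norm (B *\<^sub>R u x))\<^sup>2)" using L2_scale[OF L(1), of B] by (simp add: L2_def)
      have "norm (T (u x) *\<^sub>R grad \<eta> x) \<le> norm (B *\<^sub>R u x)" for x
        using mult_mono[OF T0[of "u x"] \<eta>(3)[of x]] B0 by (simp add: abs_mult mult.commute)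
      then show "AE x in l. (norm (T (u x) *\<^sub>R grad \<eta> x))\<^sup>2 \<le> (norm (B *\<^sub>R u x))\<^sup>2"
        by (intro always_eventually allI power_mono) auto
    qed
  qed
  have cu: "(\<lambda>k. L2n M (\<lambda>x. \<eta> x * T (w k x) - \<eta> x * T (z x))) \<longlonglongrightarrow> 0"
    if "\<And>k. L2 M (w k)" "L2 M z" "\<eta> \<in> borel_measurable M" "(\<lambda>k. L2n M (\<lambda>x. w k x - z x)) \<longlonglongrightarrow> 0"
    for w z and M :: "'a measure"
  proof (rule tendsto_sandwich[OF _ _ tendsto_const that(4)])
    have "L2n M (\<lambda>x. \<eta> x * T (w k x) - \<eta> x * T (z x)) \<le> L2n M (\<lambda>x. w k x - z x)" for k
    proof (rule L2n_mono)
      show "L2 M (\<lambda>x. \<eta> x * T (w k x) - \<eta> x * T (z x))" "L2 M (\<lambda>x. w k x - z x)"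
        using that by (intro L2_diff L2u; simp)+
      have "\<bar>\<eta> x\<bar> * \<bar>T (w k x) - T (z x)\<bar> \<le> 1 * \<bar>w k x - z x\<bar>" for x
        using \<eta>(2) lip by (intro mult_mono) auto
      then show "AE x in M. norm (\<eta> x * T (w k x) - \<eta> x * T (z x)) \<le> norm (w k x - z x)"
        by (simp add: abs_mult flip: right_diff_distrib)
    qed
    then show "\<forall>\<^sub>F k in sequentially. L2n M (\<lambda>x. \<eta> x * T (w k x) - \<eta> x * T (z x)) \<le> L2n M (\<lambda>x. w k x - z x)"
      by simp
  qed simp
  \<comment> \<open>\<open>P\<close> is controlled by convergence of the gradients and
    \<open>S\<close> by the Lipschitz bound on \<open>T\<close>; \<open>Q\<close>, a fixed gradient
    times a bounded coefficient tending to zero almost everywhere, is handled by domination.\<close>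
  define P where "P k x = (\<eta> x * T' (\<phi> k x)) *\<^sub>R (grad (\<phi> k) x - g x)" for k x
  define Q where "Q k x = (\<eta> x * (T' (\<phi> k x) - T' (u x))) *\<^sub>R g x" for k x
  define S where "S k x = (T (\<phi> k x) - T (u x)) *\<^sub>R grad \<eta> x" for k x
  have mP: "P k \<in> borel_measurable l" "Q k \<in> borel_measurable l" "S k \<in> borel_measurable l" for k
    unfolding P_def Q_def S_def
    using \<eta>m um mT(1)[OF um(1)] mT(2)[OF um(1)] mT(1)[OF um(4)] mT(2)[OF um(4)]
    by (auto intro!: borel_measurable_scaleR borel_measurable_times borel_measurable_diff)
  have bP: "norm (P k x) \<le> norm (grad (\<phi> k) x - g x)" for k x
  proof -
    have "\<bar>\<eta> x * T' (\<phi> k x)\<bar> * norm (grad (\<phi> k) x - g x) \<le> 1 * norm (grad (\<phi> k) x - g x)"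
      unfolding abs_mult using \<eta>(2) T(4) by (intro mult_right_mono mult_le_one) auto
    then show ?thesis by (simp add: P_def)
  qed
  have bQ: "norm (Q k x) \<le> norm (2 *\<^sub>R g x)" for k x
  proof -
    have "\<bar>T' (\<phi> k x) - T' (u x)\<bar> \<le> 2" using T(4)[of "\<phi> k x"] T(4)[of "u x"] by linarith
    then have "\<bar>\<eta> x\<bar> * \<bar>T' (\<phi> k x) - T' (u x)\<bar> \<le> 1 * 2" using \<eta>(2) by (intro mult_mono) auto
    then have "\<bar>\<eta> x * (T' (\<phi> k x) - T' (u x))\<bar> * norm (g x) \<le> 2 * norm (g x)"
      unfolding abs_mult by (intro mult_right_mono) auto
    then show ?thesis by (simp add: Q_def)
  qed
  have bS: "norm (S k x) \<le> norm (B *\<^sub>R (\<phi> k x - u x))" for k x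
    using mult_mono[OF lip[of "\<phi> k x" "u x"] \<eta>(3)[of x]] B0 by (simp add: S_def abs_mult mult.commute)
  have LP: "L2 l (P k)" for k
    by (rule L2I_le[OF mP(1) L2_diff[OF TL(2)[of k] L(2)] bP])
  have LS: "L2 l (S k)" for k
    by (rule L2I_le[OF mP(3) L2_scale[OF L2_diff[OF TL(1)[of k] L(1)], of B] bS])
  have cQ: "\<And>k. L2 l (Q k)" "(\<lambda>k. L2n l (Q k)) \<longlonglongrightarrow> 0"
  proof -
    have z: "(\<lambda>x. 0::'a) \<in> borel_measurable l" by simp
    have ae: "AE x in l. (\<lambda>k. Q k x) \<longlonglongrightarrow> 0"
      using \<phi>(5)
    proof eventually_elim
      case (elim x)
      have "(\<lambda>k. T' (\<phi> k x)) \<longlonglongrightarrow> T' (u x)"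
        using T(3) elim by (rule continuous_on_tendsto_compose) auto
      then have "(\<lambda>k. (\<eta> x * (T' (\<phi> k x) - T' (u x))) *\<^sub>R g x) \<longlonglongrightarrow> (\<eta> x * (T' (u x) - T' (u x))) *\<^sub>R g x"
        by (intro tendsto_intros)
      then show ?case by (simp add: Q_def)
    qed
    note D = L2_dominated[where F=Q, OF mP(2) z L2_scale[OF L(2), of 2] ae always_eventually[OF allI, OF bQ]]
    show "\<And>k. L2 l (Q k)" by (rule D(2))
    show "(\<lambda>k. L2n l (Q k)) \<longlonglongrightarrow> 0" using D(3) by simp
  qed
  have cg: "(\<lambda>k. L2n l (\<lambda>x. G k x - ((\<eta> x * T' (u x)) *\<^sub>R g x + T (u x) *\<^sub>R grad \<eta> x))) \<longlonglongrightarrow> 0"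
  proof (rule tendsto_sandwich[OF _ _ tendsto_const])
    have "(\<lambda>k. L2n l (\<lambda>x. grad (\<phi> k) x - g x) + L2n l (Q k) + \<bar>B\<bar> * L2n l (\<lambda>x. \<phi> k x - u x)) \<longlonglongrightarrow> 0 + 0 + \<bar>B\<bar> * 0"
      by (intro tendsto_intros \<phi> cQ)
    then show "(\<lambda>k. L2n l (\<lambda>x. grad (\<phi> k) x - g x) + L2n l (Q k) + \<bar>B\<bar> * L2n l (\<lambda>x. \<phi> k x - u x)) \<longlonglongrightarrow> 0"
      by simp
    have "L2n l (\<lambda>x. G k x - ((\<eta> x * T' (u x)) *\<^sub>R g x + T (u x) *\<^sub>R grad \<eta> x))
      \<le> L2n l (\<lambda>x. grad (\<phi> k) x - g x) + L2n l (Q k) + \<bar>B\<bar> * L2n l (\<lambda>x. \<phi> k x - u x)" for k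
    proof -
      have "L2n l (\<lambda>x. G k x - ((\<eta> x * T' (u x)) *\<^sub>R g x + T (u x) *\<^sub>R grad \<eta> x)) = L2n l (\<lambda>x. P k x + Q k x + S k x)"
        by (rule arg_cong[where f="L2n l"]) (auto simp: fun_eq_iff G_def P_def Q_def S_def algebra_simps)
      also have "\<dots> \<le> L2n l (\<lambda>x. P k x + Q k x) + L2n l (S k)"
        by (rule L2n_triangle[OF L2_add[OF LP cQ(1)] LS])
      also have "L2n l (\<lambda>x. P k x + Q k x) \<le> L2n l (P k) + L2n l (Q k)"
        by (rule L2n_triangle[OF LP cQ(1)])
      also have "L2n l (P k) \<le> L2n l (\<lambda>x. grad (\<phi> k) x - g x)"
        by (rule L2n_mono[OF LP L2_diff[OF TL(2) L(2)]]) (use bP in auto)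
      also have "L2n l (S k) \<le> L2n l (\<lambda>x. B *\<^sub>R (\<phi> k x - u x))"
        by (rule L2n_mono[OF LS L2_scale[OF L2_diff[OF TL(1) L(1)]]]) (intro always_eventually allI bS)
      also have "\<dots> = \<bar>B\<bar> * L2n l (\<lambda>x. \<phi> k x - u x)" by (rule L2n_scale)
      finally show ?thesis by simp
    qed
    then show "\<forall>\<^sub>F k in sequentially. L2n l (\<lambda>x. G k x - ((\<eta> x * T' (u x)) *\<^sub>R g x + T (u x) *\<^sub>R grad \<eta> x))
      \<le> L2n l (\<lambda>x. grad (\<phi> k) x - g x) + L2n l (Q k) + \<bar>B\<bar> * L2n l (\<lambda>x. \<phi> k x - u x)" by simp
  qed simp
  show ?thesis
    by (rule H01_closed[OF HK L2u[OF L(1) \<eta>m(1)] L2g L2u[OF L(3) \<eta>m(3)]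
          cu[OF TL(1) L(1) \<eta>m(1) \<phi>(2)] cg cu[OF TL(3) L(3) \<eta>m(3) \<phi>(4)]])
qed

lemma H01_trunc:
  assumes "H01 u g f" "\<epsilon> > 0" "smooth_fn \<eta>" "\<And>x. \<bar>\<eta> x\<bar> \<le> 1" "\<And>x. norm (grad \<eta> x) \<le> B"
  shows "H01 (\<lambda>x. \<eta> x * trunc \<epsilon> (u x))
    (\<lambda>x. (\<eta> x * trunc' \<epsilon> (u x)) *\<^sub>R g x + trunc \<epsilon> (u x) *\<^sub>R grad \<eta> x) (\<lambda>x. \<eta> x * trunc \<epsilon> (f x))"
  using assms trunc'_bounds[OF assms(2)]
  by (intro H01_truncate smooth_fn_trunc trunc_deriv continuous_on_trunc') (auto simp: trunc_le)

text \<open>The truncations are dominated by the original triple, so \<open>\<epsilon>\<close> may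
  tend to 0. The indicator is no smooth factor, which is why membership of the truncated pieces is a
  hypothesis; the whole space and nodal domains are the two uses.\<close>

lemma H01_trunc_limit:
  assumes H: "H01 u g f" and D: "D \<in> sets borel"
    and T: "\<And>\<epsilon>. \<epsilon> > 0 \<Longrightarrow> H01 (\<lambda>x. indicator D x * trunc \<epsilon> (u x))
      (\<lambda>x. (indicator D x * trunc' \<epsilon> (u x)) *\<^sub>R g x) (\<lambda>x. indicator D x * trunc \<epsilon> (f x))"
  shows "H01 (\<lambda>x. indicator D x * max (u x) 0) (\<lambda>x. (indicator D x * (if u x > 0 then 1 else 0)) *\<^sub>R g x)
    (\<lambda>x. indicator D x * max (f x) 0)"
proof -
  note L = H01_L2[OF H]
  define \<epsilon> where "\<epsilon> k = 1 / real (Suc k)" for k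
  have \<epsilon>: "\<And>k. \<epsilon> k > 0" "\<epsilon> \<longlonglongrightarrow> 0"
    using LIMSEQ_inverse_real_of_nat by (auto simp: \<epsilon>_def[abs_def] inverse_eq_divide)
  note HT = T[OF \<epsilon>(1)] and LT = H01_L2[OF T[OF \<epsilon>(1)]]
  have Dl: "D \<in> sets lebesgue" "D \<in> sets \<mu>" using D sets_\<mu> by auto
  have um: "u \<in> borel_measurable l" "g \<in> borel_measurable l" "f \<in> borel_measurable m"
    using L by (auto simp: L2_def)
  have i1: "\<bar>indicator D x :: real\<bar> \<le> 1" for x by (simp add: indicator_def)
  have bt: "norm (indicator D x * trunc (\<epsilon> k) s) \<le> norm (s::real)" for x k s
    using mult_mono[OF i1[of x] trunc_abs_le[OF \<epsilon>(1)[of k], of s]] by (simp add: abs_mult)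
  have bt': "norm ((indicator D x * trunc' (\<epsilon> k) s) *\<^sub>R v) \<le> norm (v::'a)" for x k s v
  proof -
    have "\<bar>indicator D x * trunc' (\<epsilon> k) s\<bar> \<le> 1"
      using trunc'_bounds[OF \<epsilon>(1)[of k], of s] by (auto simp: indicator_def)
    then have "\<bar>indicator D x * trunc' (\<epsilon> k) s\<bar> * norm v \<le> 1 * norm v" by (rule mult_right_mono) simp
    then show ?thesis by simp
  qed
  have m1: "(\<lambda>x. indicator D x * max (u x) 0) \<in> borel_measurable l"
    using um Dl by (intro borel_measurable_times borel_measurable_max) auto
  have m2: "(\<lambda>x. (indicator D x * (if u x > 0 then 1 else 0)) *\<^sub>R g x) \<in> borel_measurable l"
  proof -
    have "(\<lambda>x. if u x > 0 then 1 else 0 :: real) \<in> borel_measurable l"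
      using borel_measurable_less[OF borel_measurable_const um(1), of 0]
      by (intro measurable_If) auto
    then show ?thesis using um Dl by (intro borel_measurable_scaleR borel_measurable_times) auto
  qed
  have m3: "(\<lambda>x. indicator D x * max (f x) 0) \<in> borel_measurable m"
    using um Dl by (intro borel_measurable_times borel_measurable_max) auto
  note D1 = L2_dominated[where F="\<lambda>k x. indicator D x * trunc (\<epsilon> k) (u x)" and G=u, OF L2_measurable[OF LT(1)] m1 L(1)]
  note D2 = L2_dominated[where F="\<lambda>k x. (indicator D x * trunc' (\<epsilon> k) (u x)) *\<^sub>R g x" and G=g, OF L2_measurable[OF LT(2)] m2 L(2)]
  note D3 = L2_dominated[where F="\<lambda>k x. indicator D x * trunc (\<epsilon> k) (f x)" and G=f, OF L2_measurable[OF LT(3)] m3 L(3)]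
  note tt = trunc_tendsto[where \<epsilon>=\<epsilon>, OF \<epsilon>]
  have t1: "AE x in M. (\<lambda>k. indicator D x * trunc (\<epsilon> k) (w x)) \<longlonglongrightarrow> indicator D x * max (w x) 0" for M and w :: "'a \<Rightarrow> real"
    by (intro always_eventually allI tendsto_mult tendsto_const tt)
  have t2: "AE x in l. (\<lambda>k. (indicator D x * trunc' (\<epsilon> k) (u x)) *\<^sub>R g x)
      \<longlonglongrightarrow> (indicator D x * (if u x > 0 then 1 else 0)) *\<^sub>R g x"
    by (intro always_eventually allI tendsto_mult tendsto_const tendsto_scaleR tt)
  have b1: "AE x in M. norm (indicator D x * trunc (\<epsilon> k) (w x)) \<le> norm (w x)" for M k and w :: "'a \<Rightarrow> real"
    by (intro always_eventually allI bt)
  have b2: "AE x in l. norm ((indicator D x * trunc' (\<epsilon> k) (u x)) *\<^sub>R g x) \<le> norm (g x)" for k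
    by (intro always_eventually allI bt')
  show ?thesis
    by (rule H01_closed[OF HT D1(1)[OF t1 b1] D2(1)[OF t2 b2] D3(1)[OF t1 b1]
          D1(3)[OF t1 b1] D2(3)[OF t2 b2] D3(3)[OF t1 b1]])
qed

lemma H01_pos_part:
  assumes H: "H01 u g f"
  shows "H01 (\<lambda>x. max (u x) 0) (\<lambda>x. (if u x > 0 then 1 else 0) *\<^sub>R g x) (\<lambda>x. max (f x) 0)"
proof -
  have g0: "grad (\<lambda>x. 1) x = (0::'a)" for x by (rule grad_eqI) simp
  have "H01 (\<lambda>x. indicator UNIV x * max (u x) 0) (\<lambda>x. (indicator UNIV x * (if u x > 0 then 1 else 0)) *\<^sub>R g x)
    (\<lambda>x. indicator UNIV x * max (f x) 0)"
  proof (rule H01_trunc_limit[OF H])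
    fix \<epsilon> :: real assume \<epsilon>: "\<epsilon> > 0"
    show "H01 (\<lambda>x. indicator UNIV x * trunc \<epsilon> (u x))
      (\<lambda>x. (indicator UNIV x * trunc' \<epsilon> (u x)) *\<^sub>R g x) (\<lambda>x. indicator UNIV x * trunc \<epsilon> (f x))"
      using H01_trunc[OF H \<epsilon> smooth_fn_const[of 1], of 0] by (simp add: g0)
  qed simp
  then show ?thesis by simp
qed

text \<open>Truncating at height \<open>\<epsilon>\<close> detaches the piece from the boundary of
  \<open>D\<close>, where \<open>u\<close> is not positive: either the point lies on the frontier of
  \<open>\<Omega>\<close>, or the closedness hypothesis on \<open>D\<close> applies. The indicator
  can then be replaced by a smooth cutoff.\<close>

lemma H01_restrict_pos:
  assumes H: "H01 u g u" and u: "continuous_on (closure \<Omega>) u" "\<And>x. x \<in> frontier \<Omega> \<Longrightarrow> u x = 0"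
    and D: "open D" "D \<subseteq> \<Omega>" "\<And>x. x \<in> D \<Longrightarrow> u x > 0"
    "\<And>x. x \<in> closure D \<Longrightarrow> x \<in> \<Omega> \<Longrightarrow> u x > 0 \<Longrightarrow> x \<in> D"
  shows "H01 (\<lambda>x. indicator D x * u x) (\<lambda>x. indicator D x *\<^sub>R g x) (\<lambda>x. indicator D x * u x)"
proof -
  have clD: "closure D \<subseteq> closure \<Omega>" using D(2) by (rule closure_mono)
  have inD: "x \<in> D" if "x \<in> closure D" "u x > 0" for x
  proof (rule D(4)[OF that(1) _ that(2)])
    show "x \<in> \<Omega>"
    proof (rule ccontr)
      assume "x \<notin> \<Omega>"
      then have "x \<in> frontier \<Omega>" using that clD open_dom by (auto simp: frontier_def interior_open)
      then show False using u(2) that by force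
    qed
  qed
  have "H01 (\<lambda>x. indicator D x * max (u x) 0) (\<lambda>x. (indicator D x * (if u x > 0 then 1 else 0)) *\<^sub>R g x)
    (\<lambda>x. indicator D x * max (u x) 0)"
  proof (rule H01_trunc_limit[OF H])
    fix \<epsilon> :: real assume \<epsilon>: "\<epsilon> > 0"
    \<comment> \<open>The truncation lives on this set, which is compact and contained in
      \<open>D\<close>; a cutoff equal to 1 on it acts like the indicator of
      \<open>D\<close>.\<close>
    define K where "K = {x \<in> closure D. u x \<ge> \<epsilon>}"
    have cu: "continuous_on (closure D) u" using u(1) clD by (rule continuous_on_subset)
    have "closed K" unfolding K_def
      using continuous_closed_preimage[OF cu closed_closure, of "{\<epsilon>..}"] by (simp add: vimage_def Int_def)
    moreover have "bounded K"
      by (rule bounded_subset[OF bounded_closure[OF bounded_dom]]) (use clD in \<open>auto simp: K_def\<close>)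
    ultimately have K: "compact K" by (simp add: compact_eq_bounded_closed)
    have KD: "K \<subseteq> D" using inD \<epsilon> by (force simp: K_def)
    obtain \<eta> where \<eta>: "smooth_fn \<eta>" "\<And>x. 0 \<le> \<eta> x" "\<And>x. \<eta> x \<le> 1" "\<And>x. x \<in> K \<Longrightarrow> \<eta> x = 1"
      "compact (closure {x. \<eta> x \<noteq> 0})" "closure {x. \<eta> x \<noteq> 0} \<subseteq> D"
      by (rule smooth_cutoff[OF K D(1) KD]) (rule that)
    have "test_fn D \<eta>" using \<eta> by (simp add: test_fn_def)
    then obtain B where B: "\<And>x. \<bar>\<eta> x\<bar> \<le> B" "\<And>x. norm (grad \<eta> x) \<le> B" "B \<ge> 0"
      by (rule test_fn_bounded) (rule that)
    have 1: "\<bar>\<eta> x\<bar> \<le> 1" for x using \<eta>(2,3)[of x] by simp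
    note HT = H01_trunc[OF H \<epsilon> \<eta>(1) 1 B(2)]
    have e1: "\<eta> x * trunc \<epsilon> (u x) = indicator D x * trunc \<epsilon> (u x)" for x
    proof (cases "x \<in> D")
      case True
      then show ?thesis
        using \<eta>(4)[of x] trunc_le[OF \<epsilon>, of "u x"] closure_subset[of D] by (cases "u x \<ge> \<epsilon>") (auto simp: K_def)
    next
      case False
      then have "\<eta> x = 0" using \<eta>(6) closure_subset[of "{x. \<eta> x \<noteq> 0}"] by blast
      then show ?thesis using False by simp
    qed
    \<comment> \<open>Off \<open>D\<close> the cutoff vanishes together with its gradient. Inside
      \<open>D\<close> it is constant near points above the threshold, and at the others the
      truncation and its slope vanish; so the gradient of \<open>\<eta>\<close> never
      contributes.\<close>
    have e2: "(\<eta> x * trunc' \<epsilon> (u x)) *\<^sub>R g x + trunc \<epsilon> (u x) *\<^sub>R grad \<eta> x = (indicator D x * trunc' \<epsilon> (u x)) *\<^sub>R g x" for x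
    proof (cases "x \<in> D")
      case False
      then have "x \<notin> closure {x. \<eta> x \<noteq> 0}" using \<eta>(6) by blast
      then have "\<eta> x = 0" "grad \<eta> x = 0"
        using grad_zero_outside[of x \<eta>] closure_subset[of "{x. \<eta> x \<noteq> 0}"] by auto
      then show ?thesis using False by simp
    next
      case True
      show ?thesis
      proof (cases "u x > \<epsilon>")
        case False
        then show ?thesis using trunc_le[OF \<epsilon>, of "u x"] by simp
      next
        case gt: True
        have ex: "\<eta> x = 1" using \<eta>(4)[of x] gt True closure_subset[of D] by (auto simp: K_def)
        have "open (D \<inter> u -` {\<epsilon><..})"
          using cu closure_subset D(1) by (intro continuous_open_preimage) (auto intro: continuous_on_subset)
        moreover have "\<eta> y = 1" if "y \<in> D \<inter> u -` {\<epsilon><..}" for y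
          using that \<eta>(4)[of y] closure_subset[of D] by (auto simp: K_def)
        moreover have "x \<in> D \<inter> u -` {\<epsilon><..}" using gt True by simp
        moreover have "((\<lambda>_. 1) has_derivative (\<lambda>h. 0 \<bullet> h)) (at x)" by simp
        ultimately have "(\<eta> has_derivative (\<lambda>h. 0 \<bullet> h)) (at x)"
          by (metis (no_types, lifting) has_derivative_transform_within_open)
        then have "grad \<eta> x = 0" by (rule grad_eqI)
        then show ?thesis using ex True by simp
      qed
    qed
    show "H01 (\<lambda>x. indicator D x * trunc \<epsilon> (u x))
      (\<lambda>x. (indicator D x * trunc' \<epsilon> (u x)) *\<^sub>R g x) (\<lambda>x. indicator D x * trunc \<epsilon> (u x))"
      using HT unfolding e1 e2 .
  qed (use D in auto)
  moreover have "indicator D x * max (u x) 0 = indicator D x * u x"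
    "indicator D x * (if u x > 0 then 1 else 0) = (indicator D x :: real)" for x
    using D(3)[of x] by (auto simp: indicator_def)
  ultimately show ?thesis by simp
qed

section \<open>Nodal components and Rayleigh minimisers\<close>

lemma open_nodal_complement:
  assumes "continuous_on (closure \<Omega>) u"
  shows "open (\<Omega> - nodal_set \<Omega> u)"
proof -
  have "\<Omega> - nodal_set \<Omega> u = \<Omega> \<inter> u -` (- {0})" by (auto simp: nodal_set_def)
  moreover have "open (\<Omega> \<inter> u -` (- {0}))"
    by (rule continuous_open_preimage[OF continuous_on_subset[OF assms closure_subset] open_dom]) auto
  ultimately show ?thesis by simp
qed

text \<open>The sign is constant by connectedness. The last claim, that a component is closed within
  the complement of the nodal set, is the hypothesis on which \<open>H01_restrict_pos\<close>
  rests.\<close>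

lemma nodal_component:
  assumes u: "continuous_on (closure \<Omega>) u" and D: "D \<in> components (\<Omega> - nodal_set \<Omega> u)"
  shows "open D" "D \<subseteq> \<Omega>" "D \<noteq> {}" "(\<forall>x\<in>D. u x > 0) \<or> (\<forall>x\<in>D. u x < 0)"
    "x \<in> closure D \<Longrightarrow> x \<in> \<Omega> \<Longrightarrow> u x \<noteq> 0 \<Longrightarrow> x \<in> D"
proof -
  let ?P = "\<Omega> - nodal_set \<Omega> u"
  show "open D" using open_components[OF open_nodal_complement[OF u] D] .
  have sub: "D \<subseteq> ?P" using D by (rule in_components_subset)
  then show "D \<subseteq> \<Omega>" by auto
  show "D \<noteq> {}" using D by (rule in_components_nonempty)
  have nz: "u x \<noteq> 0" if "x \<in> D" for x using that sub by (auto simp: nodal_set_def)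
  have cD: "connected D" using D by (rule in_components_connected)
  have "continuous_on D u"
    using continuous_on_subset[OF u] \<open>D \<subseteq> \<Omega>\<close> closure_subset by blast
  then have ci: "connected (u ` D)" using cD by (rule connected_continuous_image)
  show "(\<forall>x\<in>D. u x > 0) \<or> (\<forall>x\<in>D. u x < 0)"
  proof (rule ccontr)
    assume "\<not> ?thesis"
    then obtain x y where xy: "x \<in> D" "y \<in> D" "u x \<le> 0" "u y \<ge> 0" by force
    then have "0 \<in> u ` D"
      using connectedD_interval[OF ci, of "u x" "u y" 0] by blast
    then show False using nz by force
  qed
  show "x \<in> D" if x: "x \<in> closure D" "x \<in> \<Omega>" "u x \<noteq> 0"
  proof -
    obtain T where T: "closed T" "D = ?P \<inter> T"
      using closedin_component[OF D] by (auto simp: closedin_closed)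
    then have "closure D \<subseteq> T" by (intro closure_minimal) auto
    then show ?thesis using x T by (auto simp: nodal_set_def)
  qed
qed

lemma H01_nodal_component:
  assumes H: "H01 u g u" and u: "continuous_on (closure \<Omega>) u" "\<And>x. x \<in> frontier \<Omega> \<Longrightarrow> u x = 0"
    and D: "D \<in> components (\<Omega> - nodal_set \<Omega> u)"
  shows "H01 (\<lambda>x. indicator D x * u x) (\<lambda>x. indicator D x *\<^sub>R g x) (\<lambda>x. indicator D x * u x)"
proof -
  note N = nodal_component[OF u(1) D]
  from N(4) show ?thesis
  proof
    assume "\<forall>x\<in>D. u x > 0"
    then show ?thesis
      using N by (intro H01_restrict_pos[OF H u]) auto
  next
    assume neg: "\<forall>x\<in>D. u x < 0"
    have H': "H01 (\<lambda>x. - u x) (\<lambda>x. - g x) (\<lambda>x. - u x)"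
      using H01_scale[OF H, of "-1"] by simp
    have "H01 (\<lambda>x. indicator D x * - u x) (\<lambda>x. indicator D x *\<^sub>R - g x) (\<lambda>x. indicator D x * - u x)"
      using N neg u by (intro H01_restrict_pos[OF H']) (auto intro: continuous_on_minus)
    from H01_scale[OF this, of "-1"] show ?thesis by simp
  qed
qed

section \<open>Rayleigh minimisers on orthogonal complements\<close>

definition eigen_system ::
  "'i set \<Rightarrow> ('i \<Rightarrow> real) \<Rightarrow> ('i \<Rightarrow> 'a \<Rightarrow> real) \<Rightarrow> ('i \<Rightarrow> 'a \<Rightarrow> 'a) \<Rightarrow> ('i \<Rightarrow> 'a \<Rightarrow> real) \<Rightarrow> bool" where
  "eigen_system I \<tau> v h E \<longleftrightarrow> finite I \<and> (\<forall>i\<in>I. is_eigenfunction \<Omega> \<mu> (\<tau> i) (v i) (h i) (E i)) \<and>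
    (\<forall>i\<in>I. \<forall>j\<in>I. ip m (E i) (E j) = (if i = j then 1 else 0))"

definition perp :: "'i set \<Rightarrow> ('i \<Rightarrow> 'a \<Rightarrow> real) \<Rightarrow> ('a \<Rightarrow> real) \<Rightarrow> bool" where
  "perp I E f \<longleftrightarrow> (\<forall>i\<in>I. ip m f (E i) = 0)"

text \<open>A lower bound for the Rayleigh quotient, written without division so that elements with
  zero \<open>\<mu>\<close>-norm are covered.\<close>

definition spectral_bound :: "'i set \<Rightarrow> ('i \<Rightarrow> 'a \<Rightarrow> real) \<Rightarrow> real \<Rightarrow> bool" where
  "spectral_bound I E R \<longleftrightarrow> (\<forall>v h k. H01 v h k \<longrightarrow> perp I E k \<longrightarrow> R * ip m k k \<le> ip l h h)"

lemma perp_lincomb: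
  assumes "eigen_system I \<tau> v h E" "L2 m f" "L2 m k" "perp I E f" "perp I E k"
  shows "perp I E (\<lambda>x. f x + c * k x)"
  unfolding perp_def
proof
  fix i assume i: "i \<in> I"
  then have "L2 m (E i)" using assms(1) eigenD(6) by (auto simp: eigen_system_def)
  then show "ip m (\<lambda>x. f x + c * k x) (E i) = 0"
    using assms i by (simp add: ip_add_left L2_cmult ip_cmult_left perp_def)
qed

text \<open>Directions perpendicular to the system are settled by the first variation. An arbitrary
  direction differs from its perpendicular part by a combination of the \<open>E i\<close>, on which
  both sides vanish.\<close>

lemma minimum_weak_equation:
  assumes E: "eigen_system I \<tau> v h E" and H: "H01 u g f" and p: "perp I E f"
    and R: "ip l g g = R * ip m f f" "spectral_bound I E R" and K: "H01 w q k"
  shows "ip l g q = R * ip m f k"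
proof -
  note L = H01_L2[OF H]
  have orth: "ip l g q = R * ip m f k" if K: "H01 w q k" "perp I E k" for w q k
  proof -
    note LK = H01_L2[OF K(1)]
    \<comment> \<open>The defect of the spectral bound is a nonnegative quadratic in
      \<open>t\<close> whose constant term vanishes at a minimiser, so its linear coefficient must
      vanish too.\<close>
    have "0 \<le> 0 + 2 * t * (ip l g q - R * ip m f k) + t\<^sup>2 * (ip l q q - R * ip m k k)" for t
    proof -
      have "R * ip m (\<lambda>x. f x + t *\<^sub>R k x) (\<lambda>x. f x + t *\<^sub>R k x)
        \<le> ip l (\<lambda>x. g x + t *\<^sub>R q x) (\<lambda>x. g x + t *\<^sub>R q x)"
        using R(2) H01_lincomb[OF H K(1), of t] perp_lincomb[OF E L(3) LK(3) p K(2), of t]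
        by (simp add: spectral_bound_def)
      then show ?thesis
        unfolding ip_expand[OF L(3) LK(3)] ip_expand[OF L(2) LK(2)] using R(1)
        by (simp add: algebra_simps)
    qed
    moreover have "0 \<le> ip l q q - R * ip m k k" using R(2) K by (simp add: spectral_bound_def)
    ultimately have "(ip l g q - R * ip m f k)\<^sup>2 \<le> 0 * (ip l q q - R * ip m k k)"
      by (rule quadratic_nonneg_discrim)
    then show ?thesis by simp
  qed
  define c where "c i = ip m k (E i)" for i
  have fin: "finite I" using E by (simp add: eigen_system_def)
  have HE: "H01 (v i) (h i) (E i)" "is_eigenfunction \<Omega> \<mu> (\<tau> i) (v i) (h i) (E i)" if "i \<in> I" for i
    using E that eigenD(1) by (auto simp: eigen_system_def)
  have LE: "L2 l (h i)" "L2 m (E i)" if "i \<in> I" for i using H01_L2[OF HE(1)[OF that]] by auto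
  note LK = H01_L2[OF K]
  have HS: "H01 (\<lambda>x. \<Sum>i\<in>I. c i * v i x) (\<lambda>x. \<Sum>i\<in>I. c i *\<^sub>R h i x) (\<lambda>x. \<Sum>i\<in>I. c i * E i x)"
    by (rule H01_sum[OF fin HE(1)])
  note LS = H01_L2[OF HS]
  have pk: "perp I E (\<lambda>x. k x - (\<Sum>i\<in>I. c i * E i x))"
    unfolding perp_def
  proof
    fix j assume j: "j \<in> I"
    have "ip m (\<lambda>x. \<Sum>i\<in>I. c i * E i x) (E j) = (\<Sum>i\<in>I. c i * ip m (E i) (E j))"
      using LE j by (subst ip_sum_left) (auto simp: ip_cmult_left)
    also have "\<dots> = (\<Sum>i\<in>I. if i = j then c i else 0)"
      using E j by (intro sum.cong) (auto simp: eigen_system_def)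
    also have "\<dots> = c j" using fin j by simp
    finally show "ip m (\<lambda>x. k x - (\<Sum>i\<in>I. c i * E i x)) (E j) = 0"
      using LK LS LE[OF j] by (simp add: ip_diff_left c_def)
  qed
  \<comment> \<open>Orthogonality to the \<open>E i\<close> in \<open>L2 m\<close> becomes
    orthogonality to the \<open>h i\<close> in energy through the weak equations of the
    \<open>E i\<close>.\<close>
  have "ip l (\<lambda>x. \<Sum>i\<in>I. c i *\<^sub>R h i x) g = (\<Sum>i\<in>I. c i * ip l (h i) g)"
    using LE L by (subst ip_sum_left) (auto simp: ip_scale_left)
  also have "\<dots> = (\<Sum>i\<in>I. c i * (\<tau> i * ip m (E i) f))"
    using eigenD(3)[OF HE(2) H] by (intro sum.cong) auto
  also have "\<dots> = 0" using p by (simp add: perp_def ip_commute)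
  finally have z1: "ip l g (\<lambda>x. \<Sum>i\<in>I. c i *\<^sub>R h i x) = 0" by (simp add: ip_commute)
  have "ip m (\<lambda>x. \<Sum>i\<in>I. c i * E i x) f = (\<Sum>i\<in>I. c i * ip m (E i) f)"
    using LE L by (subst ip_sum_left) (auto simp: ip_cmult_left)
  also have "\<dots> = 0" using p by (simp add: perp_def ip_commute)
  finally have z2: "ip m f (\<lambda>x. \<Sum>i\<in>I. c i * E i x) = 0" by (simp add: ip_commute)
  show ?thesis
    using orth[OF H01_diff[OF K HS] pk] z1 z2 L LK LS by (simp add: ip_diff_right)
qed

lemma minimum_is_eigenfunction:
  assumes "eigen_system I \<tau> v h E" "H01 u g f" "perp I E f" "ip l g g = R * ip m f f"
    "spectral_bound I E R" "L2n m f \<noteq> 0"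
  shows "is_eigenfunction \<Omega> \<mu> R u g f"
  unfolding eigen_iff using assms minimum_weak_equation[OF assms(1-5) H01_test] by blast

text \<open>The direct method without weak limits: compactness makes a normalised minimising
  sequence Cauchy in \<open>L2 m\<close>, and the parallelogram law upgrades this to Cauchy in
  energy. The given element \<open>k\<close> makes the infimum one over a nonempty set and bounds it
  by \<open>T\<close>.\<close>

lemma exists_minimum:
  assumes E: "eigen_system I \<tau> v h E"
    and W: "H01 w q k" "perp I E k" "L2n m k \<noteq> 0" "ip l q q \<le> T * ip m k k"
  obtains R u g f where "R \<le> T" "is_eigenfunction \<Omega> \<mu> R u g f" "perp I E f" "ip m f f = 1"
    "spectral_bound I E R"
proof -
  define A where "A = {ip l h' h' | v' h' k'. H01 v' h' k' \<and> perp I E k' \<and> ip m k' k' = 1}"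
  have normalise: "ip l q q / ip m k k \<in> A" if W: "H01 w q k" "perp I E k" "ip m k k > 0" for w q k
  proof -
    define c where "c = 1 / sqrt (ip m k k)"
    have cc: "c * c = 1 / ip m k k" using W(3) by (simp add: c_def)
    have "perp I E (\<lambda>x. c * k x)" using W(2) by (simp add: perp_def ip_cmult_left)
    moreover have "ip m (\<lambda>x. c * k x) (\<lambda>x. c * k x) = 1"
      using cc W(3) by (simp add: ip_cmult_left ip_cmult_right flip: mult.assoc)
    moreover have "ip l (\<lambda>x. c *\<^sub>R q x) (\<lambda>x. c *\<^sub>R q x) = ip l q q / ip m k k"
      using cc by (simp add: ip_scale_left ip_scale_right flip: mult.assoc)
    ultimately show ?thesis
      unfolding A_def using H01_scale[OF W(1), of c] by (intro CollectI exI conjI) (rule sym, assumption+)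
  qed
  have kpos: "ip m k k > 0" using ip_m_pos[OF W(3)] .
  have Ane: "A \<noteq> {}" using normalise[OF W(1,2) kpos] by blast
  have bdd: "bdd_below A" unfolding A_def by (rule bdd_belowI[of _ 0]) auto
  define R where "R = Inf A"
  have Rle: "R \<le> a" if "a \<in> A" for a unfolding R_def using bdd that by (rule cInf_lower[rotated])
  have R0: "R \<ge> 0" unfolding R_def using Ane by (rule cInf_greatest) (auto simp: A_def)
  have bound: "spectral_bound I E R"
    unfolding spectral_bound_def
  proof (intro allI impI)
    fix v' h' k' assume a: "H01 v' h' k'" "perp I E k'"
    show "R * ip m k' k' \<le> ip l h' h'"
    proof (cases "ip m k' k' > 0")
      case True
      then show ?thesis using Rle[OF normalise[OF a True]] by (simp add: field_simps)
    next
      case False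
      then have "ip m k' k' = 0" using ip_self_nonneg[of m k'] by linarith
      then show ?thesis by simp
    qed
  qed
  have "R * ip m k k \<le> T * ip m k k"
    using bound W by (auto simp: spectral_bound_def intro: order_trans)
  then have RT: "R \<le> T" using kpos by simp
  have "\<forall>n::nat. \<exists>p. H01 (fst p) (fst (snd p)) (snd (snd p)) \<and> perp I E (snd (snd p)) \<and>
    ip m (snd (snd p)) (snd (snd p)) = 1 \<and> ip l (fst (snd p)) (fst (snd p)) < R + 1 / real (Suc n)"
  proof
    fix n :: nat
    have "Inf A < R + 1 / real (Suc n)" by (simp add: R_def)
    then obtain a where "a \<in> A" "a < R + 1 / real (Suc n)" using cInf_lessD[OF Ane] by blast
    then obtain v' h' k' where "H01 v' h' k'" "perp I E k'" "ip m k' k' = 1" "ip l h' h' < R + 1 / real (Suc n)"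
      unfolding A_def by blast
    then show "\<exists>p. H01 (fst p) (fst (snd p)) (snd (snd p)) \<and> perp I E (snd (snd p)) \<and>
      ip m (snd (snd p)) (snd (snd p)) = 1 \<and> ip l (fst (snd p)) (fst (snd p)) < R + 1 / real (Suc n)"
      by (intro exI[of _ "(v', h', k')"]) simp
  qed
  from choice[OF this] obtain p where p: "\<forall>n::nat. H01 (fst (p n)) (fst (snd (p n))) (snd (snd (p n))) \<and> perp I E (snd (snd (p n))) \<and>
    ip m (snd (snd (p n))) (snd (snd (p n))) = 1 \<and> ip l (fst (snd (p n))) (fst (snd (p n))) < R + 1 / real (Suc n)"
    by (rule exE)
  define U G F where "U n = fst (p n)" and "G n = fst (snd (p n))" and "F n = snd (snd (p n))" for n
  have S: "\<And>n. H01 (U n) (G n) (F n)" "\<And>n. perp I E (F n)" "\<And>n. ip m (F n) (F n) = 1"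
    "\<And>n. ip l (G n) (G n) < R + 1 / real (Suc n)"
    using p by (auto simp: U_def G_def F_def)
  note LS = H01_L2[OF S(1)]
  have GB: "L2n l (G n) \<le> sqrt (R + 1)" for n
  proof -
    have "1 / real (Suc n) \<le> 1" by simp
    then have "ip l (G n) (G n) \<le> R + 1" using S(4)[of n] by linarith
    then show ?thesis unfolding L2n_def by (rule real_sqrt_le_mono)
  qed
  obtain r where r: "strict_mono (r :: nat \<Rightarrow> nat)"
    "\<And>e. e > 0 \<Longrightarrow> \<exists>N. \<forall>i\<ge>N. \<forall>j\<ge>N. L2n m (\<lambda>x. F (r i) x - F (r j) x) < e"
    by (rule H01_compact[OF S(1) GB]) (rule that)
  \<comment> \<open>Parallelogram law: the energy of the sum is at least \<open>R\<close> times its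
    squared \<open>L2 m\<close> norm, which equals 4 minus that of the difference; the four copies
    of \<open>R\<close> cancel against the two nearly minimal energies.\<close>
  have para: "(L2n l (\<lambda>x. G i x - G j x))\<^sup>2
    \<le> 2 / real (Suc i) + 2 / real (Suc j) + R * (L2n m (\<lambda>x. F i x - F j x))\<^sup>2" for i j
  proof -
    have e1: "ip l (\<lambda>x. G i x - G j x) (\<lambda>x. G i x - G j x) = ip l (G i) (G i) - 2 * ip l (G i) (G j) + ip l (G j) (G j)"
      "ip l (\<lambda>x. G i x + G j x) (\<lambda>x. G i x + G j x) = ip l (G i) (G i) + 2 * ip l (G i) (G j) + ip l (G j) (G j)"
      using ip_expand[OF LS(2)[of i] LS(2)[of j], of "-1"] ip_expand[OF LS(2)[of i] LS(2)[of j], of 1] by simp_all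
    have e2: "ip m (\<lambda>x. F i x - F j x) (\<lambda>x. F i x - F j x) = 2 - 2 * ip m (F i) (F j)"
      "ip m (\<lambda>x. F i x + F j x) (\<lambda>x. F i x + F j x) = 2 + 2 * ip m (F i) (F j)"
      using ip_expand[OF LS(3)[of i] LS(3)[of j], of "-1"] ip_expand[OF LS(3)[of i] LS(3)[of j], of 1] S(3) by simp_all
    have "R * ip m (\<lambda>x. F i x + F j x) (\<lambda>x. F i x + F j x) \<le> ip l (\<lambda>x. G i x + G j x) (\<lambda>x. G i x + G j x)"
      using bound H01_lincomb[OF S(1)[of i] S(1)[of j], of 1] perp_lincomb[OF E LS(3)[of i] LS(3)[of j] S(2) S(2), of 1]
      unfolding spectral_bound_def by fastforce
    then have "R * (2 + 2 * ip m (F i) (F j)) \<le> ip l (G i) (G i) + 2 * ip l (G i) (G j) + ip l (G j) (G j)"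
      unfolding e1 e2 .
    then show ?thesis
      unfolding L2n_sq e1 e2 using S(4)[of i] S(4)[of j] by (simp add: algebra_simps)
  qed
  have CG: "\<exists>N. \<forall>i\<ge>N. \<forall>j\<ge>N. L2n l (\<lambda>x. G (r i) x - G (r j) x) < e" if e: "e > 0" for e
  proof -
    \<comment> \<open>Each of the two reciprocal terms in \<open>para\<close> contributes at most
      \<open>d\<^sup>2 / 2\<close> and the last one \<open>R * d\<^sup>2\<close>; the total
      \<open>d\<^sup>2 * (R + 1)\<close> is \<open>e\<^sup>2\<close>.\<close>
    define d where "d = e / sqrt (R + 1)"
    have sR: "sqrt (R + 1) > 0" using R0 by simp
    have d: "d > 0" using e sR by (simp add: d_def)
    have d2: "d\<^sup>2 * (R + 1) = e\<^sup>2" using R0 by (simp add: d_def power_divide)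
    obtain N1 where N1: "\<forall>i\<ge>N1. \<forall>j\<ge>N1. L2n m (\<lambda>x. F (r i) x - F (r j) x) < d" using r(2)[OF d] by blast
    obtain N2 where N2: "1 / real (Suc N2) < d\<^sup>2 / 4" using nat_approx_posE[of "d\<^sup>2 / 4"] d by auto
    have small: "1 / real (Suc (r i)) < d\<^sup>2 / 4" if "i \<ge> N2" for i
    proof -
      have "r i \<ge> N2" using that strict_mono_imp_increasing[OF r(1), of i] by linarith
      then have "1 / real (Suc (r i)) \<le> 1 / real (Suc N2)" by (intro divide_left_mono) auto
      then show ?thesis using N2 by linarith
    qed
    show ?thesis
    proof (intro exI[of _ "max N1 N2"] allI impI)
      fix i j assume ij: "max N1 N2 \<le> i" "max N1 N2 \<le> j"
      have "(L2n m (\<lambda>x. F (r i) x - F (r j) x))\<^sup>2 \<le> d\<^sup>2"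
        using N1[rule_format, of i j] ij by (intro power_mono) auto
      then have "R * (L2n m (\<lambda>x. F (r i) x - F (r j) x))\<^sup>2 \<le> R * d\<^sup>2" using R0 by (rule mult_left_mono)
      then have "(L2n l (\<lambda>x. G (r i) x - G (r j) x))\<^sup>2 < d\<^sup>2 * (R + 1)"
        using para[of "r i" "r j"] small[of i] small[of j] ij by (simp add: algebra_simps)
      then have "(L2n l (\<lambda>x. G (r i) x - G (r j) x))\<^sup>2 < e\<^sup>2" using d2 by simp
      then show "L2n l (\<lambda>x. G (r i) x - G (r j) x) < e"
        using e by (intro power_less_imp_less_base[of _ 2 e]) auto
    qed
  qed
  obtain u g f where u: "H01 u g f" "(\<lambda>k. L2n l (\<lambda>x. U (r k) x - u x)) \<longlonglongrightarrow> 0"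
    "(\<lambda>k. L2n l (\<lambda>x. G (r k) x - g x)) \<longlonglongrightarrow> 0" "(\<lambda>k. L2n m (\<lambda>x. F (r k) x - f x)) \<longlonglongrightarrow> 0"
    by (rule H01_complete[where U="\<lambda>k. U (r k)" and G="\<lambda>k. G (r k)" and F="\<lambda>k. F (r k)", OF S(1) CG])
      (assumption, rule that)
  note Lu = H01_L2[OF u(1)]
  have "(\<lambda>k. ip m (F (r k)) (F (r k))) \<longlonglongrightarrow> ip m f f"
    by (rule tendsto_ip[OF LS(3) Lu(3) LS(3) Lu(3) u(4) u(4)])
  then have f1: "ip m f f = 1" unfolding S(3) by (simp add: LIMSEQ_const_iff)
  have pf: "perp I E f"
    unfolding perp_def
  proof
    fix i assume i: "i \<in> I"
    then have LE: "L2 m (E i)" using E eigenD(6) by (auto simp: eigen_system_def)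
    have "(\<lambda>k. ip m (F (r k)) (E i)) \<longlonglongrightarrow> ip m f (E i)"
      by (rule tendsto_ip[OF LS(3) Lu(3) LE LE u(4)]) simp
    moreover have "ip m (F (r k)) (E i) = 0" for k using S(2) i by (simp add: perp_def)
    ultimately show "ip m f (E i) = 0" by (simp add: LIMSEQ_const_iff)
  qed
  have "(\<lambda>k. ip l (G (r k)) (G (r k))) \<longlonglongrightarrow> ip l g g"
    by (rule tendsto_ip[OF LS(2) Lu(2) LS(2) Lu(2) u(3) u(3)])
  moreover have "(\<lambda>k. R + 1 / real (Suc (r k))) \<longlonglongrightarrow> R + 0"
    using LIMSEQ_subseq_LIMSEQ[OF LIMSEQ_inverse_real_of_nat r(1)]
    by (intro tendsto_intros) (simp add: inverse_eq_divide o_def)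
  ultimately have "ip l g g \<le> R + 0"
    by (rule LIMSEQ_le) (use S(4) less_imp_le in blast)
  moreover have "R * ip m f f \<le> ip l g g" using bound u(1) pf by (simp add: spectral_bound_def)
  ultimately have eq: "ip l g g = R * ip m f f" using f1 by simp
  have nz: "L2n m f \<noteq> 0" using f1 by (simp add: L2n_def)
  show ?thesis
    by (rule that[OF RT minimum_is_eigenfunction[OF E u(1) pf eq bound nz] pf f1 bound])
qed

end

section \<open>Strong maximum principle\<close>

lemma integral_leb_eq_lborel:
  fixes k :: "'a::euclidean_space \<Rightarrow> real"
  assumes k: "k \<in> borel_measurable borel" and \<Omega>: "open \<Omega>" and 0: "\<And>x. x \<notin> \<Omega> \<Longrightarrow> k x = 0"
  shows "(LINT x|leb \<Omega>. k x) = (LINT x|lborel. k x)"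
proof -
  have kl: "k \<in> borel_measurable lebesgue"
    by (rule measurable_completion) (use k in simp)
  have "\<Omega> \<in> sets lebesgue" using \<Omega> by auto
  then have "(LINT x|leb \<Omega>. k x) = (LINT x|lebesgue. indicator \<Omega> x *\<^sub>R k x)"
    unfolding restr_def by (rule integral_density_indicator[OF kl])
  also have "\<dots> = (LINT x|lebesgue. k x)"
    using 0 by (intro Bochner_Integration.integral_cong) (auto simp: indicator_def)
  also have "\<dots> = (LINT x|lborel. k x)" using k by (intro integral_completion) simp
  finally show ?thesis .
qed

lemma integral_lborel_affine:
  fixes k :: "'a::euclidean_space \<Rightarrow> real"
  assumes k: "k \<in> borel_measurable borel" and t: "t > 0"
  shows "(LINT y|lborel. k y) = t ^ DIM('a) * (LINT z|lborel. k (x + t *\<^sub>R z))"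
proof -
  have "(LINT y|lborel. k y) = (LINT y|density (distr lborel borel (\<lambda>z. x + t *\<^sub>R z)) (\<lambda>_. ennreal (\<bar>t\<bar> ^ DIM('a))). k y)"
    using t by (subst lborel_affine[of t x]) auto
  also have "\<dots> = (LINT y|distr lborel borel (\<lambda>z. x + t *\<^sub>R z). \<bar>t\<bar> ^ DIM('a) * k y)"
    using k by (subst integral_density) auto
  also have "\<dots> = (LINT z|lborel. \<bar>t\<bar> ^ DIM('a) * k (x + t *\<^sub>R z))"
    using k by (subst integral_distr) auto
  finally show ?thesis using t by simp
qed

text \<open>\<open>z ker z\<close> is minus the gradient of the bump \<open>ebump (1 - |z|\<^sup>2)\<close>, so the \<open>t\<close>-derivative of the
  average of \<open>\<phi> (x + t z)\<close> against \<open>ker\<close> is \<open>\<integral> \<nabla>\<phi> \<bullet> \<nabla>bump\<close>: it has a sign for supersolutions.\<close>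

definition ker :: "'a::euclidean_space \<Rightarrow> real" where
  "ker z = 2 * ebump' (1 - (norm z)\<^sup>2)"

definition ker_bump :: "'a::euclidean_space \<Rightarrow> real \<Rightarrow> 'a \<Rightarrow> real" where
  "ker_bump x t y = ebump (1 - (norm (y - x))\<^sup>2 * (1 / t\<^sup>2))"

lemma ker_nonneg [simp]: "0 \<le> ker z"
  by (simp add: ker_def ebump'_eq)

lemma ker_pos: "norm z < 1 \<Longrightarrow> 0 < ker z"
proof -
  assume "norm z < 1"
  then have "(norm z)\<^sup>2 < 1" by (simp add: power_less_one_iff)
  then show ?thesis by (simp add: ker_def ebump'_eq)
qed

lemma ker_eq_0: "norm z \<ge> 1 \<Longrightarrow> ker z = 0"
  by (simp add: ker_def ebump'_eq) (metis not_less one_le_power)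

lemma continuous_on_ker [continuous_intros]:
  "continuous_on S f \<Longrightarrow> continuous_on S (\<lambda>x. ker (f x))"
  unfolding ker_def by (intro continuous_intros)

lemma borel_measurable_ker [measurable]: "ker \<in> borel_measurable borel"
  by (intro borel_measurable_continuous_onI continuous_intros)

text \<open>Up to half the radius \<open>1 - (norm z)\<^sup>2\<close> lies between 3/4 and 1, so the
  exponential in \<open>ebump'\<close> is at least \<open>exp (- 4 / 3)\<close> and the square
  factor at least 1.\<close>

lemma ker_lower: "norm z \<le> 1 / 2 \<Longrightarrow> 2 * exp (- 4 / 3) \<le> ker z"
proof -
  assume "norm z \<le> 1 / 2"
  then have "(norm z)\<^sup>2 \<le> (1 / 2)\<^sup>2" by (intro power_mono) auto
  then have s: "3 / 4 \<le> 1 - (norm z)\<^sup>2" "1 - (norm z)\<^sup>2 \<le> 1" by (auto simp: power2_eq_square)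
  define s where "s = 1 - (norm z)\<^sup>2"
  have "1 / s \<le> 4 / 3" "1 \<le> 1 / s" using s by (auto simp: s_def field_simps)
  then have "1 \<le> (1 / s)\<^sup>2" "exp (- 4 / 3) \<le> exp (- 1 / s)" by (auto simp: one_le_power)
  then have "1 * exp (- 4 / 3) \<le> (1 / s)\<^sup>2 * exp (- 1 / s)" by (intro mult_mono) auto
  then show ?thesis using s by (simp add: ker_def ebump'_eq s_def)
qed

lemma ker_bounded: obtains A where "A > 0" "\<And>z::'a::euclidean_space. ker z \<le> A"
proof -
  have "compact (ker ` cball (0::'a) 1)"
    by (intro compact_continuous_image continuous_intros) auto
  then obtain A where "\<forall>y\<in>ker ` cball (0::'a) 1. norm y \<le> A"
    using compact_imp_bounded bounded_iff by blast
  then have A: "\<And>z::'a. z \<in> cball 0 1 \<Longrightarrow> norm (ker z) \<le> A" by blast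
  have "ker z \<le> max A 1" for z :: 'a
    using A[of z] ker_eq_0[of z] by (cases "norm z \<le> 1") (auto simp: le_max_iff_disj)
  then show ?thesis by (intro that[of "max A 1"]) auto
qed

lemma smooth_fn_ker_bump: "smooth_fn (ker_bump x t)"
  unfolding ker_bump_def[abs_def]
  by (intro smooth_fn_comp[OF smooth_fn_ebump] smooth_fn_diff smooth_fn_const smooth_fn_mult smooth_fn_norm_sq)

lemma grad_ker_bump:
  assumes "t > 0"
  shows "grad (ker_bump x t) y = - (1 / t\<^sup>2 * ker ((1 / t) *\<^sub>R (y - x))) *\<^sub>R (y - x)"
proof (rule grad_eqI)
  have n: "((\<lambda>y. 1 - (norm (y - x))\<^sup>2 * q) has_derivative (\<lambda>h. - (2 * ((y - x) \<bullet> h) * q))) (at y)" for q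
    unfolding power2_norm_eq_inner
    by (auto intro!: derivative_eq_intros simp: fun_eq_iff inner_commute)
  have e: "(ebump has_derivative (\<lambda>s. s * ebump' r)) (at r)" for r
    using ebump_deriv[of r] unfolding has_field_derivative_def
    by (rule has_derivative_eq_rhs) (simp add: fun_eq_iff)
  have k: "(norm ((1 / t) *\<^sub>R (y - x)))\<^sup>2 = (norm (y - x))\<^sup>2 * (1 / t\<^sup>2)"
    unfolding norm_scaleR power_mult_distrib by (simp add: power_divide)
  have "(ker_bump x t has_derivative (\<lambda>h. - (2 * ((y - x) \<bullet> h) * (1 / t\<^sup>2)) *
      ebump' (1 - (norm (y - x))\<^sup>2 * (1 / t\<^sup>2)))) (at y)"
    unfolding ker_bump_def[abs_def] by (rule has_derivative_compose[OF n e])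
  then show "(ker_bump x t has_derivative (\<lambda>h. (- (1 / t\<^sup>2 * ker ((1 / t) *\<^sub>R (y - x))) *\<^sub>R (y - x)) \<bullet> h)) (at y)"
    by (rule has_derivative_eq_rhs) (simp only: ker_def k fun_eq_iff inner_scaleR_left, simp add: mult_ac)
qed

lemma ker_bump_nonneg: "0 \<le> ker_bump x t y"
  by (simp add: ker_bump_def ebump_nonneg)

lemma test_fn_ker_bump:
  assumes t: "t > 0" and sub: "cball x t \<subseteq> \<Omega>"
  shows "test_fn \<Omega> (ker_bump x t)"
proof -
  have "{y. ker_bump x t y \<noteq> 0} \<subseteq> cball x t"
  proof
    fix y assume "y \<in> {y. ker_bump x t y \<noteq> 0}"
    then have "(norm (y - x))\<^sup>2 * (1 / t\<^sup>2) < 1" by (simp add: ker_bump_def ebump_eq_0)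
    then have "(norm (y - x))\<^sup>2 < t\<^sup>2" using t by (simp add: field_simps)
    then have "norm (y - x) < t" using t by (simp add: power_less_imp_less_base)
    then show "y \<in> cball x t" by (simp add: dist_norm norm_minus_commute)
  qed
  then have cl: "closure {y. ker_bump x t y \<noteq> 0} \<subseteq> cball x t" by (intro closure_minimal) auto
  then have "compact (closure {y. ker_bump x t y \<noteq> 0})"
    by (meson bounded_cball bounded_subset closed_closure compact_eq_bounded_closed)
  then show ?thesis using cl sub smooth_fn_ker_bump by (auto simp: test_fn_def)
qed

lemma grad_ker_bump_bound:
  assumes A: "\<And>z::'a::euclidean_space. ker z \<le> A" and t: "t > 0"
  shows "norm (grad (ker_bump x t) (y::'a)) \<le> A / t"
proof (cases "norm ((1 / t) *\<^sub>R (y - x)) \<ge> 1")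
  case True
  have "0 \<le> A" using A[of 0] ker_nonneg[of 0] order_trans by blast
  then show ?thesis using ker_eq_0[OF True] t by (simp add: grad_ker_bump)
next
  case False
  then have n: "norm (y - x) \<le> t" unfolding norm_scaleR using t by (simp add: field_simps)
  have "norm (grad (ker_bump x t) y) = 1 / t\<^sup>2 * (ker ((1 / t) *\<^sub>R (y - x)) * norm (y - x))"
    unfolding grad_ker_bump[OF t] norm_scaleR by (simp add: abs_mult)
  also have "\<dots> \<le> 1 / t\<^sup>2 * (A * t)"
    using A n order_trans[OF ker_nonneg A] by (intro mult_left_mono mult_mono) auto
  also have "\<dots> = A / t" using t by (simp add: power2_eq_square)
  finally show ?thesis .
qed

lemma norm_in_cbox_One: "norm (z::'a::euclidean_space) \<le> 1 \<Longrightarrow> z \<in> cbox (- One) One"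
proof -
  assume n: "norm z \<le> 1"
  have "- 1 \<le> z \<bullet> b \<and> z \<bullet> b \<le> 1" if "b \<in> Basis" for b
    using Basis_le_norm[OF that, of z] n by (auto simp: abs_le_iff)
  moreover have "One \<bullet> b = 1" if "b \<in> Basis" for b :: 'a
    using that by (simp add: inner_sum_left inner_Basis)
  ultimately show ?thesis by (auto simp: mem_box)
qed

lemma ker_integral:
  fixes h :: "'a::euclidean_space \<Rightarrow> real"
  assumes h: "continuous_on UNIV h"
  shows "integrable lborel (\<lambda>z. h z * ker z)"
    "integral (cbox (- One) One) (\<lambda>z. h z * ker z) = (LINT z|lborel. h z * ker z)"
proof -
  let ?Q = "cbox (- One) One :: 'a set"
  have z: "h z * ker z = 0" if "z \<notin> ?Q" for z
    using that norm_in_cbox_One[of z] ker_eq_0[of z] by (cases "norm z \<le> 1") auto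
  have c: "continuous_on ?Q (\<lambda>z. h z * ker z)"
    using h by (intro continuous_intros) (auto intro: continuous_on_subset)
  have e: "(\<lambda>z. indicator ?Q z *\<^sub>R (h z * ker z)) = (\<lambda>z. h z * ker z)"
    using z by (auto simp: indicator_def fun_eq_iff)
  have e': "(\<lambda>z. if z \<in> ?Q then h z * ker z else 0) = (\<lambda>z. h z * ker z)"
    using z by auto
  show i: "integrable lborel (\<lambda>z. h z * ker z)"
    using borel_integrable_compact[OF compact_cbox c] unfolding e .
  show "integral ?Q (\<lambda>z. h z * ker z) = (LINT z|lborel. h z * ker z)"
    using integral_lborel[OF i] integral_restrict_UNIV[of ?Q "\<lambda>z. h z * ker z"] unfolding e' by simp
qed

text \<open>A radially weighted mean of \<open>w\<close> at scale \<open>t\<close>, not normalised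
  by the mass of the kernel. As an inner product it is defined for classes and continuous in
  \<open>L2\<close>.\<close>

definition ker_mean :: "'a::euclidean_space set \<Rightarrow> ('a \<Rightarrow> real) \<Rightarrow> 'a \<Rightarrow> real \<Rightarrow> real" where
  "ker_mean \<Omega> w x t = ip (leb \<Omega>) w (\<lambda>y. ker ((1 / t) *\<^sub>R (y - x))) / t ^ DIM('a)"

lemma ker_mean_test:
  fixes x :: "'a::euclidean_space"
  assumes \<phi>: "test_fn \<Omega> \<phi>" and \<Omega>: "open \<Omega>" and t: "t > 0"
  shows "ker_mean \<Omega> \<phi> x t = (LINT z|lborel. \<phi> (x + t *\<^sub>R z) * ker z)"
proof -
  note [measurable] = test_fn_measurable(1)[OF \<phi>]
  have "ip (leb \<Omega>) \<phi> (\<lambda>y. ker ((1 / t) *\<^sub>R (y - x))) = (LINT y|lborel. \<phi> y * ker ((1 / t) *\<^sub>R (y - x)))"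
    unfolding ip_def using integral_leb_eq_lborel[of "\<lambda>y. \<phi> y * ker ((1 / t) *\<^sub>R (y - x))" \<Omega>]
      \<Omega> test_fnD(4)[OF \<phi>] by simp
  also have "\<dots> = t ^ DIM('a) * (LINT z|lborel. \<phi> (x + t *\<^sub>R z) * ker z)"
    using t by (subst integral_lborel_affine[OF _ t, of _ x]) auto
  finally show ?thesis using t by (simp add: ker_mean_def)
qed

text \<open>Mean value theorem in the scale: the derivative times \<open>t ^ (DIM('a) - 1)\<close>
  is minus the energy pairing of \<open>\<phi>\<close> with the bump at scale \<open>t\<close>. The
  defect \<open>\<delta>\<close> is there because test functions approximating a supersolution are
  supersolutions only approximately.\<close>

lemma ker_mean_increment:
  fixes x :: "'a::euclidean_space"
  assumes \<phi>: "test_fn \<Omega> \<phi>" and \<Omega>: "open \<Omega>" and \<epsilon>: "0 < \<epsilon>" "\<epsilon> < r"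
    and \<delta>: "0 \<le> \<delta>" "\<And>t. \<epsilon> \<le> t \<Longrightarrow> t \<le> r \<Longrightarrow> - \<delta> \<le> ip (leb \<Omega>) (grad \<phi>) (grad (ker_bump x t))"
  shows "ker_mean \<Omega> \<phi> x r \<le> ker_mean \<Omega> \<phi> x \<epsilon> + (r - \<epsilon>) * \<delta> / \<epsilon> ^ (DIM('a) - 1)"
proof -
  let ?Q = "cbox (- One) One :: 'a set"
  note sm = test_fnD(1)[OF \<phi>]
  note c\<phi> = smooth_fn_continuous[OF sm, of UNIV] and cg = continuous_on_grad[OF sm, of UNIV]
  note [measurable] = test_fn_measurable[OF \<phi>]
  define F where "F t = integral ?Q (\<lambda>z. \<phi> (x + t *\<^sub>R z) * ker z)" for t
  define F' where "F' t = integral ?Q (\<lambda>z. (grad \<phi> (x + t *\<^sub>R z) \<bullet> z) * ker z)" for t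
  have FN: "ker_mean \<Omega> \<phi> x t = F t" if "t > 0" for t
    unfolding ker_mean_test[OF \<phi> \<Omega> that] F_def
    by (rule ker_integral(2)[symmetric]) (intro continuous_on_compose2[OF c\<phi>] continuous_intros, auto)
  \<comment> \<open>The fixed cube contains the unit ball, off which \<open>ker\<close> vanishes, so
    differentiation under the integral takes place over a compact box independent of
    \<open>t\<close>.\<close>
  have der: "(F has_field_derivative F' t) (at t within {\<epsilon>..r})" if "t \<in> {\<epsilon>..r}" for t
    unfolding F_def F'_def
  proof (rule leibniz_rule_field_derivative)
    fix t z
    have "((\<lambda>t. x + t *\<^sub>R z) has_derivative (\<lambda>s. s *\<^sub>R z)) (at t within {\<epsilon>..r})"
      by (auto intro!: derivative_eq_intros)
    from has_derivative_compose[OF this smooth_fn_has_grad[OF sm]]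
    have "((\<lambda>t. \<phi> (x + t *\<^sub>R z)) has_field_derivative (grad \<phi> (x + t *\<^sub>R z) \<bullet> z)) (at t within {\<epsilon>..r})"
      unfolding has_field_derivative_def by (rule has_derivative_eq_rhs) (auto simp: fun_eq_iff)
    then show "((\<lambda>t. \<phi> (x + t *\<^sub>R z) * ker z) has_field_derivative (grad \<phi> (x + t *\<^sub>R z) \<bullet> z) * ker z) (at t within {\<epsilon>..r})"
      by (rule DERIV_cmult_right)
  next
    fix t
    show "(\<lambda>z. \<phi> (x + t *\<^sub>R z) * ker z) integrable_on ?Q"
      by (intro integrable_continuous continuous_intros continuous_on_compose2[OF c\<phi>]) auto
  next
    show "continuous_on ({\<epsilon>..r} \<times> ?Q) (\<lambda>(t, z). (grad \<phi> (x + t *\<^sub>R z) \<bullet> z) * ker z)"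
      unfolding split_beta by (intro continuous_intros continuous_on_compose2[OF cg]) auto
  qed (use that in auto)
  have F'le: "F' t \<le> \<delta> / \<epsilon> ^ (DIM('a) - 1)" if t: "t \<in> {\<epsilon>..r}" for t
  proof -
    have t0: "t > 0" using t \<epsilon> by simp
    have d: "DIM('a) = Suc (DIM('a) - 1)" using DIM_positive[where 'a='a] by simp
    define k where "k y = grad \<phi> y \<bullet> grad (ker_bump x t) y" for y
    have km: "k \<in> borel_measurable borel"
      unfolding k_def using smooth_fn_ker_bump[of x t]
      by (intro borel_measurable_continuous_onI continuous_intros cg continuous_on_grad)
    have "ip (leb \<Omega>) (grad \<phi>) (grad (ker_bump x t)) = (LINT y|lborel. k y)"
      unfolding ip_def k_def[symmetric]
      by (rule integral_leb_eq_lborel[OF km \<Omega>]) (simp add: k_def test_fnD(5)[OF \<phi>])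
    also have "\<dots> = t ^ DIM('a) * (LINT z|lborel. k (x + t *\<^sub>R z))"
      by (rule integral_lborel_affine[OF km t0])
    also have "(\<lambda>z. k (x + t *\<^sub>R z)) = (\<lambda>z. - (1 / t) * ((grad \<phi> (x + t *\<^sub>R z) \<bullet> z) * ker z))"
      unfolding k_def grad_ker_bump[OF t0] using t0 by (auto simp: fun_eq_iff power2_eq_square)
    also have "(LINT z|lborel. - (1 / t) * ((grad \<phi> (x + t *\<^sub>R z) \<bullet> z) * ker z)) = - (1 / t) * F' t"
      unfolding F'_def by (subst ker_integral(2))
        (auto intro!: continuous_intros continuous_on_compose2[OF cg])
    also have "t ^ DIM('a) * (- (1 / t) * F' t) = - (t ^ (DIM('a) - 1) * F' t)"
    proof -
      have "t ^ DIM('a) = t ^ (DIM('a) - 1) * t" by (metis d power_Suc2)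
      then show ?thesis using t0 by simp
    qed
    finally have "t ^ (DIM('a) - 1) * F' t \<le> \<delta>" using \<delta>(2)[of t] t by simp
    then have "F' t \<le> \<delta> / t ^ (DIM('a) - 1)" using t0 by (simp add: field_simps)
    also have "\<dots> \<le> \<delta> / \<epsilon> ^ (DIM('a) - 1)"
      using \<delta>(1) t \<epsilon> t0 by (intro divide_left_mono power_mono mult_pos_pos zero_less_power) auto
    finally show ?thesis .
  qed
  have "\<exists>\<xi>\<in>{\<epsilon><..<r}. F r - F \<epsilon> = F' \<xi> * (r - \<epsilon>)"
    by (rule mvt_simple[OF \<epsilon>(2)]) (use der in \<open>simp add: has_field_derivative_def\<close>)
  then obtain \<xi> where \<xi>: "\<xi> \<in> {\<epsilon><..<r}" "F r - F \<epsilon> = F' \<xi> * (r - \<epsilon>)" by blast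
  have "F' \<xi> * (r - \<epsilon>) \<le> \<delta> / \<epsilon> ^ (DIM('a) - 1) * (r - \<epsilon>)"
    using F'le[of \<xi>] \<xi>(1) by (intro mult_right_mono) auto
  then show ?thesis using \<xi>(2) FN[of r] FN[of \<epsilon>] \<epsilon> by (simp add: mult.commute)
qed

context dirichlet_space
begin

text \<open>Superharmonicity in the sense of distributions, expressed through the weak
  gradient.\<close>

definition supersolution :: "('a \<Rightarrow> 'a) \<Rightarrow> bool" where
  "supersolution g \<longleftrightarrow> (\<forall>\<phi>. test_fn \<Omega> \<phi> \<longrightarrow> (\<forall>x. 0 \<le> \<phi> x) \<longrightarrow> 0 \<le> ip l g (grad \<phi>))"

lemma ker_L2: "L2 l (\<lambda>y. ker ((1 / t) *\<^sub>R (y - x)))"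
proof -
  obtain A where A: "A > 0" "\<And>z::'a. ker z \<le> A" by (rule ker_bounded) (rule that)
  show ?thesis
    by (rule l.L2_bounded[of _ A]) (use A in \<open>auto intro!: measurable_completion\<close>)
qed

text \<open>The pairing of a supersolution with a bump is nonnegative, and Cauchy-Schwarz bounds the
  error of replacing its gradient by that of \<open>\<phi>\<close>. The constant depends on neither
  \<open>\<phi>\<close> nor \<open>x\<close>; uniformity in \<open>x\<close> is what the almost
  everywhere argument uses.\<close>

lemma ker_mean_supersolution_approx:
  assumes H: "H01 w g f" and S: "supersolution g" and \<epsilon>: "0 < \<epsilon>" "\<epsilon> < r"
  obtains C where "\<And>\<phi> x. test_fn \<Omega> \<phi> \<Longrightarrow> cball x r \<subseteq> \<Omega> \<Longrightarrow>
    ker_mean \<Omega> \<phi> x r \<le> ker_mean \<Omega> \<phi> x \<epsilon> + C * L2n l (\<lambda>y. grad \<phi> y - g y)"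
proof -
  obtain A where A: "A > 0" "\<And>z::'a. ker z \<le> A" by (rule ker_bounded) (rule that)
  note L = H01_L2[OF H]
  define s where "s = A / \<epsilon> * sqrt (measure l UNIV)"
  have s0: "s \<ge> 0" using A \<epsilon> by (simp add: s_def)
  show ?thesis
  proof (rule that[of "(r - \<epsilon>) * s / \<epsilon> ^ (DIM('a) - 1)"])
    fix \<phi> x assume \<phi>: "test_fn \<Omega> \<phi>" and x: "cball x r \<subseteq> \<Omega>"
    define e where "e = L2n l (\<lambda>y. grad \<phi> y - g y)"
    have "- (e * s) \<le> ip l (grad \<phi>) (grad (ker_bump x t))" if t: "\<epsilon> \<le> t" "t \<le> r" for t
    proof -
      have t0: "t > 0" using t \<epsilon> by simp
      have b: "test_fn \<Omega> (ker_bump x t)"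
        by (rule test_fn_ker_bump[OF t0]) (use x t in auto)
      note Lb = test_L2[OF b] and L\<phi> = test_L2[OF \<phi>]
      have "norm (grad (ker_bump x t) y) \<le> A / \<epsilon>" for y
        using grad_ker_bump_bound[OF A(2) t0, of x y] A(1) t \<epsilon> t0
          divide_left_mono[of \<epsilon> t A] by auto
      then have "L2n l (grad (ker_bump x t)) \<le> s"
        using l.L2_bounded(2)[OF L2_measurable[OF Lb(2)], of "A / \<epsilon>"] by (simp add: s_def)
      then have "\<bar>ip l (\<lambda>y. grad \<phi> y - g y) (grad (ker_bump x t))\<bar> \<le> e * s"
        using ip_Cauchy_Schwarz[OF L2_diff[OF L\<phi>(2) L(2)] Lb(2)] mult_left_mono[of "L2n l (grad (ker_bump x t))" s e]
        by (simp add: e_def)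
      moreover have "ip l (grad \<phi>) (grad (ker_bump x t)) =
          ip l (\<lambda>y. grad \<phi> y - g y) (grad (ker_bump x t)) + ip l g (grad (ker_bump x t))"
        using L Lb L\<phi> by (simp add: ip_diff_left)
      moreover have "0 \<le> ip l g (grad (ker_bump x t))"
        using S b ker_bump_nonneg by (auto simp: supersolution_def)
      ultimately show ?thesis by linarith
    qed
    from ker_mean_increment[OF \<phi> open_dom \<epsilon> _ this]
    show "ker_mean \<Omega> \<phi> x r \<le> ker_mean \<Omega> \<phi> x \<epsilon> + (r - \<epsilon>) * s / \<epsilon> ^ (DIM('a) - 1) * L2n l (\<lambda>y. grad \<phi> y - g y)"
      using s0 by (simp add: e_def mult_ac)
  qed
qed

lemma ker_mean_tendsto:
  assumes "\<And>k. L2 l (\<phi> (k::nat))" "L2 l w" "(\<lambda>k. L2n l (\<lambda>x. \<phi> k x - w x)) \<longlonglongrightarrow> 0"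
  shows "(\<lambda>k. ker_mean \<Omega> (\<phi> k) x t) \<longlonglongrightarrow> ker_mean \<Omega> w x t"
proof -
  have "(\<lambda>k. ip l (\<phi> k) (\<lambda>y. ker ((1 / t) *\<^sub>R (y - x)))) \<longlonglongrightarrow> ip l w (\<lambda>y. ker ((1 / t) *\<^sub>R (y - x)))"
    by (rule tendsto_ip[OF assms(1,2) ker_L2 ker_L2 assms(3)]) simp
  then show ?thesis unfolding ker_mean_def divide_inverse by (intro tendsto_intros)
qed

text \<open>The mean value property of superharmonic functions, obtained by letting the
  approximation error tend to zero.\<close>

lemma ker_mean_mono:
  assumes H: "H01 w g f" and S: "supersolution g" and \<epsilon>: "0 < \<epsilon>" "\<epsilon> < r" and x: "cball x r \<subseteq> \<Omega>"
  shows "ker_mean \<Omega> w x r \<le> ker_mean \<Omega> w x \<epsilon>"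
proof -
  note L = H01_L2[OF H]
  obtain \<phi> where \<phi>: "\<And>k. test_fn \<Omega> (\<phi> (k::nat))"
    "(\<lambda>k. L2n l (\<lambda>x. \<phi> k x - w x)) \<longlonglongrightarrow> 0"
    "(\<lambda>k. L2n l (\<lambda>x. grad (\<phi> k) x - g x)) \<longlonglongrightarrow> 0"
    "(\<lambda>k. L2n m (\<lambda>x. \<phi> k x - f x)) \<longlonglongrightarrow> 0"
    by (rule H01_approx[OF H]) (rule that)
  obtain C where C: "\<And>\<phi> x. test_fn \<Omega> \<phi> \<Longrightarrow> cball x r \<subseteq> \<Omega> \<Longrightarrow>
    ker_mean \<Omega> \<phi> x r \<le> ker_mean \<Omega> \<phi> x \<epsilon> + C * L2n l (\<lambda>y. grad \<phi> y - g y)"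
    by (rule ker_mean_supersolution_approx[OF H S \<epsilon>]) (rule that)
  note lim = ker_mean_tendsto[OF test_L2(1)[OF \<phi>(1)] L(1) \<phi>(2)]
  have "(\<lambda>k. ker_mean \<Omega> (\<phi> k) x \<epsilon> + C * L2n l (\<lambda>y. grad (\<phi> k) y - g y)) \<longlonglongrightarrow> ker_mean \<Omega> w x \<epsilon> + C * 0"
    by (intro tendsto_intros lim \<phi>(3))
  then have "(\<lambda>k. ker_mean \<Omega> (\<phi> k) x \<epsilon> + C * L2n l (\<lambda>y. grad (\<phi> k) y - g y)) \<longlonglongrightarrow> ker_mean \<Omega> w x \<epsilon>"
    by simp
  then show ?thesis
    by (rule LIMSEQ_le[OF lim]) (use C[OF \<phi>(1) x] in blast)
qed

definition ker_mass :: real where "ker_mass = (LINT z|lborel. ker (z::'a))"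

lemma ker_integrable: "integrable lborel (ker :: 'a \<Rightarrow> real)"
  using ker_integral(1)[of "\<lambda>_. 1"] by simp

lemma ker_mass_nonneg: "0 \<le> ker_mass"
  unfolding ker_mass_def by (intro integral_nonneg_AE) auto

lemma ker_scaled_mass:
  assumes t: "t > 0" and x: "cball x t \<subseteq> \<Omega>"
  shows "(LINT y|l. ker ((1 / t) *\<^sub>R (y - x))) = t ^ DIM('a) * ker_mass"
proof -
  have "(LINT y|l. ker ((1 / t) *\<^sub>R (y - x))) = (LINT y|lborel. ker ((1 / t) *\<^sub>R (y - x)))"
  proof (rule integral_leb_eq_lborel[OF _ open_dom])
    fix y assume "y \<notin> \<Omega>"
    then have "y \<notin> cball x t" using x by auto
    then have "t < norm (y - x)" by (simp add: dist_norm norm_minus_commute)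
    then have "1 \<le> norm ((1 / t) *\<^sub>R (y - x))" unfolding norm_scaleR using t by (simp add: field_simps)
    then show "ker ((1 / t) *\<^sub>R (y - x)) = 0" by (rule ker_eq_0)
  qed measurable
  also have "\<dots> = t ^ DIM('a) * ker_mass"
    unfolding ker_mass_def using t by (subst integral_lborel_affine[OF _ t, of _ x]) auto
  finally show ?thesis .
qed

text \<open>At a zero the means at small scales are small by continuity, and by
  \<open>ker_mean_mono\<close> the mean at a fixed scale is smaller still, hence zero. Positivity of
  the kernel makes \<open>w\<close> vanish on a ball, so the zero set is open, and connectedness
  finishes.\<close>

lemma strong_maximum_continuous:
  assumes H: "H01 w g f" and S: "supersolution g" and c: "continuous_on \<Omega> w"
    and nn: "\<And>x. x \<in> \<Omega> \<Longrightarrow> 0 \<le> w x" and z: "x0 \<in> \<Omega>" "w x0 = 0"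
  shows "\<forall>x\<in>\<Omega>. w x = 0"
proof -
  note L = H01_L2[OF H]
  have loc: "\<exists>r>0. ball x r \<subseteq> \<Omega> \<and> (\<forall>y\<in>ball x r. w y = 0)" if x: "x \<in> \<Omega>" "w x = 0" for x
  proof -
    obtain r where r: "r > 0" "cball x r \<subseteq> \<Omega>" using open_dom x(1) open_contains_cball by blast
    have up: "ker_mean \<Omega> w x r \<le> e * ker_mass" if e: "e > 0" for e
    proof -
      obtain d where d: "d > 0" "\<And>y. y \<in> \<Omega> \<Longrightarrow> dist y x < d \<Longrightarrow> dist (w y) (w x) < e"
        using c x(1) e unfolding continuous_on_iff by blast
      define \<epsilon> where "\<epsilon> = min (d / 2) (r / 2)"
      have \<epsilon>: "0 < \<epsilon>" "\<epsilon> < r" "\<epsilon> < d" using d(1) r(1) by (auto simp: \<epsilon>_def)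
      have sub: "cball x \<epsilon> \<subseteq> \<Omega>" using r(2) \<epsilon>(2) by (meson order.trans less_imp_le subset_cball)
      have i1: "integrable l (\<lambda>y. w y * ker ((1 / \<epsilon>) *\<^sub>R (y - x)))"
        using L2_integrable_ip[OF L(1) ker_L2] by simp
      have "L2 l (\<lambda>y. 1::real)" by (simp add: L2_def)
      from L2_integrable_ip[OF L2_cmult[OF this, of e] ker_L2]
      have i2: "integrable l (\<lambda>y. e * ker ((1 / \<epsilon>) *\<^sub>R (y - x)))" by simp
      have "ip l w (\<lambda>y. ker ((1 / \<epsilon>) *\<^sub>R (y - x))) \<le> (LINT y|l. e * ker ((1 / \<epsilon>) *\<^sub>R (y - x)))"
        unfolding ip_def inner_real_def
      proof (rule integral_mono_AE[OF i1 i2])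
        have "w y * ker ((1 / \<epsilon>) *\<^sub>R (y - x)) \<le> e * ker ((1 / \<epsilon>) *\<^sub>R (y - x))" if "y \<in> \<Omega>" for y
        proof (cases "dist y x < d")
          case True
          then show ?thesis using d(2)[OF that True] x(2) by (intro mult_right_mono) (auto simp: dist_real_def)
        next
          case False
          then have "1 \<le> norm ((1 / \<epsilon>) *\<^sub>R (y - x))"
            unfolding norm_scaleR using \<epsilon> by (simp add: dist_norm field_simps)
          then show ?thesis by (simp add: ker_eq_0)
        qed
        then show "AE y in l. w y * ker ((1 / \<epsilon>) *\<^sub>R (y - x)) \<le> e * ker ((1 / \<epsilon>) *\<^sub>R (y - x))"
          by (simp add: AE_restr[OF dom_sets(1)])
      qed
      also have "\<dots> = e * (\<epsilon> ^ DIM('a) * ker_mass)" using ker_scaled_mass[OF \<epsilon>(1) sub] by simp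
      finally have "ker_mean \<Omega> w x \<epsilon> \<le> e * ker_mass"
        using \<epsilon>(1) by (simp add: ker_mean_def field_simps)
      then show ?thesis using ker_mean_mono[OF H S \<epsilon>(1,2) r(2)] by linarith
    qed
    have "ker_mean \<Omega> w x r \<le> 0"
    proof (rule field_le_epsilon)
      fix e :: real assume e: "e > 0"
      have "ker_mean \<Omega> w x r \<le> e / (ker_mass + 1) * ker_mass"
        using ker_mass_nonneg e by (intro up) auto
      also have "\<dots> \<le> e" using ker_mass_nonneg e by (simp add: field_simps)
      finally show "ker_mean \<Omega> w x r \<le> 0 + e" by simp
    qed
    then have le: "ip l w (\<lambda>y. ker ((1 / r) *\<^sub>R (y - x))) \<le> 0"
      using zero_less_power[OF r(1), of "DIM('a)"] by (auto simp: ker_mean_def divide_le_0_iff)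
    have i: "integrable l (\<lambda>y. w y * ker ((1 / r) *\<^sub>R (y - x)))"
      using L2_integrable_ip[OF L(1) ker_L2] by simp
    have nnA: "AE y in l. 0 \<le> w y * ker ((1 / r) *\<^sub>R (y - x))"
      using nn by (simp add: AE_restr[OF dom_sets(1)])
    have "(LINT y|l. w y * ker ((1 / r) *\<^sub>R (y - x))) = 0"
      using le integral_nonneg_AE[OF nnA] by (simp add: ip_def)
    then have "AE y in l. w y * ker ((1 / r) *\<^sub>R (y - x)) = 0"
      using integral_nonneg_eq_0_iff_AE[OF i nnA] by simp
    then have ae: "AE y in lebesgue. y \<in> \<Omega> \<longrightarrow> w y * ker ((1 / r) *\<^sub>R (y - x)) = 0"
      by (simp add: AE_restr[OF dom_sets(1)])
    \<comment> \<open>By continuity a nonzero value would persist on a nonempty open set, which is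
      never negligible.\<close>
    have "w y = 0" if y: "y \<in> ball x r" for y
    proof (rule ccontr)
      assume "w y \<noteq> 0"
      define V where "V = ball x r \<inter> w -` (- {0})"
      have "open V" unfolding V_def
        using r(2) by (intro continuous_open_preimage continuous_on_subset[OF c]) auto
      have yV: "y \<in> V" using y \<open>w y \<noteq> 0\<close> by (simp add: V_def)
      have "AE y in lebesgue. y \<notin> V"
        using ae
      proof eventually_elim
        case (elim y)
        show ?case
        proof
          assume y: "y \<in> V"
          then have "norm (y - x) < r" by (simp add: V_def dist_norm norm_minus_commute)
          then have "norm ((1 / r) *\<^sub>R (y - x)) < 1" unfolding norm_scaleR using r(1) by (simp add: field_simps)
          then have "ker ((1 / r) *\<^sub>R (y - x)) > 0" by (rule ker_pos)
          moreover have "y \<in> \<Omega>" using y r(2) by (auto simp: V_def)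
          ultimately show False using elim y by (auto simp: V_def)
        qed
      qed
      then have "V \<in> null_sets lebesgue" using \<open>open V\<close> by (subst (asm) AE_iff_null_sets[symmetric]) auto
      then have "negligible V" by (simp add: negligible_iff_null_sets)
      then show False using open_not_negligible[OF \<open>open V\<close>] yV by auto
    qed
    then show ?thesis using r by (intro exI[of _ r]) (auto dest: subsetD[OF r(2)])
  qed
  define Z where "Z = {x\<in>\<Omega>. w x = 0}"
  have "open Z"
    unfolding open_contains_ball
  proof
    fix x assume "x \<in> Z"
    then obtain r where "r > 0" "ball x r \<subseteq> \<Omega>" "\<forall>y\<in>ball x r. w y = 0"
      using loc[of x] unfolding Z_def by blast
    then show "\<exists>e>0. ball x e \<subseteq> Z" by (intro exI[of _ r]) (auto simp: Z_def)
  qed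
  moreover have "open (\<Omega> - Z)"
  proof -
    have "\<Omega> - Z = \<Omega> \<inter> w -` (- {0})" by (auto simp: Z_def)
    then show ?thesis
      using continuous_open_preimage[OF c open_dom open_Compl[OF closed_singleton]] by simp
  qed
  ultimately have "\<Omega> - Z = {}"
    using connected_dom z unfolding connected_def Z_def by blast
  then show ?thesis by (auto simp: Z_def)
qed

end

section \<open>Strong maximum principle for classes\<close>

lemma nn_integral_leb_le_lborel:
  fixes k :: "'a::euclidean_space \<Rightarrow> ennreal"
  assumes k: "k \<in> borel_measurable borel" and \<Omega>: "open \<Omega>"
  shows "(\<integral>\<^sup>+x. k x \<partial>leb \<Omega>) \<le> (\<integral>\<^sup>+x. k x \<partial>lborel)"
proof -
  have kl: "k \<in> borel_measurable lebesgue"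
    by (rule measurable_completion) (use k in simp)
  have "(\<integral>\<^sup>+x. k x \<partial>leb \<Omega>) = (\<integral>\<^sup>+x. indicator \<Omega> x * k x \<partial>lebesgue)"
    unfolding restr_def
    by (rule nn_integral_density[OF borel_measurable_indicator kl]) (use \<Omega> in auto)
  also have "\<dots> \<le> (\<integral>\<^sup>+x. k x \<partial>lebesgue)"
    by (intro nn_integral_mono) (auto simp: indicator_def)
  also have "\<dots> = (\<integral>\<^sup>+x. k x \<partial>lborel)" using k by (simp add: nn_integral_completion)
  finally show ?thesis .
qed

context dirichlet_space
begin

definition ker_measure :: "'a measure" where
  "ker_measure = density lborel (\<lambda>z. ennreal (ker z))"

lemma sets_ker_measure [simp, measurable_cong]: "sets ker_measure = sets borel"
  and space_ker_measure [simp]: "space ker_measure = UNIV"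
  by (auto simp: ker_measure_def)

lemma emeasure_ker_measure: "emeasure ker_measure UNIV = ennreal ker_mass"
  unfolding ker_measure_def ker_mass_def using ker_integrable
  by (subst emeasure_density) (auto simp: nn_integral_eq_integral)

text \<open>Cauchy-Schwarz for the kernel measure and the shift estimate for vectors of length at
  most \<open>\<epsilon>\<close>. For classes this \<open>L2\<close> rate replaces continuity at a
  point.\<close>

lemma ker_mean_oscillation:
  assumes \<phi>: "test_fn \<Omega> \<phi>" and \<epsilon>: "\<epsilon> > 0"
  shows "L2 l (\<lambda>x. ker_mean \<Omega> \<phi> x \<epsilon> - ker_mass * \<phi> x)"
    "L2n l (\<lambda>x. ker_mean \<Omega> \<phi> x \<epsilon> - ker_mass * \<phi> x) \<le> \<epsilon> * ker_mass * L2n l (grad \<phi>)"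
proof -
  interpret K: finite_measure ker_measure
    by standard (simp add: emeasure_ker_measure)
  note [measurable] = test_fn_measurable(1)[OF \<phi>]
  have mK: "measure ker_measure UNIV = ker_mass"
    using ker_mass_nonneg by (simp add: measure_def emeasure_ker_measure)
  obtain B where B: "\<And>x. \<bar>\<phi> x\<bar> \<le> B" "\<And>x. norm (grad \<phi> x) \<le> B" "B \<ge> 0"
    by (rule test_fn_bounded[OF \<phi>]) (rule that)
  have B2: "\<bar>\<phi> x - \<phi> y\<bar> \<le> 2 * B" for x y using B(1)[of x] B(1)[of y] by linarith
  have int: "integrable ker_measure (\<lambda>z. \<phi> (x + \<epsilon> *\<^sub>R z))" for x
    by (rule K.integrable_const_bound[of _ B]) (use B in auto)
  define h where "h x = (LINT z|ker_measure. \<phi> (x + \<epsilon> *\<^sub>R z) - \<phi> x)" for x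
  have heq: "ker_mean \<Omega> \<phi> x \<epsilon> - ker_mass * \<phi> x = h x" for x
  proof -
    have "h x = (LINT z|ker_measure. \<phi> (x + \<epsilon> *\<^sub>R z)) - (LINT z|ker_measure. \<phi> x)"
      unfolding h_def by (rule Bochner_Integration.integral_diff[OF int]) simp
    also have "(LINT z|ker_measure. \<phi> x) = ker_mass * \<phi> x" by (simp add: mK)
    also have "(LINT z|ker_measure. \<phi> (x + \<epsilon> *\<^sub>R z)) = (LINT z|lborel. \<phi> (x + \<epsilon> *\<^sub>R z) * ker z)"
      unfolding ker_measure_def by (subst integral_density) (auto simp: mult.commute)
    finally show ?thesis using ker_mean_test[OF \<phi> open_dom \<epsilon>] by simp
  qed
  have hm: "h \<in> borel_measurable borel" unfolding h_def by measurable
  have hl: "h \<in> borel_measurable l" by (simp, rule measurable_completion) (use hm in simp)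
  define E where "E = L2n l (grad \<phi>)"
  have E0: "E \<ge> 0" by (simp add: E_def)
  have aez: "AE z in ker_measure. norm z \<le> 1"
  proof -
    have "norm z \<le> 1" if "0 < ennreal (ker z)" for z :: 'a
      using that ker_eq_0[of z] by (cases "norm z \<le> 1") auto
    moreover have "(\<lambda>z::'a. ennreal (ker z)) \<in> borel_measurable lborel" by simp
    ultimately show ?thesis
      unfolding ker_measure_def by (subst AE_density) auto
  qed
  have "(\<integral>\<^sup>+x. ennreal ((h x)\<^sup>2) \<partial>l) \<le> (\<integral>\<^sup>+x. ennreal ((h x)\<^sup>2) \<partial>lborel)"
    using hm by (intro nn_integral_leb_le_lborel open_dom) measurable
  also have "\<dots> \<le> (\<integral>\<^sup>+x. ennreal ker_mass * (\<integral>\<^sup>+z. ennreal ((\<phi> (x + \<epsilon> *\<^sub>R z) - \<phi> x)\<^sup>2) \<partial>ker_measure) \<partial>lborel)"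
    unfolding h_def using K.square_integral_le[of "\<lambda>z. \<phi> (x + \<epsilon> *\<^sub>R z) - \<phi> x" "2 * B" for x] B2
    by (intro nn_integral_mono) (simp add: mK)
  also have "\<dots> = ennreal ker_mass * (\<integral>\<^sup>+x. (\<integral>\<^sup>+z. ennreal ((\<phi> (x + \<epsilon> *\<^sub>R z) - \<phi> x)\<^sup>2) \<partial>ker_measure) \<partial>lborel)"
    by (rule nn_integral_cmult) measurable
  also have "(\<integral>\<^sup>+x. (\<integral>\<^sup>+z. ennreal ((\<phi> (x + \<epsilon> *\<^sub>R z) - \<phi> x)\<^sup>2) \<partial>ker_measure) \<partial>lborel)
    = (\<integral>\<^sup>+z. (\<integral>\<^sup>+x. ennreal ((\<phi> (x + \<epsilon> *\<^sub>R z) - \<phi> x)\<^sup>2) \<partial>lborel) \<partial>ker_measure)"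
    by (rule pair_sigma_finite.Fubini')
      (auto simp: pair_sigma_finite_def sigma_finite_lborel K.sigma_finite_measure_axioms)
  also have "\<dots> \<le> (\<integral>\<^sup>+z. ennreal ((\<epsilon> * E)\<^sup>2) \<partial>ker_measure)"
  proof (rule nn_integral_mono_AE)
    show "AE z in ker_measure. (\<integral>\<^sup>+x. ennreal ((\<phi> (x + \<epsilon> *\<^sub>R z) - \<phi> x)\<^sup>2) \<partial>lborel) \<le> ennreal ((\<epsilon> * E)\<^sup>2)"
      using aez
    proof eventually_elim
      case (elim z)
      have "(norm (\<epsilon> *\<^sub>R z) * E)\<^sup>2 \<le> (\<epsilon> * E)\<^sup>2"
        using elim \<epsilon> E0 by (intro power_mono mult_right_mono) auto
      then show ?case
        using nn_integral_shift_diff[OF \<phi> open_dom bounded_dom, of "\<epsilon> *\<^sub>R z"]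
        unfolding E_def by (meson ennreal_leI order_trans)
    qed
  qed
  also have "\<dots> = ennreal ((\<epsilon> * E)\<^sup>2) * ennreal ker_mass" by (simp add: emeasure_ker_measure)
  finally have "(\<integral>\<^sup>+x. ennreal ((h x)\<^sup>2) \<partial>l) \<le> ennreal ker_mass * (ennreal ((\<epsilon> * E)\<^sup>2) * ennreal ker_mass)"
    by (simp add: mult_left_mono)
  also have "\<dots> = ennreal ((\<epsilon> * ker_mass * E)\<^sup>2)"
  proof -
    have "(\<epsilon> * ker_mass * E)\<^sup>2 = ker_mass * ((\<epsilon> * E)\<^sup>2 * ker_mass)" by (simp add: power2_eq_square)
    then show ?thesis using ker_mass_nonneg by (simp only: ennreal_mult' zero_le_power2 ennreal_mult)
  qed
  finally have le: "(\<integral>\<^sup>+x. ennreal ((h x)\<^sup>2) \<partial>l) \<le> ennreal ((\<epsilon> * ker_mass * E)\<^sup>2)" .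
  have Lh: "L2 l h"
    unfolding L2_def
  proof
    show "integrable l (\<lambda>x. (norm (h x))\<^sup>2)"
      by (rule integrableI_nonneg) (use hl le in \<open>auto simp: order_le_less_trans\<close>)
  qed (use hl in simp)
  then show "L2 l (\<lambda>x. ker_mean \<Omega> \<phi> x \<epsilon> - ker_mass * \<phi> x)" unfolding heq .
  have "(L2n l h)\<^sup>2 \<le> (\<epsilon> * ker_mass * E)\<^sup>2"
    using le nn_integral_L2[OF Lh] by simp
  then show "L2n l (\<lambda>x. ker_mean \<Omega> \<phi> x \<epsilon> - ker_mass * \<phi> x) \<le> \<epsilon> * ker_mass * L2n l (grad \<phi>)"
    unfolding heq using \<epsilon> ker_mass_nonneg E0 by (simp add: E_def power_mono_iff)
qed

text \<open>On the zero set \<open>Z\<close> the means at scale \<open>r\<close> are at least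
  \<open>\<kappa> * I\<close>, with \<open>I\<close> the integral of \<open>w\<close> over the ball.
  The means at scale \<open>\<epsilon>\<close> dominate them and are of size
  \<open>\<epsilon>\<close> in \<open>L2\<close> on \<open>Z\<close>. Letting
  \<open>\<epsilon>\<close> tend to 0 forces \<open>I\<close> or the norm \<open>J\<close> of the
  indicator of \<open>Z\<close> to vanish.\<close>

lemma supersolution_zero_set_ball:
  assumes H: "H01 w g f" and S: "supersolution g" and nn: "\<And>x. 0 \<le> w x"
    and \<rho>: "\<rho> > 0" "cball c (5 * \<rho>) \<subseteq> \<Omega>"
  shows "(AE x in lebesgue. x \<in> ball c \<rho> \<longrightarrow> w x = 0) \<or> (AE x in lebesgue. x \<in> ball c \<rho> \<longrightarrow> 0 < w x)"
proof -
  note L = H01_L2[OF H]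
  obtain A where A: "A > 0" "\<And>z::'a. ker z \<le> A" by (rule ker_bounded) (rule that)
  define B where "B = ball c \<rho>"
  \<comment> \<open>Two points of the ball are closer than \<open>2 * \<rho>\<close>, half of
    \<open>r\<close>, so \<open>ker_lower\<close> applies; and a ball of radius \<open>r\<close>
    about a point of \<open>B\<close> stays within distance \<open>5 * \<rho>\<close> of
    \<open>c\<close>.\<close>
  define r where "r = 4 * \<rho>"
  have r: "r > 0" using \<rho> by (simp add: r_def)
  have subr: "cball x r \<subseteq> \<Omega>" if "x \<in> B" for x
  proof
    fix y assume "y \<in> cball x r"
    then have "dist c y \<le> 5 * \<rho>" using that dist_triangle[of c y x] by (auto simp: B_def r_def)
    then show "y \<in> \<Omega>" using \<rho>(2) by auto
  qed
  have BO: "B \<subseteq> \<Omega>" using subr r by (metis centre_in_cball less_imp_le subset_eq)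
  have wm: "w \<in> borel_measurable lebesgue" using L(1) by (simp add: L2_def)
  define Z where "Z = {x \<in> B. w x = 0}"
  have Zm: "Z \<in> sets lebesgue"
  proof -
    have "Z = B \<inter> (w -` {0} \<inter> space lebesgue)" by (auto simp: Z_def)
    moreover have "w -` {0} \<inter> space lebesgue \<in> sets lebesgue" by (rule measurable_sets[OF wm]) simp
    ultimately show ?thesis by (auto simp: B_def)
  qed
  define J where "J = L2n l (indicator Z :: 'a \<Rightarrow> real)"
  have LZ: "L2 l (indicator Z :: 'a \<Rightarrow> real)"
    by (rule l.L2_bounded(1)[of _ 1]) (use Zm in \<open>auto simp: indicator_def\<close>)
  define I where "I = (LINT y|l. indicator B y * w y)"
  have LB: "L2 l (\<lambda>y. indicator B y * w y)"
  proof (rule L2I_le[OF _ L(1)])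
    show "(\<lambda>y. indicator B y * w y) \<in> borel_measurable l"
      using wm by (intro borel_measurable_times borel_measurable_indicator) (auto simp: B_def)
  qed (auto simp: indicator_def)
  have one: "L2 l (\<lambda>y. 1::real)" by (simp add: L2_def)
  have iB: "integrable l (\<lambda>y. indicator B y * w y)"
    using L2_integrable_ip[OF LB one] by simp
  define \<kappa> where "\<kappa> = 2 * exp (- 4 / 3) / r ^ DIM('a)"
  have \<kappa>: "\<kappa> > 0" using r by (simp add: \<kappa>_def)
  have I0: "I \<ge> 0" unfolding I_def using nn by (intro integral_nonneg_AE) auto
  have lower: "\<kappa> * I \<le> ker_mean \<Omega> w x r" if x: "x \<in> B" for x
  proof -
    have "(LINT y|l. (2 * exp (- 4 / 3)) * (indicator B y * w y)) \<le> (LINT y|l. w y * ker ((1 / r) *\<^sub>R (y - x)))"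
    proof (rule integral_mono)
      show "integrable l (\<lambda>y. (2 * exp (- 4 / 3)) * (indicator B y * w y))" using iB by simp
      show "integrable l (\<lambda>y. w y * ker ((1 / r) *\<^sub>R (y - x)))"
        using L2_integrable_ip[OF L(1) ker_L2] by simp
      fix y
      show "(2 * exp (- 4 / 3)) * (indicator B y * w y) \<le> w y * ker ((1 / r) *\<^sub>R (y - x))"
      proof (cases "y \<in> B")
        case True
        have "dist y x < 2 * \<rho>"
          using x True dist_triangle[of y x c] by (auto simp: B_def dist_commute)
        then have "norm (y - x) \<le> r / 2" by (simp add: r_def dist_norm)
        then have "norm ((1 / r) *\<^sub>R (y - x)) \<le> 1 / 2" unfolding norm_scaleR using r by (simp add: field_simps)
        from ker_lower[OF this] show ?thesis
          using nn[of y] True mult_left_mono[of "2 * exp (- 4 / 3)" "ker ((1 / r) *\<^sub>R (y - x))" "w y"]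
          by (simp add: mult.commute)
      qed (use nn in simp)
    qed
    then have "2 * exp (- 4 / 3) * I \<le> ip l w (\<lambda>y. ker ((1 / r) *\<^sub>R (y - x)))"
      by (simp add: I_def ip_def)
    then show ?thesis unfolding \<kappa>_def ker_mean_def using r by (simp add: divide_right_mono)
  qed
  obtain \<phi> where \<phi>: "\<And>k. test_fn \<Omega> (\<phi> (k::nat))"
    "(\<lambda>k. L2n l (\<lambda>x. \<phi> k x - w x)) \<longlonglongrightarrow> 0"
    "(\<lambda>k. L2n l (\<lambda>x. grad (\<phi> k) x - g x)) \<longlonglongrightarrow> 0"
    "(\<lambda>k. L2n m (\<lambda>x. \<phi> k x - f x)) \<longlonglongrightarrow> 0"
    by (rule H01_approx[OF H]) (rule that)
  note T = test_L2[OF \<phi>(1)]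
  have est: "\<kappa> * I * J \<le> \<epsilon> * ker_mass * L2n l g" if \<epsilon>: "0 < \<epsilon>" "\<epsilon> < r" for \<epsilon>
  proof -
    obtain C where C: "\<And>\<phi> x. test_fn \<Omega> \<phi> \<Longrightarrow> cball x r \<subseteq> \<Omega> \<Longrightarrow>
      ker_mean \<Omega> \<phi> x r \<le> ker_mean \<Omega> \<phi> x \<epsilon> + C * L2n l (\<lambda>y. grad \<phi> y - g y)"
      by (rule ker_mean_supersolution_approx[OF H S \<epsilon>]) (rule that)
    define q where "q = A * sqrt (measure l UNIV) / r ^ DIM('a)"
    define s where "s k = q * L2n l (\<lambda>x. \<phi> k x - w x) + C * L2n l (\<lambda>y. grad (\<phi> k) y - g y)" for k
    define h where "h k x = ker_mean \<Omega> (\<phi> k) x \<epsilon> - ker_mass * \<phi> k x" for k x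
    have Lh: "L2 l (h k)" "L2n l (h k) \<le> \<epsilon> * ker_mass * L2n l (grad (\<phi> k))" for k
      unfolding h_def using ker_mean_oscillation[OF \<phi>(1) \<epsilon>(1)] by auto
    have pt: "\<kappa> * I \<le> \<bar>h k x\<bar> + ker_mass * \<bar>\<phi> k x - w x\<bar> + \<bar>s k\<bar>" if x: "x \<in> Z" for k x
    proof -
      have xB: "x \<in> B" "w x = 0" using x by (auto simp: Z_def)
      have "L2n l (\<lambda>y. ker ((1 / r) *\<^sub>R (y - x))) \<le> A * sqrt (measure l (space l))"
        by (rule l.L2_bounded(2)[OF L2_measurable[OF ker_L2]]) (use A in simp)
      then have "L2n l (\<lambda>y. ker ((1 / r) *\<^sub>R (y - x))) \<le> A * sqrt (measure l UNIV)" by simp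
      then have "\<bar>ip l (\<lambda>x. \<phi> k x - w x) (\<lambda>y. ker ((1 / r) *\<^sub>R (y - x)))\<bar>
          \<le> L2n l (\<lambda>x. \<phi> k x - w x) * (A * sqrt (measure l UNIV))"
        using ip_Cauchy_Schwarz[OF L2_diff[OF T(1)[of k] L(1)] ker_L2, of r x]
        by (meson L2n_nonneg mult_left_mono order_trans)
      then have "ip l w (\<lambda>y. ker ((1 / r) *\<^sub>R (y - x))) - ip l (\<phi> k) (\<lambda>y. ker ((1 / r) *\<^sub>R (y - x)))
          \<le> L2n l (\<lambda>x. \<phi> k x - w x) * (A * sqrt (measure l UNIV))"
        using T(1)[of k] L(1) ker_L2[of r x] by (simp add: ip_diff_left)
      then have "ker_mean \<Omega> w x r - ker_mean \<Omega> (\<phi> k) x r \<le> q * L2n l (\<lambda>x. \<phi> k x - w x)"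
        unfolding ker_mean_def q_def using r by (simp add: divide_right_mono mult.commute flip: diff_divide_distrib)
      \<comment> \<open>As \<open>w x = 0\<close>, subtracting \<open>ker_mass * w x\<close> is free
        and turns the mean at scale \<open>\<epsilon>\<close> into the oscillation
        \<open>h k x\<close> plus a small error.\<close>
      then have "\<kappa> * I \<le> h k x + ker_mass * (\<phi> k x - w x) + s k"
        using lower[OF xB(1)] C[OF \<phi>(1)[of k] subr[OF xB(1)]] xB(2) by (simp add: h_def s_def)
      also have "\<dots> \<le> \<bar>h k x\<bar> + ker_mass * \<bar>\<phi> k x - w x\<bar> + \<bar>s k\<bar>"
        using ker_mass_nonneg by (intro add_mono mult_left_mono) auto
      finally show ?thesis .
    qed
    have abs_L2: "L2 l (\<lambda>x. \<bar>v x\<bar>)" "L2n l (\<lambda>x. \<bar>v x\<bar>) = L2n l v" if "L2 l v" for v :: "'a \<Rightarrow> real"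
      using that by (auto simp: L2_def L2n_def ip_def abs_mult[symmetric])
    have bound: "\<kappa> * I * J \<le> \<epsilon> * ker_mass * L2n l (grad (\<phi> k)) + ker_mass * L2n l (\<lambda>x. \<phi> k x - w x)
        + \<bar>s k\<bar> * sqrt (measure l UNIV)" for k
    proof -
      define P where "P x = \<bar>h k x\<bar> + ker_mass * \<bar>\<phi> k x - w x\<bar>" for x
      note D = L2_diff[OF T(1)[of k] L(1)]
      have LP: "L2 l P" unfolding P_def by (intro L2_add L2_cmult abs_L2 Lh D)
      have Lc: "L2 l (\<lambda>x. \<bar>s k\<bar>)" by (simp add: L2_def)
      have "\<kappa> * I * J = \<bar>\<kappa> * I\<bar> * L2n l (indicator Z :: 'a \<Rightarrow> real)" using \<kappa> I0 by (simp add: J_def)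
      also have "\<dots> = L2n l (\<lambda>x. (\<kappa> * I) *\<^sub>R (indicator Z x :: real))" by (rule L2n_scale[symmetric])
      also have "\<dots> \<le> L2n l (\<lambda>x. P x + \<bar>s k\<bar>)"
      proof (rule L2n_mono[OF L2_scale[OF LZ] L2_add[OF LP Lc]], intro always_eventually allI)
        fix x
        have "0 \<le> P x" unfolding P_def using ker_mass_nonneg by simp
        moreover have "(\<kappa> * I) * indicator Z x \<le> P x + \<bar>s k\<bar>"
          using pt[of x k] \<open>0 \<le> P x\<close> by (cases "x \<in> Z") (auto simp: P_def)
        moreover have "0 \<le> (\<kappa> * I) * indicator Z x" using \<kappa> I0 by simp
        ultimately show "norm ((\<kappa> * I) *\<^sub>R (indicator Z x :: real)) \<le> norm (P x + \<bar>s k\<bar>)" by simp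
      qed
      also have "\<dots> \<le> L2n l P + L2n l (\<lambda>x. \<bar>s k\<bar>)" by (rule L2n_triangle[OF LP Lc])
      also have "L2n l (\<lambda>x. \<bar>s k\<bar>) = \<bar>s k\<bar> * sqrt (measure l UNIV)"
        by (simp add: L2n_def ip_def real_sqrt_mult)
      also have "L2n l P \<le> L2n l (\<lambda>x. \<bar>h k x\<bar>) + L2n l (\<lambda>x. ker_mass * \<bar>\<phi> k x - w x\<bar>)"
        unfolding P_def by (intro L2n_triangle L2_cmult abs_L2 Lh D)
      also have "L2n l (\<lambda>x. \<bar>h k x\<bar>) \<le> \<epsilon> * ker_mass * L2n l (grad (\<phi> k))"
        using abs_L2(2)[OF Lh(1)] Lh(2) by simp
      also have "L2n l (\<lambda>x. ker_mass * \<bar>\<phi> k x - w x\<bar>) = ker_mass * L2n l (\<lambda>x. \<phi> k x - w x)"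
        using L2n_scale[of l ker_mass "\<lambda>x. \<bar>\<phi> k x - w x\<bar>"] abs_L2(2)[OF D] ker_mass_nonneg by simp
      finally show ?thesis by simp
    qed
    have "(\<lambda>k. s k) \<longlonglongrightarrow> q * 0 + C * 0" unfolding s_def by (intro tendsto_intros \<phi>)
    then have s0: "(\<lambda>k. \<bar>s k\<bar>) \<longlonglongrightarrow> 0" by (simp add: tendsto_rabs_zero)
    have "(\<lambda>k. \<epsilon> * ker_mass * L2n l (grad (\<phi> k)) + ker_mass * L2n l (\<lambda>x. \<phi> k x - w x)
        + \<bar>s k\<bar> * sqrt (measure l UNIV)) \<longlonglongrightarrow> \<epsilon> * ker_mass * L2n l g + ker_mass * 0 + 0 * sqrt (measure l UNIV)"
      by (intro tendsto_intros tendsto_L2n T L \<phi> s0)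
    then have "(\<lambda>k. \<epsilon> * ker_mass * L2n l (grad (\<phi> k)) + ker_mass * L2n l (\<lambda>x. \<phi> k x - w x)
        + \<bar>s k\<bar> * sqrt (measure l UNIV)) \<longlonglongrightarrow> \<epsilon> * ker_mass * L2n l g" by simp
    then show ?thesis by (rule LIMSEQ_le_const) (use bound in blast)
  qed
  have J0: "J \<ge> 0" by (simp add: J_def)
  have "\<kappa> * I * J \<le> 0"
  proof (rule tendsto_lowerbound)
    have "((\<lambda>\<epsilon>. \<epsilon> * ker_mass * L2n l g) \<longlongrightarrow> 0 * ker_mass * L2n l g) (at_right 0)"
      by (intro tendsto_intros)
    then show "((\<lambda>\<epsilon>. \<epsilon> * ker_mass * L2n l g) \<longlongrightarrow> 0) (at_right 0)" by simp
    show "\<forall>\<^sub>F \<epsilon> in at_right 0. \<kappa> * I * J \<le> \<epsilon> * ker_mass * L2n l g"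
      unfolding eventually_at_right_field using est r by (intro exI[of _ r]) auto
  qed simp
  moreover have "0 \<le> \<kappa> * I * J" using \<kappa> I0 J0 by simp
  ultimately have "I = 0 \<or> J = 0" using \<kappa> by auto
  then show ?thesis
  proof
    assume "I = 0"
    then have "AE y in l. indicator B y * w y = 0"
      unfolding I_def using integral_nonneg_eq_0_iff_AE[OF iB] nn by auto
    then have "AE y in lebesgue. y \<in> \<Omega> \<longrightarrow> indicator B y * w y = 0" by (simp only: AE_restr[OF dom_sets(1)])
    then have "AE y in lebesgue. y \<in> ball c \<rho> \<longrightarrow> w y = 0"
      by eventually_elim (use BO in \<open>auto simp: B_def indicator_def\<close>)
    then show ?thesis by blast
  next
    assume "J = 0"
    then have "AE y in l. indicator Z y = (0::real)" unfolding J_def L2n_eq_0_iff[OF LZ] .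
    then have "AE y in lebesgue. y \<in> \<Omega> \<longrightarrow> indicator Z y = (0::real)" by (simp only: AE_restr[OF dom_sets(1)])
    then have "AE y in lebesgue. y \<in> ball c \<rho> \<longrightarrow> 0 < w y"
    proof eventually_elim
      case (elim y)
      show ?case
      proof
        assume y: "y \<in> ball c \<rho>"
        then have "y \<notin> Z" using elim BO by (auto simp: B_def indicator_def split: if_splits)
        then show "0 < w y" using y nn[of y] by (auto simp: Z_def B_def order_less_le)
      qed
    qed
    then show ?thesis by blast
  qed
qed

lemma AE_lebesgue_ball_nontrivial:
  fixes c :: 'a
  assumes "r > 0" "AE x in lebesgue. x \<in> ball c r \<longrightarrow> P x"
  shows "\<exists>x\<in>ball c r. P x"
proof (rule ccontr)
  assume n: "\<not> ?thesis"
  have "AE x in lebesgue. x \<notin> ball c r"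
    using assms(2) by eventually_elim (use n in blast)
  then have "ball c r \<in> null_sets lebesgue" by (subst (asm) AE_iff_null_sets[symmetric]) auto
  then have "negligible (ball c r)" by (simp add: negligible_iff_null_sets)
  then show False using open_not_negligible[OF open_ball, of c r] assms(1) by auto
qed

lemma AE_restr_local:
  assumes "\<And>x. x \<in> \<Omega> \<Longrightarrow> \<exists>r>0. AE y in lebesgue. y \<in> ball x r \<longrightarrow> P y"
  shows "AE y in l. P y"
proof -
  define F where "F = {B. \<exists>x r. B = ball x r \<and> (AE y in lebesgue. y \<in> ball x r \<longrightarrow> P y)}"
  have "\<And>S. S \<in> F \<Longrightarrow> open S" by (auto simp: F_def)
  then obtain F' where F': "F' \<subseteq> F" "countable F'" "\<Union>F' = \<Union>F" by (rule Lindelof) blast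
  have "AE y in lebesgue. \<forall>B\<in>F'. y \<in> B \<longrightarrow> P y"
    unfolding AE_ball_countable[OF F'(2)] using F'(1) by (auto simp: F_def)
  then have "AE y in lebesgue. y \<in> \<Omega> \<longrightarrow> P y"
  proof eventually_elim
    case (elim y)
    show ?case
    proof
      assume "y \<in> \<Omega>"
      then obtain r where "r > 0" "AE z in lebesgue. z \<in> ball y r \<longrightarrow> P z" using assms by blast
      then have "ball y r \<in> F" "y \<in> ball y r" by (auto simp: F_def)
      then show "P y" using elim F'(3) by blast
    qed
  qed
  then show ?thesis by (simp only: AE_restr[OF dom_sets(1)])
qed

text \<open>The points near which \<open>w\<close> is almost everywhere zero and those near which it
  is almost everywhere positive form two disjoint open sets covering \<open>\<Omega>\<close>;
  connectedness leaves only one of them.\<close>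

lemma strong_maximum_AE:
  assumes H: "H01 w g f" and S: "supersolution g" and nn: "\<And>x. 0 \<le> w x"
  shows "(AE x in l. w x = 0) \<or> (AE x in l. 0 < w x)"
proof -
  define X where "X P = {x\<in>\<Omega>. \<exists>r>0. AE y in lebesgue. y \<in> ball x r \<longrightarrow> P (w y)}" for P :: "real \<Rightarrow> bool"
  have opX: "open (X P)" for P
    unfolding open_contains_ball
  proof
    fix x assume "x \<in> X P"
    then obtain r where r: "x \<in> \<Omega>" "r > 0" "AE y in lebesgue. y \<in> ball x r \<longrightarrow> P (w y)" by (auto simp: X_def)
    have "x' \<in> X P" if x': "x' \<in> ball x r \<inter> \<Omega>" for x'
    proof -
      obtain e where e: "e > 0" "ball x' e \<subseteq> ball x r" using x' open_ball open_contains_ball by blast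
      have "AE y in lebesgue. y \<in> ball x' e \<longrightarrow> P (w y)"
        using r(3) by eventually_elim (use e in blast)
      then show ?thesis using x' e by (auto simp: X_def)
    qed
    moreover have "open (ball x r \<inter> \<Omega>)" using open_dom by auto
    ultimately show "\<exists>e>0. ball x e \<subseteq> X P"
      using r(1,2) unfolding open_contains_ball by (meson IntI centre_in_ball subset_eq)
  qed
  have cover: "x \<in> X (\<lambda>t. t = 0) \<or> x \<in> X (\<lambda>t. 0 < t)" if x: "x \<in> \<Omega>" for x
  proof -
    obtain e where e: "e > 0" "cball x e \<subseteq> \<Omega>" using open_dom x open_contains_cball by blast
    have "e / 5 > 0" "cball x (5 * (e / 5)) \<subseteq> \<Omega>" using e by auto
    from supersolution_zero_set_ball[OF H S nn this] show ?thesis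
      using x \<open>e / 5 > 0\<close> unfolding X_def by blast
  qed
  have disj: "X (\<lambda>t. t = 0) \<inter> X (\<lambda>t. 0 < t) = {}"
  proof (rule ccontr)
    assume "\<not> ?thesis"
    then obtain x r1 r2 where r: "r1 > 0" "r2 > 0" "AE y in lebesgue. y \<in> ball x r1 \<longrightarrow> w y = 0"
      "AE y in lebesgue. y \<in> ball x r2 \<longrightarrow> 0 < w y" unfolding X_def by blast
    have "AE y in lebesgue. y \<in> ball x (min r1 r2) \<longrightarrow> False"
      using r(3,4) by eventually_elim auto
    then show False using AE_lebesgue_ball_nontrivial[of "min r1 r2" x "\<lambda>_. False"] r by auto
  qed
  have "X (\<lambda>t. t = 0) \<subseteq> \<Omega>" "X (\<lambda>t. 0 < t) \<subseteq> \<Omega>" by (auto simp: X_def)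
  then have "X (\<lambda>t. t = 0) = {} \<or> X (\<lambda>t. 0 < t) = {}"
    using connectedD[OF connected_dom opX opX, of "\<lambda>t. t = 0" "\<lambda>t. 0 < t"] disj cover by blast
  then show ?thesis
  proof
    assume "X (\<lambda>t. t = 0) = {}"
    then have "\<exists>r>0. AE y in lebesgue. y \<in> ball x r \<longrightarrow> 0 < w y" if "x \<in> \<Omega>" for x
      using cover[OF that] by (auto simp: X_def)
    from AE_restr_local[OF this] show ?thesis by blast
  next
    assume "X (\<lambda>t. 0 < t) = {}"
    then have "\<exists>r>0. AE y in lebesgue. y \<in> ball x r \<longrightarrow> w y = 0" if "x \<in> \<Omega>" for x
      using cover[OF that] by (auto simp: X_def)
    from AE_restr_local[OF this] show ?thesis by blast
  qed
qed

end

section \<open>Counting nodal domains\<close>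

text \<open>Gaussian elimination by induction on the equations: one with a nonzero coefficient at
  \<open>D0\<close> is solved for that unknown and substituted into the rest.\<close>

lemma homogeneous_system_nontrivial:
  fixes a :: "'d \<Rightarrow> 'i \<Rightarrow> real"
  assumes "finite I" "finite S" "card I < card S"
  shows "\<exists>c. (\<exists>D\<in>S. c D \<noteq> 0) \<and> (\<forall>i\<in>I. (\<Sum>D\<in>S. c D * a D i) = 0)"
  using assms
proof (induction I arbitrary: S a rule: finite_induct)
  case empty
  then have "S \<noteq> {}" by auto
  then show ?case by (intro exI[of _ "\<lambda>_. 1"]) auto
next
  case (insert i I)
  show ?case
  proof (cases "\<forall>D\<in>S. a D i = 0")
    case True
    have "card I < card S" using insert by simp
    then obtain c where c: "\<exists>D\<in>S. c D \<noteq> 0" "\<forall>i\<in>I. (\<Sum>D\<in>S. c D * a D i) = 0"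
      using insert.IH[OF insert.prems(1), of a] by blast
    moreover have "(\<Sum>D\<in>S. c D * a D i) = 0" using True by (intro sum.neutral) auto
    ultimately show ?thesis by (intro exI[of _ c]) auto
  next
    case False
    then obtain D0 where D0: "D0 \<in> S" "a D0 i \<noteq> 0" by blast
    define S' where "S' = S - {D0}"
    have S': "finite S'" "card I < card S'" "S = insert D0 S'" "D0 \<notin> S'"
      using insert D0 by (auto simp: S'_def)
    obtain c where c: "\<exists>D\<in>S'. c D \<noteq> 0"
      "\<forall>j\<in>I. (\<Sum>D\<in>S'. c D * (a D j - a D i / a D0 i * a D0 j)) = 0"
      using insert.IH[OF S'(1,2), of "\<lambda>D j. a D j - a D i / a D0 i * a D0 j"] by blast
    define c0 where "c0 = - (\<Sum>D\<in>S'. c D * a D i) / a D0 i"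
    define c' where "c' D = (if D = D0 then c0 else c D)" for D
    have sum: "(\<Sum>D\<in>S. c' D * a D j) = c0 * a D0 j + (\<Sum>D\<in>S'. c D * a D j)" for j
    proof -
      have "(\<Sum>D\<in>S'. c' D * a D j) = (\<Sum>D\<in>S'. c D * a D j)"
        using S'(4) by (intro sum.cong) (auto simp: c'_def)
      then show ?thesis using S' by (simp add: c'_def)
    qed
    have "(\<Sum>D\<in>S. c' D * a D j) = 0" if "j \<in> I" for j
    proof -
      have "(\<Sum>D\<in>S'. c D * a D j) - (\<Sum>D\<in>S'. c D * a D i) / a D0 i * a D0 j = 0"
        using c(2)[rule_format, OF that]
        by (simp add: right_diff_distrib sum_subtractf sum_distrib_right sum_divide_distrib mult.assoc)
      then show ?thesis unfolding sum c0_def by simp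
    qed
    moreover have "(\<Sum>D\<in>S. c' D * a D i) = 0" unfolding sum c0_def using D0 by simp
    moreover have "\<exists>D\<in>S. c' D \<noteq> 0" using c(1) S' by (auto simp: c'_def)
    ultimately show ?thesis by (intro exI[of _ c']) auto
  qed
qed

context dirichlet_space
begin

section \<open>Signs of eigenfunctions\<close>

lemma AE_m: "(AE x in m. P x) \<longleftrightarrow> (AE x in \<mu>. x \<in> \<Omega> \<longrightarrow> P x)"
  by (rule AE_restr[OF dom_sets(2)])

lemma L2n_m_zeroI:
  assumes "L2 m f" "\<And>x. x \<in> \<Omega> \<Longrightarrow> f x = 0"
  shows "L2n m f = 0"
  using assms(2) unfolding L2n_eq_0_iff[OF assms(1)] AE_m by simp

lemma eigen_scale:
  assumes "is_eigenfunction \<Omega> \<mu> t u g f" "c \<noteq> 0"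
  shows "is_eigenfunction \<Omega> \<mu> t (\<lambda>x. c * u x) (\<lambda>x. c *\<^sub>R g x) (\<lambda>x. c * f x)"
  using assms H01_scale[of u g f c] L2n_scale[of m c f]
  by (auto simp: eigen_iff ip_scale_left ip_cmult_left)

lemma eigen_uminus:
  assumes "is_eigenfunction \<Omega> \<mu> t u g f"
  shows "is_eigenfunction \<Omega> \<mu> t (\<lambda>x. - u x) (\<lambda>x. - g x) (\<lambda>x. - f x)"
  using eigen_scale[OF assms, of "-1"] by simp

lemma eigen_lincomb:
  assumes "is_eigenfunction \<Omega> \<mu> t u g f" "is_eigenfunction \<Omega> \<mu> t u' g' f'"
    "L2n m (\<lambda>x. f x + c * f' x) \<noteq> 0"
  shows "is_eigenfunction \<Omega> \<mu> t (\<lambda>x. u x + c * u' x) (\<lambda>x. g x + c *\<^sub>R g' x) (\<lambda>x. f x + c * f' x)"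
  unfolding eigen_iff
proof (intro conjI allI impI)
  show "H01 (\<lambda>x. u x + c * u' x) (\<lambda>x. g x + c *\<^sub>R g' x) (\<lambda>x. f x + c * f' x)"
    by (rule H01_lincomb[OF eigenD(1)[OF assms(1)] eigenD(1)[OF assms(2)]])
  fix \<phi> assume \<phi>: "test_fn \<Omega> \<phi>"
  note L = eigenD(4-6)[OF assms(1)] eigenD(4-6)[OF assms(2)] test_L2[OF \<phi>]
  show "ip l (\<lambda>x. g x + c *\<^sub>R g' x) (grad \<phi>) = t * ip m (\<lambda>x. f x + c * f' x) \<phi>"
    using eigenD(3)[OF assms(1) H01_test[OF \<phi>]] eigenD(3)[OF assms(2) H01_test[OF \<phi>]] L
    by (simp add: ip_add_left L2_scale L2_cmult ip_scale_left ip_cmult_left algebra_simps)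
qed (rule assms(3))

lemma eigen_orthogonal:
  assumes "is_eigenfunction \<Omega> \<mu> t u g f" "is_eigenfunction \<Omega> \<mu> t' u' g' f'" "t \<noteq> t'"
  shows "ip m f f' = 0"
proof -
  have "t * ip m f f' = t' * ip m f' f"
    using eigenD(3)[OF assms(1) eigenD(1)[OF assms(2)]] eigenD(3)[OF assms(2) eigenD(1)[OF assms(1)]]
    by (simp add: ip_commute)
  then show ?thesis using assms(3) by (simp add: ip_commute)
qed

text \<open>Testing the equation with the positive part shows that this part has Rayleigh quotient
  \<open>t\<close> as well. As \<open>t\<close> bounds all Rayleigh quotients from below, expressed
  by an empty system, the positive part is a minimiser.\<close>

lemma pos_part_eigenfunction:
  assumes e: "is_eigenfunction \<Omega> \<mu> t u g f" and b: "spectral_bound ({} :: nat set) E t"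
    and nz: "L2n m (\<lambda>x. max (f x) 0) \<noteq> 0"
  shows "is_eigenfunction \<Omega> \<mu> t (\<lambda>x. max (u x) 0) (\<lambda>x. (if u x > 0 then 1 else 0) *\<^sub>R g x) (\<lambda>x. max (f x) 0)"
proof -
  note P = H01_pos_part[OF eigenD(1)[OF e]]
  have "ip l (\<lambda>x. (if u x > 0 then 1 else 0) *\<^sub>R g x) (\<lambda>x. (if u x > 0 then 1 else 0) *\<^sub>R g x)
    = ip l g (\<lambda>x. (if u x > 0 then 1 else 0) *\<^sub>R g x)"
    unfolding ip_def by (intro Bochner_Integration.integral_cong) auto
  also have "\<dots> = t * ip m f (\<lambda>x. max (f x) 0)" by (rule eigenD(3)[OF e P])
  also have "ip m f (\<lambda>x. max (f x) 0) = ip m (\<lambda>x. max (f x) 0) (\<lambda>x. max (f x) 0)"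
    unfolding ip_def by (intro Bochner_Integration.integral_cong) (auto simp: max_def)
  finally have eq: "ip l (\<lambda>x. (if u x > 0 then 1 else 0) *\<^sub>R g x) (\<lambda>x. (if u x > 0 then 1 else 0) *\<^sub>R g x)
    = t * ip m (\<lambda>x. max (f x) 0) (\<lambda>x. max (f x) 0)" .
  have sys: "eigen_system ({} :: nat set) \<tau> v h E" for \<tau> v h by (simp add: eigen_system_def)
  have perp: "perp ({} :: nat set) E k" for k by (simp add: perp_def)
  show ?thesis by (rule minimum_is_eigenfunction[OF sys P perp eq b nz])
qed

text \<open>The distribution given by minus the Laplacian is \<open>t * f\<close> times
  \<open>\<mu>\<close>, which is nonnegative. Here a possibly singular \<open>\<mu>\<close> leaves
  the stage: the maximum principle sees only Lebesgue measure.\<close>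

lemma eigen_supersolution:
  assumes e: "is_eigenfunction \<Omega> \<mu> t u g f" and nn: "\<And>x. x \<in> \<Omega> \<Longrightarrow> 0 \<le> f x"
  shows "supersolution g"
  unfolding supersolution_def
proof (intro allI impI)
  fix \<phi> assume \<phi>: "test_fn \<Omega> \<phi>" "\<forall>x. 0 \<le> \<phi> x"
  have "AE x in m. 0 \<le> f x \<bullet> \<phi> x" unfolding AE_m using nn \<phi>(2) by simp
  then have "0 \<le> ip m f \<phi>" unfolding ip_def by (rule integral_nonneg_AE)
  then show "0 \<le> ip l g (grad \<phi>)"
    using eigenD(3)[OF e H01_test[OF \<phi>(1)]] eigenvalue_nonneg[OF e] by simp
qed

lemma eigen_sign_part_nonzero:
  assumes e: "is_eigenfunction \<Omega> \<mu> t u g f"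
  shows "L2n m (\<lambda>x. max (f x) 0) \<noteq> 0 \<or> L2n m (\<lambda>x. max (- f x) 0) \<noteq> 0"
proof (rule ccontr)
  note P = H01_L2(3)[OF H01_pos_part[OF eigenD(1)[OF e]]]
    H01_L2(3)[OF H01_pos_part[OF eigenD(1)[OF eigen_uminus[OF e]]]]
  assume "\<not> ?thesis"
  then have "AE x in m. max (f x) 0 = 0" "AE x in m. max (- f x) 0 = 0"
    using L2n_eq_0_iff[OF P(1)] L2n_eq_0_iff[OF P(2)] by auto
  then have "AE x in m. f x = 0" by eventually_elim auto
  then show False using eigenD(2)[OF e] L2n_eq_0_iff[OF eigenD(6)[OF e]] by simp
qed

lemma cont_nonneg_eigenfunction_pos:
  assumes e: "is_eigenfunction \<Omega> \<mu> t u g u" and c: "continuous_on (closure \<Omega>) u"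
    and nn: "\<And>x. x \<in> \<Omega> \<Longrightarrow> 0 \<le> u x"
  shows "\<forall>x\<in>\<Omega>. 0 < u x"
proof (rule ccontr)
  assume "\<not> ?thesis"
  then obtain x0 where x0: "x0 \<in> \<Omega>" "u x0 = 0" using nn by force
  have "\<forall>x\<in>\<Omega>. u x = 0"
    by (rule strong_maximum_continuous[OF eigenD(1)[OF e] eigen_supersolution[OF e nn]
          continuous_on_subset[OF c closure_subset] nn x0])
  then show False using L2n_m_zeroI[OF eigenD(6)[OF e]] eigenD(2)[OF e] by simp
qed

lemma cont_first_eigenfunction_pos:
  assumes e: "is_eigenfunction \<Omega> \<mu> t u g u" and c: "continuous_on (closure \<Omega>) u"
    and b: "spectral_bound ({} :: nat set) E t" and nz: "L2n m (\<lambda>x. max (u x) 0) \<noteq> 0"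
  shows "\<forall>x\<in>\<Omega>. 0 < u x"
proof -
  have "\<forall>x\<in>\<Omega>. 0 < max (u x) 0"
    by (rule cont_nonneg_eigenfunction_pos[OF pos_part_eigenfunction[OF e b nz]])
      (auto intro!: continuous_intros c)
  then show ?thesis by (metis less_max_iff_disj less_irrefl)
qed

lemma first_eigenfunction_nonvanishing:
  assumes e: "is_eigenfunction \<Omega> \<mu> t u g u" and c: "continuous_on (closure \<Omega>) u"
    and b: "spectral_bound ({} :: nat set) E t"
  shows "\<forall>x\<in>\<Omega>. u x \<noteq> 0"
  using eigen_sign_part_nonzero[OF e]
proof
  assume "L2n m (\<lambda>x. max (u x) 0) \<noteq> 0"
  from cont_first_eigenfunction_pos[OF e c b this] show ?thesis by fastforce
next
  assume "L2n m (\<lambda>x. max (- u x) 0) \<noteq> 0"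
  from cont_first_eigenfunction_pos[OF eigen_uminus[OF e] continuous_on_minus[OF c] b this]
  show ?thesis by fastforce
qed

text \<open>The hypothesis concerns the \<open>\<mu>\<close>-representative, the conclusion Lebesgue
  measure. If the positive part were Lebesgue null, so would be its gradient, and by
  \<open>H01_Poincare\<close> its \<open>\<mu>\<close>-representative.\<close>

lemma pos_part_AE_pos:
  assumes e: "is_eigenfunction \<Omega> \<mu> t u g f" and b: "spectral_bound ({} :: nat set) E t"
    and nz: "L2n m (\<lambda>x. max (f x) 0) \<noteq> 0"
  shows "AE x in l. 0 < u x"
proof -
  note P = pos_part_eigenfunction[OF e b nz]
  have S: "supersolution (\<lambda>x. (if u x > 0 then 1 else 0) *\<^sub>R g x)"
    by (rule eigen_supersolution[OF P]) simp
  have "(AE x in l. max (u x) 0 = 0) \<or> (AE x in l. 0 < max (u x) 0)"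
    by (rule strong_maximum_AE[OF eigenD(1)[OF P] S]) simp
  then show ?thesis
  proof
    assume "AE x in l. max (u x) 0 = 0"
    then have "AE x in l. (if u x > 0 then 1 else 0) *\<^sub>R g x = 0" by eventually_elim auto
    then have "L2n l (\<lambda>x. (if u x > 0 then 1 else 0) *\<^sub>R g x) = 0"
      using L2n_eq_0_iff[OF eigenD(5)[OF P]] by blast
    moreover obtain K where "K \<ge> 0" "\<And>u g f. H01 u g f \<Longrightarrow> L2n l u \<le> K * L2n l g"
      "\<And>u g f. H01 u g f \<Longrightarrow> L2n m f \<le> K * L2n l g"
      by (rule H01_Poincare) (rule that)
    ultimately have "L2n m (\<lambda>x. max (f x) 0) \<le> 0" using eigenD(1)[OF P] by fastforce
    then show ?thesis using nz L2n_nonneg[of m "\<lambda>x. max (f x) 0"] by linarith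
  next
    assume "AE x in l. 0 < max (u x) 0"
    then show ?thesis by eventually_elim auto
  qed
qed

lemma not_AE_l_False: "\<not> (AE x in l. False)"
proof
  assume "AE x in l. False"
  then have a: "AE x in lebesgue. x \<notin> \<Omega>" by (simp add: AE_restr[OF dom_sets(1)])
  obtain x r where x: "r > 0" "ball x r \<subseteq> \<Omega>"
    using nonempty_dom open_dom open_contains_ball by blast
  have "AE y in lebesgue. y \<in> ball x r \<longrightarrow> False" using a by eventually_elim (use x in blast)
  then show False using AE_lebesgue_ball_nontrivial[OF x(1), of x "\<lambda>_. False"] by auto
qed

lemma pos_orthogonal_zero:
  fixes u k :: "'a \<Rightarrow> real"
  assumes u: "L2 m u" "\<And>x. x \<in> \<Omega> \<Longrightarrow> 0 < u x" and k: "L2 m k" "\<And>x. 0 \<le> k x" and o: "ip m u k = 0"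
  shows "L2n m k = 0"
proof -
  have "0 \<le> u x \<bullet> k x" if "x \<in> \<Omega>" for x using u(2)[OF that] k(2)[of x] by simp
  then have nn: "AE x in m. 0 \<le> u x \<bullet> k x" unfolding AE_m by simp
  have "AE x in m. u x \<bullet> k x = 0"
    using o unfolding ip_def
    by (subst (asm) integral_nonneg_eq_0_iff_AE[OF L2_integrable_ip[OF u(1) k(1)] nn])
  moreover have "AE x in m. 0 < u x" unfolding AE_m using u(2) by simp
  ultimately have "AE x in m. k x = 0" by eventually_elim auto
  then show ?thesis using L2n_eq_0_iff[OF k(1)] by blast
qed

text \<open>An eigenfunction orthogonal to a positive one changes sign on \<open>\<mu>\<close>-positive sets; both its
  parts would be first eigenfunctions, hence positive almost everywhere.\<close>

lemma no_first_eigenfunction_orthogonal_to_positive: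
  assumes u: "L2 m u" "\<And>x. x \<in> \<Omega> \<Longrightarrow> 0 < u x"
    and e: "is_eigenfunction \<Omega> \<mu> t v h k" and b: "spectral_bound ({} :: nat set) E t"
    and o: "ip m u k = 0"
  shows False
proof -
  note e' = eigen_uminus[OF e]
  have P: "L2 m (\<lambda>x. max (k x) 0)" "L2 m (\<lambda>x. max (- k x) 0)"
    using H01_L2(3)[OF H01_pos_part[OF eigenD(1)[OF e]]] H01_L2(3)[OF H01_pos_part[OF eigenD(1)[OF e']]] .
  have split: "ip m u k = ip m u (\<lambda>x. max (k x) 0) - ip m u (\<lambda>x. max (- k x) 0)"
  proof -
    have "ip m u k = ip m u (\<lambda>x. max (k x) 0 - max (- k x) 0)"
      by (rule arg_cong[where f="ip m u"]) (auto simp: fun_eq_iff max_def)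
    then show ?thesis using ip_diff_right[OF P u(1)] by simp
  qed
  have zero: "ip m u w = 0" if "L2 m w" "L2n m w = 0" for w
    using ip_Cauchy_Schwarz[OF u(1) that(1)] that(2) by simp
  \<comment> \<open>If one part is \<open>\<mu>\<close>-null, orthogonality to the positive
    \<open>u\<close> makes the other null too. Both cannot be null for an eigenfunction, so neither
    is.\<close>
  have p1: "L2n m (\<lambda>x. max (- k x) 0) = 0" if "L2n m (\<lambda>x. max (k x) 0) = 0"
    by (rule pos_orthogonal_zero[OF u P(2)]) (use zero[OF P(1) that] split o in auto)
  have p2: "L2n m (\<lambda>x. max (k x) 0) = 0" if "L2n m (\<lambda>x. max (- k x) 0) = 0"
    by (rule pos_orthogonal_zero[OF u P(1)]) (use zero[OF P(2) that] split o in auto)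
  from p1 p2 have "L2n m (\<lambda>x. max (k x) 0) = 0 \<longleftrightarrow> L2n m (\<lambda>x. max (- k x) 0) = 0" by blast
  then have "L2n m (\<lambda>x. max (k x) 0) \<noteq> 0" "L2n m (\<lambda>x. max (- k x) 0) \<noteq> 0"
    using eigen_sign_part_nonzero[OF e] by auto
  then have "AE x in l. 0 < v x" "AE x in l. 0 < - v x"
    using pos_part_AE_pos[OF e b] pos_part_AE_pos[OF e' b] by auto
  then have "AE x in l. False" by eventually_elim auto
  then show False using not_AE_l_False by blast
qed

section \<open>Multiplicities and the counting of nodal domains\<close>

lemma orthonormal_eigen_iff:
  "orthonormal_eigen \<Omega> \<mu> t r \<longleftrightarrow> (\<exists>F. (\<forall>i<r. \<exists>u g. is_eigenfunction \<Omega> \<mu> t u g (F i)) \<and>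
     (\<forall>i<r. \<forall>j<r. ip m (F i) (F j) = (if i = j then 1 else 0)))"
proof -
  have eq: "(LINT x:\<Omega>|\<mu>. F i x * F j x) = ip m (F i) (F j)"
    if a: "\<forall>i<r. \<exists>u g. is_eigenfunction \<Omega> \<mu> t u g (F i)" and ij: "i < r" "j < r"
    for F :: "nat \<Rightarrow> 'a \<Rightarrow> real" and i j
  proof -
    obtain u g u' g' where "is_eigenfunction \<Omega> \<mu> t u g (F i)" "is_eigenfunction \<Omega> \<mu> t u' g' (F j)"
      using a ij by blast
    then have "L2 m (F i)" "L2 m (F j)" by (blast intro: eigenD(6))+
    from set_integral_ip(2)[OF this] show ?thesis by simp
  qed
  have iff: "((\<forall>i<r. \<exists>u g. is_eigenfunction \<Omega> \<mu> t u g (F i)) \<and>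
      (\<forall>i<r. \<forall>j<r. (LINT x:\<Omega>|\<mu>. F i x * F j x) = (if i = j then 1 else 0))) \<longleftrightarrow>
    ((\<forall>i<r. \<exists>u g. is_eigenfunction \<Omega> \<mu> t u g (F i)) \<and>
      (\<forall>i<r. \<forall>j<r. ip m (F i) (F j) = (if i = j then 1 else 0)))" for F :: "nat \<Rightarrow> 'a \<Rightarrow> real"
  proof (rule conj_cong[OF refl])
    assume a: "\<forall>i<r. \<exists>u g. is_eigenfunction \<Omega> \<mu> t u g (F i)"
    show "(\<forall>i<r. \<forall>j<r. (LINT x:\<Omega>|\<mu>. F i x * F j x) = (if i = j then 1 else 0)) \<longleftrightarrow>
      (\<forall>i<r. \<forall>j<r. ip m (F i) (F j) = (if i = j then 1 else 0))"
      using eq[OF a] by metis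
  qed
  show ?thesis
    unfolding orthonormal_eigen_def iff ..
qed

lemma orthonormal_eigen_mono:
  assumes "orthonormal_eigen \<Omega> \<mu> t r" "r' \<le> r"
  shows "orthonormal_eigen \<Omega> \<mu> t r'"
proof -
  obtain F where "\<forall>i<r. \<exists>u g. is_eigenfunction \<Omega> \<mu> t u g (F i)"
    "\<forall>i<r. \<forall>j<r. ip m (F i) (F j) = (if i = j then 1 else 0)"
    using assms(1) unfolding orthonormal_eigen_iff by blast
  then show ?thesis
    unfolding orthonormal_eigen_iff using assms(2) by (intro exI[of _ F]) auto
qed

lemma has_multiplicity_unique:
  assumes "has_multiplicity \<Omega> \<mu> t r" "has_multiplicity \<Omega> \<mu> t r'"
  shows "r = r'"
proof (rule ccontr)
  assume "r \<noteq> r'"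
  then consider "Suc r \<le> r'" | "Suc r' \<le> r" by linarith
  then show False using assms orthonormal_eigen_mono unfolding has_multiplicity_def by cases blast+
qed

text \<open>The unconstrained minimum \<open>R\<close> is attained by an eigenfunction and is at
  most \<open>lam 1\<close>. Being an eigenvalue it is some \<open>lam n\<close>, so the ordering
  makes it equal to \<open>lam 1\<close>.\<close>

lemma first_eigenvalue_bound:
  assumes "eigen_arrangement \<Omega> \<mu> lam"
  shows "spectral_bound ({} :: nat set) E (lam 1)"
proof -
  have "is_eigenvalue \<Omega> \<mu> (lam 1)" using assms unfolding eigen_arrangement_def by blast
  then obtain u g f where e: "is_eigenfunction \<Omega> \<mu> (lam 1) u g f" unfolding is_eigenvalue_def by blast
  have sys: "eigen_system ({} :: nat set) \<tau> v h E" for \<tau> v h by (simp add: eigen_system_def)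
  have perp: "perp ({} :: nat set) E k" for k by (simp add: perp_def)
  have "ip l g g \<le> lam 1 * ip m f f" using eigenD(3)[OF e eigenD(1)[OF e]] by simp
  from exists_minimum[OF sys eigenD(1)[OF e] perp eigenD(2)[OF e] this]
  obtain R u' g' f' where R: "R \<le> lam 1" "is_eigenfunction \<Omega> \<mu> R u' g' f'"
    "spectral_bound ({} :: nat set) E R" by metis
  then obtain n where "n \<ge> 1" "lam n = R"
    using assms unfolding eigen_arrangement_def is_eigenvalue_def by metis
  moreover have "lam 1 \<le> lam n" using assms \<open>n \<ge> 1\<close> unfolding eigen_arrangement_def by blast
  ultimately show ?thesis using R by simp
qed

text \<open>Such a \<open>u\<close> would be strictly positive, so it suffices to find a first
  eigenfunction orthogonal to it. If \<open>lam n\<close> differs from \<open>lam 1\<close>, any one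
  will do; otherwise the first eigenspace has dimension at least 2 and contains a suitable
  combination.\<close>

lemma higher_eigenfunction_not_nonneg:
  assumes arr: "eigen_arrangement \<Omega> \<mu> lam" and n: "2 \<le> n"
    and e: "is_eigenfunction \<Omega> \<mu> (lam n) u g u" and c: "continuous_on (closure \<Omega>) u"
    and nn: "\<And>x. x \<in> \<Omega> \<Longrightarrow> 0 \<le> u x"
  shows False
proof -
  have pos: "\<And>x. x \<in> \<Omega> \<Longrightarrow> 0 < u x" using cont_nonneg_eigenfunction_pos[OF e c nn] by blast
  note b = first_eigenvalue_bound[OF arr]
  have no: False if "is_eigenfunction \<Omega> \<mu> (lam 1) v h k" "ip m u k = 0" for v h k
    by (rule no_first_eigenfunction_orthogonal_to_positive[OF eigenD(6)[OF e] pos that(1) b that(2)])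
  show False
  proof (cases "lam n = lam 1")
    case False
    have "is_eigenvalue \<Omega> \<mu> (lam 1)" using arr unfolding eigen_arrangement_def by blast
    then obtain v h k where e1: "is_eigenfunction \<Omega> \<mu> (lam 1) v h k" unfolding is_eigenvalue_def by blast
    show False by (rule no[OF e1 eigen_orthogonal[OF e e1 False]])
  next
    case True
    define M where "M = {k. 1 \<le> k \<and> lam k = lam 1}"
    have "is_eigenvalue \<Omega> \<mu> (lam 1)" using arr unfolding eigen_arrangement_def by blast
    then have M: "finite M" "has_multiplicity \<Omega> \<mu> (lam 1) (card M)"
      using arr unfolding eigen_arrangement_def M_def by blast+
    \<comment> \<open>The indices 1 and \<open>n\<close> both carry the value \<open>lam 1\<close>,
      which forces multiplicity at least 2.\<close>
    have "{1, n} \<subseteq> M" using True n by (auto simp: M_def)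
    then have "card {1, n} \<le> card M" using M(1) by (intro card_mono)
    then have "2 \<le> card M" using n by simp
    then have "orthonormal_eigen \<Omega> \<mu> (lam 1) 2"
      using M(2) orthonormal_eigen_mono unfolding has_multiplicity_def by blast
    then obtain F where F: "\<forall>i<2::nat. \<exists>u g. is_eigenfunction \<Omega> \<mu> (lam 1) u g (F i)"
      "\<forall>i<2. \<forall>j<2. ip m (F i) (F j) = (if i = j then 1 else (0::real))"
      unfolding orthonormal_eigen_iff by blast
    obtain v0 h0 where e0: "is_eigenfunction \<Omega> \<mu> (lam 1) v0 h0 (F 0)"
      using F(1)[rule_format, of 0] by auto
    obtain v1 h1 where e1: "is_eigenfunction \<Omega> \<mu> (lam 1) v1 h1 (F 1)"
      using F(1)[rule_format, of 1] by auto
    note L = eigenD(6)[OF e0] eigenD(6)[OF e1] eigenD(6)[OF e]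
    show False
    proof (cases "ip m u (F 0) = 0")
      case True
      show False by (rule no[OF e0 True])
    next
      case False
      \<comment> \<open>This coefficient removes the component along \<open>u\<close>; the
        combination is nonzero because its inner product with \<open>F 1\<close> is 1.\<close>
      define q where "q = - ip m u (F 1) / ip m u (F 0)"
      have "ip m u (\<lambda>x. F 1 x + q * F 0 x) = ip m u (F 1) + q * ip m u (F 0)"
        using L by (simp add: ip_add_right L2_cmult ip_cmult_right)
      also have "\<dots> = 0" using False by (simp add: q_def)
      finally have o: "ip m u (\<lambda>x. F 1 x + q * F 0 x) = 0" .
      have "ip m (F 1) (\<lambda>x. F 1 x + q * F 0 x) = 1"
        using L F(2) by (simp add: ip_add_right L2_cmult ip_cmult_right)
      then have "L2n m (\<lambda>x. F 1 x + q * F 0 x) \<noteq> 0"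
        using ip_Cauchy_Schwarz[OF L(2) L2_add[OF L(2) L2_cmult[OF L(1), of q]]] by auto
      from no[OF eigen_lincomb[OF e1 e0 this] o] show False .
    qed
  qed
qed

text \<open>The components being disjoint, \<open>G \<bullet> G = g \<bullet> (\<Sum>D. (a D)\<^sup>2 1\<^sub>D g)\<close>, so the weak equation applies.\<close>

lemma nodal_combination:
  assumes e: "is_eigenfunction \<Omega> \<mu> t u g u" and c: "continuous_on (closure \<Omega>) u"
    and bd: "\<And>x. x \<in> frontier \<Omega> \<Longrightarrow> u x = 0"
    and S: "finite S" "S \<subseteq> components (\<Omega> - nodal_set \<Omega> u)"
    and a: "D0 \<in> S" "a D0 \<noteq> (0::real)"
  defines "w \<equiv> \<lambda>x. \<Sum>D\<in>S. a D * (indicator D x * u x)"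
  obtains G where "H01 w G w" "ip l G G = t * ip m w w" "L2n m w \<noteq> 0"
proof -
  define G where "G x = (\<Sum>D\<in>S. a D *\<^sub>R (indicator D x *\<^sub>R g x))" for x
  have HD: "H01 (\<lambda>x. indicator D x * u x) (\<lambda>x. indicator D x *\<^sub>R g x) (\<lambda>x. indicator D x * u x)" if "D \<in> S" for D
    by (rule H01_nodal_component[OF eigenD(1)[OF e] c bd]) (use that S in auto)
  have H: "H01 w G w"
    unfolding w_def G_def by (rule H01_sum[OF S(1) HD])
  have H2: "H01 (\<lambda>x. \<Sum>D\<in>S. (a D)\<^sup>2 * (indicator D x * u x)) (\<lambda>x. \<Sum>D\<in>S. (a D)\<^sup>2 *\<^sub>R (indicator D x *\<^sub>R g x))
    (\<lambda>x. \<Sum>D\<in>S. (a D)\<^sup>2 * (indicator D x * u x))"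
    by (rule H01_sum[OF S(1) HD])
  define s where "s x = (\<Sum>D\<in>S. a D * indicator D x)" for x
  have single: "(\<Sum>D\<in>S. b D * indicator D x) = b D1" if "D1 \<in> S" "x \<in> D1" for b :: "'a set \<Rightarrow> real" and x D1
  proof -
    have "(\<Sum>D\<in>S. b D * indicator D x) = (\<Sum>D\<in>S. if D = D1 then b D else 0)"
    proof (rule sum.cong[OF refl])
      fix D assume D: "D \<in> S"
      show "b D * indicator D x = (if D = D1 then b D else 0)"
        using components_nonoverlap[of D "\<Omega> - nodal_set \<Omega> u" D1] S(2) D that by (auto simp: indicator_def)
    qed
    then show ?thesis using S(1) that by simp
  qed
  have s2: "(\<Sum>D\<in>S. (a D)\<^sup>2 * indicator D x) = s x * s x" for x
  proof (cases "\<exists>D\<in>S. x \<in> D")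
    case True
    then obtain D1 where "D1 \<in> S" "x \<in> D1" by blast
    then show ?thesis using single by (simp add: s_def power2_eq_square)
  next
    case False
    then show ?thesis by (simp add: s_def indicator_def)
  qed
  have ws: "w x = s x * u x" for x by (simp add: w_def s_def sum_distrib_right mult.assoc)
  have Gs: "G x = s x *\<^sub>R g x" for x by (simp add: G_def s_def scaleR_sum_left)
  have w2: "(\<Sum>D\<in>S. (a D)\<^sup>2 * (indicator D x * u x)) = s x * s x * u x" for x
    by (simp add: sum_distrib_right mult.assoc flip: s2)
  have G2: "(\<Sum>D\<in>S. (a D)\<^sup>2 *\<^sub>R (indicator D x *\<^sub>R g x)) = (s x * s x) *\<^sub>R g x" for x
    by (simp add: scaleR_sum_left flip: s2)
  have "ip l G G = ip l g (\<lambda>x. (s x * s x) *\<^sub>R g x)"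
    unfolding ip_def Gs by (simp add: mult.assoc)
  also have "\<dots> = t * ip m u (\<lambda>x. s x * s x * u x)"
    using eigenD(3)[OF e H2] unfolding w2 G2 .
  also have "ip m u (\<lambda>x. s x * s x * u x) = ip m w w"
    unfolding ip_def ws by (simp add: mult_ac)
  finally have en: "ip l G G = t * ip m w w" .
  \<comment> \<open>A zero \<open>\<mu>\<close>-norm would give zero energy, hence
    \<open>w = 0\<close> Lebesgue almost everywhere; but on the open set \<open>D0\<close> it is the
    nonzero multiple \<open>a D0\<close> of \<open>u\<close>, which has no zeros there.\<close>
  have nz: "L2n m w \<noteq> 0"
  proof
    assume z: "L2n m w = 0"
    then have "ip m w w = 0" using L2n_sq[of m w] by simp
    then have G0: "L2n l G = 0" using en by (simp add: L2n_def)
    obtain K where "K \<ge> 0" "\<And>u g f. H01 u g f \<Longrightarrow> L2n l u \<le> K * L2n l g"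
      "\<And>u g f. H01 u g f \<Longrightarrow> L2n m f \<le> K * L2n l g"
      by (rule H01_Poincare) (rule that)
    then have "L2n l w \<le> 0" using H G0 by fastforce
    then have "L2n l w = 0" using L2n_nonneg[of l w] by linarith
    then have ae: "AE x in l. w x = 0" using L2n_eq_0_iff[OF H01_L2(1)[OF H]] by blast
    have D0: "D0 \<in> components (\<Omega> - nodal_set \<Omega> u)" using a S by auto
    note N = nodal_component[OF c D0]
    obtain x r where x: "r > 0" "ball x r \<subseteq> D0" using N(1,3) open_contains_ball by blast
    have "AE y in lebesgue. y \<in> \<Omega> \<longrightarrow> w y = 0" using ae by (simp add: AE_restr[OF dom_sets(1)])
    then have "AE y in lebesgue. y \<in> ball x r \<longrightarrow> w y = 0"
      by eventually_elim (use x N(2) in blast)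
    from AE_lebesgue_ball_nontrivial[OF x(1) this]
    obtain y where y: "y \<in> ball x r" "w y = 0" by (rule bexE)
    then have "y \<in> D0" using x by auto
    then have "s y = a D0" unfolding s_def using a(1) single by blast
    moreover have "u y \<noteq> 0" using N(4) \<open>y \<in> D0\<close> by force
    ultimately show False using y(2) a(2) ws by simp
  qed
  show ?thesis by (rule that[OF H en nz])
qed

text \<open>The system contains an orthonormal family of full multiplicity for every eigenvalue up
  to \<open>lam n\<close>. A minimiser perpendicular to it has one of these eigenvalues and would
  enlarge the corresponding family.\<close>

lemma card_nodal_components_le:
  assumes arr: "eigen_arrangement \<Omega> \<mu> lam" and n: "1 \<le> n"
    and e: "is_eigenfunction \<Omega> \<mu> (lam n) u g u" and c: "continuous_on (closure \<Omega>) u"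
    and bd: "\<And>x. x \<in> frontier \<Omega> \<Longrightarrow> u x = 0"
    and S: "finite S" "S \<subseteq> components (\<Omega> - nodal_set \<Omega> u)"
    and J: "J = {k. 1 \<le> k \<and> lam k \<le> lam n}" "finite J"
  shows "card S \<le> card J"
proof (rule ccontr)
  assume big: "\<not> ?thesis"
  define mult where "mult t = card {k. 1 \<le> k \<and> lam k = t}" for t
  have ev: "is_eigenvalue \<Omega> \<mu> (lam k)" if "1 \<le> k" for k using arr that unfolding eigen_arrangement_def by blast
  have mul: "finite {k. 1 \<le> k \<and> lam k = t}" "has_multiplicity \<Omega> \<mu> t (mult t)" if "is_eigenvalue \<Omega> \<mu> t" for t
    using arr that unfolding eigen_arrangement_def mult_def by blast+
  have ex: "\<forall>t. \<exists>F. t \<in> lam ` J \<longrightarrow> (\<forall>i<mult t. \<exists>u g. is_eigenfunction \<Omega> \<mu> t u g (F i)) \<and>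
     (\<forall>i<mult t. \<forall>j<mult t. ip m (F i) (F j) = (if i = j then 1 else 0))"
  proof
    fix t
    show "\<exists>F. t \<in> lam ` J \<longrightarrow> (\<forall>i<mult t. \<exists>u g. is_eigenfunction \<Omega> \<mu> t u g (F i)) \<and>
     (\<forall>i<mult t. \<forall>j<mult t. ip m (F i) (F j) = (if i = j then 1 else 0))"
    proof (cases "t \<in> lam ` J")
      case True
      then have "orthonormal_eigen \<Omega> \<mu> t (mult t)"
        using mul(2)[of t] ev J(1) unfolding has_multiplicity_def by auto
      then show ?thesis unfolding orthonormal_eigen_iff by blast
    qed auto
  qed
  from choice[OF ex] obtain F where F: "\<forall>t. t \<in> lam ` J \<longrightarrow> (\<forall>i<mult t. \<exists>u g. is_eigenfunction \<Omega> \<mu> t u g (F t i)) \<and>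
     (\<forall>i<mult t. \<forall>j<mult t. ip m (F t i) (F t j) = (if i = j then 1 else 0))" by (rule exE)
  \<comment> \<open>Pairs of an eigenvalue and a position in its orthonormal family. Each eigenvalue
    occurs in \<open>lam\<close> as often as its multiplicity, so there are as many pairs as indices
    in \<open>J\<close>.\<close>
  define I where "I = (SIGMA t : lam ` J. {..<mult t})"
  define E where "E p = F (fst p) (snd p)" for p
  have finI: "finite I" unfolding I_def using J(2) by auto
  have "card I = (\<Sum>t\<in>lam ` J. mult t)" unfolding I_def using J(2) by simp
  also have "\<dots> = (\<Sum>t\<in>lam ` J. \<Sum>k\<in>{k\<in>J. lam k = t}. 1)"
    using J(1) by (intro sum.cong) (auto simp: mult_def intro!: arg_cong[where f=card])
  also have "\<dots> = card J" using sum.image_gen[OF J(2), of "\<lambda>_. 1::nat" lam] by simp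
  finally have cardI: "card I = card J" .
  have "\<forall>p. \<exists>vh. p \<in> I \<longrightarrow> is_eigenfunction \<Omega> \<mu> (fst p) (fst vh) (snd vh) (E p)"
    using F by (auto simp: I_def E_def)
  from choice[OF this] obtain vh where vh: "\<forall>p. p \<in> I \<longrightarrow> is_eigenfunction \<Omega> \<mu> (fst p) (fst (vh p)) (snd (vh p)) (E p)"
    by (rule exE)
  have sys: "eigen_system I fst (\<lambda>p. fst (vh p)) (\<lambda>p. snd (vh p)) E"
    unfolding eigen_system_def
  proof (intro conjI ballI)
    fix p q assume pq: "p \<in> I" "q \<in> I"
    show "ip m (E p) (E q) = (if p = q then 1 else 0)"
    proof (cases "fst p = fst q")
      case True
      then show ?thesis using F pq by (auto simp: I_def E_def prod_eq_iff)
    next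
      case False
      then show ?thesis using eigen_orthogonal vh pq by (metis prod_eq_iff)
    qed
  qed (use finI vh in auto)
  define W where "W D = (\<lambda>x. indicator D x * u x)" for D :: "'a set"
  have HW: "L2 m (W D)" if "D \<in> S" for D
    unfolding W_def using H01_L2(3)[OF H01_nodal_component[OF eigenD(1)[OF e] c bd]] that S by auto
  have "card I < card S" using big cardI by simp
  from homogeneous_system_nontrivial[OF finI S(1) this, of "\<lambda>D p. ip m (W D) (E p)"]
  obtain a where a: "\<exists>D\<in>S. a D \<noteq> 0" "\<forall>p\<in>I. (\<Sum>D\<in>S. a D * ip m (W D) (E p)) = 0" by blast
  then obtain D0 where D0: "D0 \<in> S" "a D0 \<noteq> 0" by blast
  define w where "w x = (\<Sum>D\<in>S. a D * (indicator D x * u x))" for x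
  obtain G where G: "H01 w G w" "ip l G G = lam n * ip m w w" "L2n m w \<noteq> 0"
    by (rule nodal_combination[where a=a, OF e c bd S D0, folded w_def[abs_def]]) (assumption, rule that)
  have perp: "perp I E w"
    unfolding perp_def
  proof
    fix p assume p: "p \<in> I"
    then have LE: "L2 m (E p)" using vh eigenD(6) by blast
    have "w = (\<lambda>x. \<Sum>D\<in>S. a D * W D x)" by (simp add: fun_eq_iff w_def W_def)
    then have "ip m w (E p) = (\<Sum>D\<in>S. ip m (\<lambda>x. a D * W D x) (E p))"
      using HW LE by (simp add: ip_sum_left L2_cmult)
    then show "ip m w (E p) = 0" using a(2) p by (simp add: ip_cmult_left)
  qed
  obtain R v h f where R: "R \<le> lam n" "is_eigenfunction \<Omega> \<mu> R v h f" "perp I E f" "ip m f f = 1"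
    "spectral_bound I E R"
    by (rule exists_minimum[OF sys G(1) perp G(3) eq_refl[OF G(2)]]) (rule that)
  have evR: "is_eigenvalue \<Omega> \<mu> R" using R(2) unfolding is_eigenvalue_def by blast
  then obtain k where k: "k \<ge> 1" "lam k = R" using arr unfolding eigen_arrangement_def by blast
  then have RJ: "R \<in> lam ` J" using R(1) J(1) by auto
  have fE: "ip m f (F R i) = 0" if "i < mult R" for i
    using R(3) RJ that unfolding perp_def by (auto simp: I_def E_def)
  \<comment> \<open>The minimiser \<open>f\<close> is appended to the family of \<open>R\<close> in
    the last position.\<close>
  have "orthonormal_eigen \<Omega> \<mu> R (Suc (mult R))"
    unfolding orthonormal_eigen_iff
  proof (intro exI[of _ "\<lambda>i. if i < mult R then F R i else f"] conjI allI impI)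
    fix i assume "i < Suc (mult R)"
    then show "\<exists>u g. is_eigenfunction \<Omega> \<mu> R u g (if i < mult R then F R i else f)"
      using F RJ R(2) by auto
  next
    fix i j assume ij: "i < Suc (mult R)" "j < Suc (mult R)"
    show "ip m (if i < mult R then F R i else f) (if j < mult R then F R j else f) = (if i = j then 1 else 0)"
      using F[rule_format, OF RJ] fE[of i] fE[of j] R(4) ij ip_commute[of m f "F R i"] by auto
  qed
  then show False using mul(2)[OF evR] unfolding has_multiplicity_def by blast
qed

lemma nodal_domain_count:
  assumes arr: "eigen_arrangement \<Omega> \<mu> lam" and n: "2 \<le> n" and r: "has_multiplicity \<Omega> \<mu> (lam n) r"
    and u: "cont_eigenfunction \<Omega> \<mu> (lam n) u"
  shows "2 \<le> card (components (\<Omega> - nodal_set \<Omega> u))"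
    "card (components (\<Omega> - nodal_set \<Omega> u)) \<le> n + r - 1"
proof -
  define P where "P = \<Omega> - nodal_set \<Omega> u"
  obtain g where c: "continuous_on (closure \<Omega>) u" and bd: "\<And>x. x \<in> frontier \<Omega> \<Longrightarrow> u x = 0"
    and e: "is_eigenfunction \<Omega> \<mu> (lam n) u g u"
    using u unfolding cont_eigenfunction_def by blast
  define M where "M = {k. 1 \<le> k \<and> lam k = lam n}"
  have "is_eigenvalue \<Omega> \<mu> (lam n)" using e unfolding is_eigenvalue_def by blast
  then have M: "finite M" "has_multiplicity \<Omega> \<mu> (lam n) (card M)"
    using arr unfolding eigen_arrangement_def M_def by blast+
  have rM: "r = card M" using has_multiplicity_unique[OF r M(2)] .
  define J where "J = {k. 1 \<le> k \<and> lam k \<le> lam n}"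
  have "lam n \<le> lam k" if "n \<le> k" for k using arr n that unfolding eigen_arrangement_def by auto
  \<comment> \<open>Indices up to \<open>n - 1\<close> account for at most \<open>n - 1\<close>; any
    further index in \<open>J\<close> is forced by monotonicity to carry the value
    \<open>lam n\<close>, which happens for \<open>r\<close> indices in all.\<close>
  then have JM: "J \<subseteq> {1..<n} \<union> M" by (force simp: J_def M_def not_le intro: antisym)
  have finJ: "finite J" using JM M(1) by (auto intro: finite_subset)
  have "card J \<le> card ({1..<n} \<union> M)" using JM M(1) by (intro card_mono) auto
  also have "\<dots> \<le> card {1..<n} + card M" by (rule card_Un_le)
  finally have cJ: "card J \<le> n + r - 1" using rM n by simp
  have le: "card S \<le> card J" if "finite S" "S \<subseteq> components P" for S
    by (rule card_nodal_components_le[OF arr _ e c bd that(1) _ J_def finJ]) (use n that in \<open>auto simp: P_def\<close>)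
  \<comment> \<open>Needed for both bounds: \<open>card\<close> is 0 on an infinite set, so the
    estimate is first applied to finite subfamilies.\<close>
  have fin: "finite (components P)"
  proof (rule ccontr)
    assume "infinite (components P)"
    then obtain S where "finite S" "card S = Suc (card J)" "S \<subseteq> components P"
      using infinite_arbitrarily_large by blast
    then show False using le by fastforce
  qed
  show "card (components (\<Omega> - nodal_set \<Omega> u)) \<le> n + r - 1"
    using le[OF fin order_refl] cJ unfolding P_def by linarith
  show "2 \<le> card (components (\<Omega> - nodal_set \<Omega> u))"
  proof (rule ccontr)
    assume "\<not> ?thesis"
    then have "card (components P) = 0 \<or> card (components P) = 1" unfolding P_def by linarith
    \<comment> \<open>Without components \<open>u\<close> vanishes on \<open>\<Omega>\<close>; with
      a single one it has one sign off its nodal set.\<close>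
    then have "(\<forall>x\<in>\<Omega>. 0 \<le> u x) \<or> (\<forall>x\<in>\<Omega>. 0 \<le> - u x)"
    proof
      assume "card (components P) = 0"
      then have "components P = {}" using fin by simp
      then have "P = {}" by (simp add: components_eq_empty)
      then show ?thesis by (auto simp: P_def nodal_set_def)
    next
      assume "card (components P) = 1"
      then obtain D where D: "components P = {D}" by (rule card_1_singletonE)
      then have PD: "P = D" using Union_components[of P] by simp
      have "D \<in> components (\<Omega> - nodal_set \<Omega> u)" using D unfolding P_def by simp
      from nodal_component(4)[OF c this] show ?thesis
      proof
        assume "\<forall>x\<in>D. u x > 0"
        then have "0 \<le> u x" if "x \<in> \<Omega>" for x
          using that PD by (cases "x \<in> P") (auto simp: P_def nodal_set_def less_imp_le)
        then have "\<forall>x\<in>\<Omega>. 0 \<le> u x" by blast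
        then show ?thesis ..
      next
        assume "\<forall>x\<in>D. u x < 0"
        then have "0 \<le> - u x" if "x \<in> \<Omega>" for x
          using that PD by (cases "x \<in> P") (auto simp: P_def nodal_set_def less_imp_le)
        then have "\<forall>x\<in>\<Omega>. 0 \<le> - u x" by blast
        then show ?thesis ..
      qed
    qed
    then show False
    proof
      assume "\<forall>x\<in>\<Omega>. 0 \<le> u x"
      then show False using higher_eigenfunction_not_nonneg[OF arr n e c] by blast
    next
      assume "\<forall>x\<in>\<Omega>. 0 \<le> - u x"
      then show False
        using higher_eigenfunction_not_nonneg[OF arr n eigen_uminus[OF e] continuous_on_minus[OF c]] by blast
    qed
  qed
qed

end

theorem theorem1p1:
  fixes \<Omega> :: "'a::euclidean_space set" and \<mu> :: "'a measure" and lam :: "nat \<Rightarrow> real"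
  assumes "open \<Omega>" and "connected \<Omega>" and "bounded \<Omega>" and "\<Omega> \<noteq> {}"
    and "sets \<mu> = sets borel" and "finite_measure \<mu>"
    and "msupp \<mu> \<subseteq> closure \<Omega>" and "emeasure \<mu> \<Omega> > 0"
    and "lower_Linf_dim \<mu> > ereal (real DIM('a) - 2)"
    and "eigen_arrangement \<Omega> \<mu> lam"
  shows "(\<forall>u. cont_eigenfunction \<Omega> \<mu> (lam 1) u \<longrightarrow> (\<forall>x\<in>\<Omega>. u x \<noteq> 0))
       \<and> (\<forall>n r u. 2 \<le> n \<longrightarrow> 1 \<le> r \<longrightarrow> has_multiplicity \<Omega> \<mu> (lam n) r \<longrightarrow>
            cont_eigenfunction \<Omega> \<mu> (lam n) u \<longrightarrow>
              2 \<le> card (components (\<Omega> - nodal_set \<Omega> u))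
            \<and> card (components (\<Omega> - nodal_set \<Omega> u)) \<le> n + r - 1)"
proof -
  interpret dirichlet_space \<Omega> \<mu>
    by (rule dirichlet_space.intro) (rule assms)+
  show ?thesis
  proof (intro conjI allI impI)
    fix u assume "cont_eigenfunction \<Omega> \<mu> (lam 1) u"
    then show "\<forall>x\<in>\<Omega>. u x \<noteq> 0"
      using first_eigenfunction_nonvanishing[OF _ _ first_eigenvalue_bound[OF assms(10)]]
      unfolding cont_eigenfunction_def by blast
  qed (use nodal_domain_count[OF assms(10)] in blast)+
qed

end
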